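(* Suppose that $E(w(1)+w(2))=1$ and $\sum_{i\in S}P(w(i)=1)<1$. Then, $P$-a.s., the Hausdorff dimension of the random metric space $(T,R)$ satisfies $\dim_H(T)\leq\alpha$, where $\alpha$ is the unique positive solution of $E\left(\sum_{i\in S}w(i)^\alpha\right)=1$.
   Context: Addresses: $S:=\{1,2,3\}$; $\Sigma_n:=S^n$ (with $\Sigma_0:=\{\emptyset\}$), $\Sigma_*:=\bigcup_{n\ge0}\Sigma_n$; $ij$ denotes concatenation, $|i|$ the length of $i\in\Sigma_*$, and $i|m$ the truncation of $i$ to its first $m$ letters. Fractal: fix $c\in(0,1/2)$ and maps on $\mathbb{R}^2$: $\psi_1(x,y)=\frac12(1-x,y)$, $\psi_2(x,y)=\frac12(1+x,-y)$, $\psi_3(x,y)=(\frac12+cy,cx)$. $T$ is the unique non-empty compact subset of $\mathbb{R}^2$ with $T=\bigcup_{i\in S}\psi_i(T)$. For $i\in\Sigma_n$, $\psi_i:=\psi_{i_1}\circ\dots\circ\psi_{i_n}$ ($\psi_\emptyset$ is the identity). $V^0:=\{(0,0),(1,0)\}$, $V^n:=\bigcup_{i\in\Sigma_n}\psi_i(V^0)$, $V^*:=\bigcup_{n\ge0}V^n$. $T$ is the Euclidean closure of $V^*$. Cascade: $(w(i))_{i\in\Sigma_*\setminus\{\emptyset\}}$ are random variables on a probability space with measure $P$ (expectation $E$), with values in $[0,1]$ and non-zero $P$-a.s., such that the triples $(w(ij))_{j\in S}$, $i\in\Sigma_*$, are independent copies of $(w(j))_{j\in S}$ (no independence is assumed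 within a triple). $l(\emptyset):=1$, $l(i):=w(i|1)w(i|2)\cdots w(i)$. Under the condition $E(w(1)+w(2))=1$, the limits $R_i:=\lim_{n\to\infty}\sum_{j\in\{1,2\}^n}l(ij)/l(i)$, $i\in\Sigma_*$, exist in $(0,\infty)$ $P$-a.s. Random metric: for $f:V^n\to\mathbb{R}$ let $\mathcal{E}^n(f,f):=\sum_{i\in\Sigma_n}\frac{1}{l(i)R_i}\left(f(\psi_i(0,0))-f(\psi_i(1,0))\right)^2$. For $f:V^*\to\mathbb{R}$ let $\mathcal{E}^*(f,f):=\lim_{n\to\infty}\mathcal{E}^n(f|_{V^n},f|_{V^n})$, with domain $\mathcal{F}^*$ the set of $f$ for which this limit exists finitely. Define $R^*(x,x)=0$ and, for $x\ne y$ in $V^*$, $R^*(x,y)^{-1}:=\inf\{\mathcal{E}^*(f,f): f\in\mathcal{F}^*, f(x)=0, f(y)=1\}$; this is $P$-a.s. a metric on $V^*$. Under the conditions $E(w(1)+w(2))=1$ and $\sum_{i\in S}P(w(i)=1)<1$, $P$-a.s. $R(x,y):=\lim_{n\to\infty}R^*(x_n,y_n)$, for any $x_n,y_n\in V^*$ converging in Euclidean distance to $x,y\in T$, is a well-defined metric on $T$ inducing the Euclidean topology; the Hausdorff dimension $\dim_H(T)$ is taken with respect to $R$. These two conditions also guarantee that the equation $E(\sum_{i\in S}w(i)^\theta)=1$ has a unique positive solution $\theta=\alpha$, and $\alpha\in(1,\infty)$. *)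

theory Defs
  imports "HOL-Probability.Probability"
begin

text \<open>The metric of interest is not that of the ambient type, so the Hausdorff dimension takes the
  carrier \<open>X\<close> and the distance \<open>d\<close> as parameters.\<close>

definition diam_of :: "('a \<Rightarrow> 'a \<Rightarrow> real) \<Rightarrow> 'a set \<Rightarrow> ennreal" where
  "diam_of d U = (SUP x\<in>U. SUP y\<in>U. ennreal (d x y))"

text \<open>Only sets of finite diameter occur in the covers, so \<open>enn2real\<close> loses nothing.\<close>

definition hausdorff_premeasure ::
  "'a set \<Rightarrow> ('a \<Rightarrow> 'a \<Rightarrow> real) \<Rightarrow> real \<Rightarrow> real \<Rightarrow> ennreal" where
  "hausdorff_premeasure X d s \<delta> =
     (INF U\<in>{U :: nat \<Rightarrow> 'a set. (\<forall>n. U n \<subseteq> X) \<and> X \<subseteq> (\<Union>n. U n) \<and>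
                (\<forall>n. diam_of d (U n) \<le> ennreal \<delta>)}.
        \<Sum>n. ennreal (enn2real (diam_of d (U n)) powr s))"

definition hausdorff_measure :: "'a set \<Rightarrow> ('a \<Rightarrow> 'a \<Rightarrow> real) \<Rightarrow> real \<Rightarrow> ennreal" where
  "hausdorff_measure X d s = (SUP \<delta>\<in>{0<..}. hausdorff_premeasure X d s \<delta>)"

text \<open>The exponent \<open>s = 0\<close> is excluded, which does not change the infimum; it avoids the
  convention \<open>0 powr 0 = 0\<close>, under which the above is not the counting measure for \<open>s = 0\<close>.
  The infimum is taken in the extended reals, so it is \<open>\<infinity>\<close> if no \<open>s\<close> qualifies.\<close>

definition hausdorff_dim :: "'a set \<Rightarrow> ('a \<Rightarrow> 'a \<Rightarrow> real) \<Rightarrow> ereal" where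
  "hausdorff_dim X d = Inf {ereal s | s. 0 < s \<and> hausdorff_measure X d s = 0}"

text \<open>Addresses are lists of letters; concatenation \<open>ij\<close> is \<open>i @ j\<close> and the truncation \<open>i|m\<close> is
  \<open>take m i\<close>.\<close>

definition letters :: "nat set" where
  "letters = {1, 2, 3}"

definition words :: "nat set \<Rightarrow> nat \<Rightarrow> nat list set" where
  "words A n = {i. set i \<subseteq> A \<and> length i = n}"

definition addresses :: "nat list set" where
  "addresses = (\<Union>n. words letters n)"

text \<open>Only the letters 1, 2, 3 are relevant, so the last branch is \<open>\<psi>\<^sub>3\<close>.\<close>

definition psi :: "real \<Rightarrow> nat \<Rightarrow> real \<times> real \<Rightarrow> real \<times> real" where
  "psi c k = (\<lambda>(x, y).
     if k = 1 then ((1 - x) / 2, y / 2)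
     else if k = 2 then ((1 + x) / 2, - y / 2)
     else (1 / 2 + c * y, c * x))"

fun psi_word :: "real \<Rightarrow> nat list \<Rightarrow> real \<times> real \<Rightarrow> real \<times> real" where
  "psi_word c [] = id"
| "psi_word c (k # i) = psi c k \<circ> psi_word c i"

definition fractal :: "real \<Rightarrow> (real \<times> real) set" where
  "fractal c = (THE K. K \<noteq> {} \<and> compact K \<and> K = (\<Union>k\<in>letters. psi c k ` K))"

definition vertices :: "real \<Rightarrow> nat \<Rightarrow> (real \<times> real) set" where
  "vertices c n = (\<Union>i\<in>words letters n. psi_word c i ` {(0, 0), (1, 0)})"

definition all_vertices :: "real \<Rightarrow> (real \<times> real) set" where
  "all_vertices c = (\<Union>n. vertices c n)"

text \<open>Here \<open>v\<close> is one realisation of the weights, \<open>v i = w i \<omega>\<close>; only its values at non-empty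
  addresses are used.\<close>

definition cascade :: "(nat list \<Rightarrow> real) \<Rightarrow> nat list \<Rightarrow> real" where
  "cascade v i = (\<Prod>m = 1..length i. v (take m i))"

definition cascade_limit :: "(nat list \<Rightarrow> real) \<Rightarrow> nat list \<Rightarrow> real" where
  "cascade_limit v i = lim (\<lambda>n. \<Sum>j\<in>words {1, 2} n. cascade v (i @ j) / cascade v i)"

text \<open>A function on \<open>V\<^sup>n\<close> or \<open>V\<^sup>*\<close> is represented by any function on the plane extending it;
  the quantities below depend only on the values at vertices.\<close>

definition energy ::
  "real \<Rightarrow> (nat list \<Rightarrow> real) \<Rightarrow> nat \<Rightarrow> (real \<times> real \<Rightarrow> real) \<Rightarrow> real" where
  "energy c v n f =
     (\<Sum>i\<in>words letters n. 1 / (cascade v i * cascade_limit v i) *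
        (f (psi_word c i (0, 0)) - f (psi_word c i (1, 0)))\<^sup>2)"

definition energy_domain ::
  "real \<Rightarrow> (nat list \<Rightarrow> real) \<Rightarrow> (real \<times> real \<Rightarrow> real) set" where
  "energy_domain c v = {f. convergent (\<lambda>n. energy c v n f)}"

definition energy_limit ::
  "real \<Rightarrow> (nat list \<Rightarrow> real) \<Rightarrow> (real \<times> real \<Rightarrow> real) \<Rightarrow> real" where
  "energy_limit c v f = lim (\<lambda>n. energy c v n f)"

definition resistance_vertices ::
  "real \<Rightarrow> (nat list \<Rightarrow> real) \<Rightarrow> real \<times> real \<Rightarrow> real \<times> real \<Rightarrow> real" where
  "resistance_vertices c v x y =
     (if x = y then 0
      else inverse (Inf {energy_limit c v f | f. f \<in> energy_domain c v \<and> f x = 0 \<and> f y = 1}))"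

definition resistance ::
  "real \<Rightarrow> (nat list \<Rightarrow> real) \<Rightarrow> real \<times> real \<Rightarrow> real \<times> real \<Rightarrow> real" where
  "resistance c v x y =
     (THE r. \<forall>xs ys. range xs \<subseteq> all_vertices c \<longrightarrow> range ys \<subseteq> all_vertices c \<longrightarrow>
        xs \<longlonglongrightarrow> x \<longrightarrow> ys \<longlonglongrightarrow> y \<longrightarrow>
        (\<lambda>n. resistance_vertices c v (xs n) (ys n)) \<longlonglongrightarrow> r)"

definition triple :: "(nat list \<Rightarrow> 'a \<Rightarrow> real) \<Rightarrow> nat list \<Rightarrow> 'a \<Rightarrow> nat \<Rightarrow> real" where
  "triple w i \<omega> = (\<lambda>j\<in>letters. w (i @ [j]) \<omega>)"

definition triple_space :: "(nat \<Rightarrow> real) measure" where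
  "triple_space = Pi\<^sub>M letters (\<lambda>_. borel)"

definition random_cascade :: "'a measure \<Rightarrow> (nat list \<Rightarrow> 'a \<Rightarrow> real) \<Rightarrow> bool" where
  "random_cascade M w \<longleftrightarrow>
     prob_space M \<and>
     (\<forall>i\<in>addresses - {[]}. w i \<in> borel_measurable M \<and>
        (\<forall>\<omega>\<in>space M. 0 \<le> w i \<omega> \<and> w i \<omega> \<le> 1) \<and> (AE \<omega> in M. w i \<omega> \<noteq> 0)) \<and>
     prob_space.indep_vars M (\<lambda>_. triple_space) (triple w) addresses \<and>
     (\<forall>i\<in>addresses. distr M triple_space (triple w i) = distr M triple_space (triple w []))"

end

theory Submission
  imports Defs
begin

text \<open>The resistance of the edge with address \<open>i\<close> is \<open>l(i) R\<^sub>i\<close>. By the recursion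
  \<open>R\<^sub>i = w(i1) R\<^bsub>i1\<^esub> + w(i2) R\<^bsub>i2\<^esub>\<close> the energies are compatible networks, so a function of finite
  energy changes along an edge by at most the square root of its resistance times the energy. Chaining
  such estimates through the levels bounds the \<open>s\<close>-th power of the diameter of the cell \<open>i\<close> by
  a geometrically weighted sum of the numbers \<open>(l(ij) R\<^bsub>ij\<^esub>)\<^sup>s\<close>. Hence everything, including the
  extension of the metric to the fractal, follows once the sums of \<open>(l(i) R\<^sub>i)\<^sup>s\<close> over the \<open>n\<close>-th
  level decay exponentially in \<open>n\<close> for each \<open>s > \<alpha>\<close>. Since \<open>l(i)\<close> and \<open>R\<^sub>i\<close> are independent,
  their expectation is at most \<open>(E \<Sum>\<^sub>k w(k)\<^sup>s)\<^sup>n\<close> times a bound for \<open>E R\<^sub>i\<^sup>s\<close>, and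
  \<open>E \<Sum>\<^sub>k w(k)\<^sup>s < 1\<close>. The moments of \<open>R\<^sub>i\<close> are finite because
  \<open>E (w(1)\<^sup>p + w(2)\<^sup>p) < 1\<close> for \<open>p > 1\<close>. All moment bounds are uniform in the address, so
  that the equality in law of the subtrees is never needed.\<close>

section \<open>Addresses and the geometry of the fractal\<close>

text \<open>Since \<open>resistance\<close> is a definite description, nothing follows about it
  until the limit is known to exist and to be the same for all approximating sequences. The decay of
  the edge sums therefore serves two purposes: it bounds the sums over covers, and it makes the
  cells shrink uniformly in the resistance between vertices. The geometry enters through one fact:
  distinct cells of a level meet only at images of the two endpoints. It makes the extension of
  functions to new vertices unambiguous, and it joins any two vertices near a point of the fractal
  through at most two cells. Estimates are made for the square root of the resistance. The
  inequality \<open>\<bar>f x - f y\<bar> \<le> b * sqrt (E f)\<close> is additive along chains,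
  whereas the resistance itself is only an inverse of an infimum. The exponent \<open>s\<close>
  exceeds \<alpha>, which may be arbitrarily large, so convergence in mean square is not enough and
  moments of every order are bounded. Positivity of the limits needs its own argument, as
  convergence alone does not exclude a limit 0.\<close>

lemma letters_iff: "k \<in> letters \<longleftrightarrow> k = 1 \<or> k = 2 \<or> k = 3"
  by (auto simp: letters_def)

lemma letters_simps [simp]: "1 \<in> letters" "Suc 0 \<in> letters" "2 \<in> letters" "3 \<in> letters"
  by (auto simp: letters_def)

lemma finite_letters [simp]: "finite letters"
  by (simp add: letters_def)

lemma finite_words [simp]: "finite A \<Longrightarrow> finite (words A n)"
  unfolding words_def by (rule finite_lists_length_eq)

lemma words_0 [simp]: "words A 0 = {[]}"
  by (auto simp: words_def)

lemma words_Suc: "words A (Suc n) = (\<Union>k\<in>A. (#) k ` words A n)"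
  by (auto simp: words_def length_Suc_conv image_iff) 

lemma append_words: "i \<in> words A m \<Longrightarrow> j \<in> words A n \<Longrightarrow> i @ j \<in> words A (m + n)"
  by (auto simp: words_def)

lemma snoc_words: "i \<in> words A n \<Longrightarrow> k \<in> A \<Longrightarrow> i @ [k] \<in> words A (Suc n)"
  by (auto simp: words_def)

lemma words_addE:
  assumes "i \<in> words A (m + n)"
  obtains j k where "i = j @ k" "j \<in> words A m" "k \<in> words A n"
proof
  show "i = take m i @ drop m i" by simp
  show "take m i \<in> words A m" "drop m i \<in> words A n"
    using assms set_take_subset[of m i] set_drop_subset[of m i] by (auto simp: words_def)
qed

lemma addresses_words: "i \<in> addresses \<longleftrightarrow> i \<in> words letters (length i)"
  by (auto simp: addresses_def words_def)

lemma words_addresses: "i \<in> words letters n \<Longrightarrow> i \<in> addresses"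
  by (auto simp: addresses_def)

lemma addresses_iff: "i \<in> addresses \<longleftrightarrow> set i \<subseteq> letters"
  by (auto simp: addresses_def words_def)

lemma snoc_addresses: "i \<in> addresses \<Longrightarrow> k \<in> letters \<Longrightarrow> i @ [k] \<in> addresses"
  by (simp add: addresses_iff)

lemma sum_words_add:
  "(\<Sum>i\<in>words A (m + n). f i) = (\<Sum>i\<in>words A m. \<Sum>j\<in>words A n. f (i @ j))"
proof -
  have "bij_betw (\<lambda>(i, j). i @ j) (words A m \<times> words A n) (words A (m + n))"
    by (rule bij_betw_imageI)
      (auto simp: inj_on_def append_words words_def elim!: words_addE[unfolded words_def]
        intro!: image_eqI)
  then have "sum f (words A (m + n)) = (\<Sum>(i, j)\<in>words A m \<times> words A n. f (i @ j))"
    by (subst sum.reindex_bij_betw[symmetric, of "\<lambda>(i, j). i @ j"]) (auto intro!: sum.cong)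
  then show ?thesis
    by (simp add: sum.cartesian_product)
qed

lemma sum_words_Suc:
  "(\<Sum>i\<in>words A (Suc n). f i) = (\<Sum>i\<in>words A n. \<Sum>k\<in>A. f (i @ [k]))"
proof -
  have "words A 1 = (\<lambda>k. [k]) ` A"
    by (auto simp: words_def length_Suc_conv)
  then show ?thesis
    using sum_words_add[of f A n 1] by (simp add: sum.reindex inj_on_def o_def)
qed

section \<open>The three maps and an invariant rhombus\<close>

lemma psi_word_append: "psi_word c (i @ j) = psi_word c i \<circ> psi_word c j"
  by (induction i) auto

lemma psi_word_Cons_image: "psi_word c (k # i) ` S = psi c k ` psi_word c i ` S"
  by (simp add: image_comp o_def)

lemma psi_values:
  "psi c 1 (x, y) = ((1 - x) / 2, y / 2)"
  "psi c (Suc 0) (x, y) = ((1 - x) / 2, y / 2)"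
  "psi c 2 (x, y) = ((1 + x) / 2, - y / 2)"
  "psi c 3 (x, y) = (1 / 2 + c * y, c * x)"
  by (auto simp: psi_def)

text \<open>The closed rhombus with corners \<open>(0, 0)\<close>, \<open>(1, 0)\<close>,
  \<open>(1/2, c)\<close> and \<open>(1/2, - c)\<close>; the upper corner is the tip
  \<open>psi c 3 (1, 0)\<close> of the first branch. It contains the fractal, and its images are
  simple enough to be separated by inequalities.\<close>

definition rhombus :: "real \<Rightarrow> (real \<times> real) set" where
  "rhombus c = {(x, y). \<bar>y\<bar> \<le> 2 * c * x \<and> \<bar>y\<bar> \<le> 2 * c * (1 - x)}"

lemma rhombus_fst: 
  assumes "0 < c" "(x, y) \<in> rhombus c" shows "0 \<le> x" "x \<le> 1"
proof -
  have "0 \<le> 2 * c * x" "0 \<le> 2 * c * (1 - x)" using assms(2) by (auto simp: rhombus_def)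
  then show "0 \<le> x" "x \<le> 1" using assms(1) by (simp_all add: zero_le_mult_iff)
qed

lemma dist_psi_le:
  assumes c: "0 < c" "c < 1 / 2" and k: "k \<in> letters"
  shows "dist (psi c k p) (psi c k q) \<le> dist p q / 2"
proof -
  obtain x y x' y' where pq: "p = (x, y)" "q = (x', y')" by (meson surj_pair)
  have "dist (psi c k p) (psi c k q) ^ 2 \<le> (dist p q / 2) ^ 2"
  proof -
    have d: "dist p q ^ 2 = (x - x')\<^sup>2 + (y - y')\<^sup>2"
      by (simp add: pq dist_Pair_Pair dist_real_def)
    have cc: "c\<^sup>2 \<le> (1 / 2)\<^sup>2" using c by (intro power_mono) auto
    consider "k = 1" | "k = 2" | "k = 3" using k by (auto simp: letters_iff)
    then show ?thesis
    proof cases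
      case 1
      show ?thesis
        by (simp add: power_divide d, simp add: 1 pq psi_values dist_Pair_Pair dist_real_def)
          (simp add: power2_eq_square field_simps)
    next
      case 2
      show ?thesis
        by (simp add: power_divide d, simp add: 2 pq psi_values dist_Pair_Pair dist_real_def)
          (simp add: power2_eq_square field_simps)
    next
      case 3
      have "c\<^sup>2 * ((x - x')\<^sup>2 + (y - y')\<^sup>2) \<le> (1 / 2)\<^sup>2 * ((x - x')\<^sup>2 + (y - y')\<^sup>2)"
        using cc by (intro mult_right_mono) auto
      then show ?thesis
        by (simp add: power_divide d, simp add: 3 pq psi_values dist_Pair_Pair dist_real_def)
          (simp add: power2_eq_square field_simps)
    qed
  qed
  then show ?thesis by (rule power2_le_imp_le) simp
qed

lemma continuous_on_psi: "continuous_on S (psi c k)"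
proof -
  have "psi c k = (\<lambda>p. if k = 1 then ((1 - fst p) / 2, snd p / 2)
     else if k = 2 then ((1 + fst p) / 2, - snd p / 2) else (1 / 2 + c * snd p, c * fst p))"
    by (auto simp: psi_def fun_eq_iff)
  then show ?thesis
    by (cases "k = 1"; cases "k = 2") (auto intro!: continuous_intros)
qed

lemma continuous_on_psi_word: "continuous_on S (psi_word c i)"
proof (induction i arbitrary: S)
  case (Cons k i)
  show ?case
    using continuous_on_compose[OF Cons continuous_on_psi] by (simp add: o_def)
qed simp

lemma inj_psi: "0 < c \<Longrightarrow> inj (psi c k)"
  by (auto simp: inj_def psi_def split: if_splits)

lemma inj_psi_word: "0 < c \<Longrightarrow> inj (psi_word c i)"
proof (induction i)
  case (Cons k i)
  then show ?case using inj_compose[OF inj_psi, of c "psi_word c i" k] by (simp add: o_def)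
qed (simp add: inj_on_def)

lemma psi_rhombus:
  assumes c: "0 < c" "c < 1 / 2" and k: "k \<in> letters" and p: "p \<in> rhombus c"
  shows "psi c k p \<in> rhombus c"
proof -
  obtain x y where xy: "p = (x, y)" by (meson surj_pair)
  from p have h: "\<bar>y\<bar> \<le> 2 * c * x" "\<bar>y\<bar> \<le> 2 * c * (1 - x)" by (auto simp: rhombus_def xy)
  have x: "0 \<le> x" "x \<le> 1"
    using p rhombus_fst[OF c(1)] by (auto simp: xy)
  consider "k = 1" | "k = 2" | "k = 3" using k by (auto simp: letters_iff)
  then show ?thesis
  proof cases
    case 1
    have "\<bar>y\<bar> \<le> 2 * c * (1 + x)" 
      using h(1) c by (simp add: algebra_simps)
    then show ?thesis using h by (auto simp: 1 xy psi_values rhombus_def field_simps)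
  next
    case 2
    have "\<bar>y\<bar> \<le> 2 * c * (1 + x)" 
      using h(1) c by (simp add: algebra_simps)
    then show ?thesis using h by (auto simp: 2 xy psi_values rhombus_def field_simps)
  next
    case 3
    \<comment> \<open>The image is in the rhombus as soon as \<open>x \<le> 1 + 2 * c * y\<close>
      and \<open>x \<le> 1 - 2 * c * y\<close>. Both follow from
      \<open>\<bar>y\<bar> \<le> 1 - x\<close> and \<open>2 * c < 1\<close>.\<close>
    have "2 * c * (1 - x) \<le> 1 * (1 - x)" using c x by (intro mult_right_mono) auto
    then have "\<bar>y\<bar> \<le> 1 - x" using h by simp
    moreover have "2 * c * \<bar>y\<bar> \<le> 1 * \<bar>y\<bar>" using c by (intro mult_right_mono) auto
    ultimately have "\<bar>2 * c * y\<bar> \<le> 1 - x" using c by (simp add: abs_mult)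
    then have "x \<le> 1 + 2 * c * y" "x \<le> 1 - 2 * c * y" by linarith+
    then have "c * x \<le> c * (1 + 2 * c * y)" "c * x \<le> c * (1 - 2 * c * y)"
      using c by (auto intro!: mult_left_mono)
    then show ?thesis using c x
      by (auto simp: 3 xy psi_values rhombus_def abs_mult algebra_simps)
  qed
qed

lemma psi_word_rhombus:
  assumes "0 < c" "c < 1 / 2" "set i \<subseteq> letters" "p \<in> rhombus c"
  shows "psi_word c i p \<in> rhombus c"
  using assms(3) by (induction i) (auto simp: assms(4) psi_rhombus[OF assms(1,2)])

lemma compact_rhombus:
  assumes c: "0 < c" "c < 1 / 2"
  shows "compact (rhombus c)"
proof -
  have "rhombus c = {p. \<bar>snd p\<bar> \<le> 2 * c * fst p} \<inter> {p. \<bar>snd p\<bar> \<le> 2 * c * (1 - fst p)}"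
    by (auto simp: rhombus_def)
  then have cl: "closed (rhombus c)"
    by (auto intro!: closed_Collect_le continuous_intros)
  have "rhombus c \<subseteq> {0..1} \<times> {-1..1}"
  proof (clarsimp simp: rhombus_def, intro conjI)
    fix x y :: real assume h: "\<bar>y\<bar> \<le> 2 * c * x" "\<bar>y\<bar> \<le> 2 * c * (1 - x)"
    show x: "0 \<le> x" "x \<le> 1"
      using h rhombus_fst[OF c(1), of x y] by (auto simp: rhombus_def)
    have "2 * c * x \<le> 1 * 1" using c x by (intro mult_mono) auto
    then show "- 1 \<le> y" "y \<le> 1" using h by linarith+
  qed
  then have "bounded (rhombus c)"
    by (rule bounded_subset[rotated]) (intro bounded_Times bounded_closed_interval)
  then show ?thesis using cl compact_eq_bounded_closed by blast
qed

section \<open>Cells and their intersections\<close>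

definition endpoints :: "(real \<times> real) set" where
  "endpoints = {(0, 0), (1, 0)}"

lemma vertices_eq: "vertices c n = (\<Union>i\<in>words letters n. psi_word c i ` endpoints)"
  by (simp add: vertices_def endpoints_def)

lemma endpoints_rhombus: "0 < c \<Longrightarrow> endpoints \<subseteq> rhombus c"
  by (auto simp: endpoints_def rhombus_def)

text \<open>The three images lie in cones with apex \<open>(1 / 2, 0)\<close>, opening to the left,
  to the right and upwards, each of slope \<open>2 * c < 1\<close> relative to its axis. Such cones
  meet only in the apex.\<close>

lemma psi_rhombus_inter:
  assumes c: "0 < c" "c < 1 / 2" and k: "k \<in> letters" "l \<in> letters" "k \<noteq> l"
    and p: "p \<in> psi c k ` rhombus c" "p \<in> psi c l ` rhombus c"
  shows "p = (1 / 2, 0)"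
proof -
  have h1: "x \<le> 1/2 \<and> \<bar>y\<bar> \<le> 2 * c * (1 / 2 - x)" if "(x, y) \<in> psi c 1 ` rhombus c" for x y
  proof -
    obtain a b where ab: "(a, b) \<in> rhombus c" "x = (1 - a) / 2" "y = b / 2"
      using \<open>(x, y) \<in> _\<close> by (auto simp: psi_values)
    have "\<bar>b\<bar> \<le> 2 * c * a" using ab by (simp add: rhombus_def)
    moreover have "\<bar>y\<bar> = \<bar>b\<bar> / 2" by (simp add: ab)
    moreover have "2 * c * (1 / 2 - x) = 2 * c * a / 2" by (simp add: ab field_simps)
    ultimately have "\<bar>y\<bar> \<le> 2 * c * (1 / 2 - x)" by linarith
    moreover have "x \<le> 1 / 2" using ab(2) rhombus_fst[OF c(1) ab(1)] by argo
    ultimately show ?thesis by blast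
  qed
  have h2: "x \<ge> 1/2 \<and> \<bar>y\<bar> \<le> 2 * c * (x - 1 / 2)" if "(x, y) \<in> psi c 2 ` rhombus c" for x y
  proof -
    obtain a b where ab: "(a, b) \<in> rhombus c" "x = (1 + a) / 2" "y = - b / 2"
      using \<open>(x, y) \<in> _\<close> by (auto simp: psi_values)
    have "\<bar>b\<bar> \<le> 2 * c * a" using ab by (simp add: rhombus_def)
    moreover have "\<bar>y\<bar> = \<bar>b\<bar> / 2" by (simp add: ab)
    moreover have "2 * c * (x - 1 / 2) = 2 * c * a / 2" by (simp add: ab field_simps)
    ultimately have "\<bar>y\<bar> \<le> 2 * c * (x - 1 / 2)" by linarith
    moreover have "x \<ge> 1 / 2" using ab(2) rhombus_fst[OF c(1) ab(1)] by argo
    ultimately show ?thesis by blast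
  qed
  have h3: "y \<ge> 0 \<and> \<bar>x - 1 / 2\<bar> \<le> 2 * c * y" if "(x, y) \<in> psi c 3 ` rhombus c" for x y
  proof -
    obtain a b where ab: "(a, b) \<in> rhombus c" "x = 1 / 2 + c * b" "y = c * a"
      using \<open>(x, y) \<in> _\<close> by (auto simp: psi_values)
    have "c * \<bar>b\<bar> \<le> c * (2 * c * a)"
      using ab c by (intro mult_left_mono) (auto simp: rhombus_def)
    moreover have "\<bar>x - 1 / 2\<bar> = c * \<bar>b\<bar>" using c by (simp add: ab abs_mult)
    moreover have "c * (2 * c * a) = 2 * c * y" by (simp add: ab)
    ultimately have "\<bar>x - 1 / 2\<bar> \<le> 2 * c * y" by linarith
    moreover have "0 \<le> y" using ab c rhombus_fst[OF c(1) ab(1)] by simp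
    ultimately show ?thesis by blast
  qed
  \<comment> \<open>A horizontal and a vertical cone: each of \<open>y\<close> and
    \<open>\<bar>x - 1 / 2\<bar>\<close> is at most \<open>2 * c < 1\<close> times the other, so
    both vanish.\<close>
  have h4: "x = 1 / 2 \<and> y = 0" if h: "y \<ge> 0" "\<bar>x - 1 / 2\<bar> \<le> 2 * c * y" "\<bar>y\<bar> \<le> 2 * c * \<bar>x - 1 / 2\<bar>"
    for x y
  proof -
    have "2 * c * \<bar>x - 1 / 2\<bar> \<le> 1 * \<bar>x - 1 / 2\<bar>" using c by (intro mult_right_mono) auto
    with h have "y \<le> 2 * c * y" by simp
    moreover have "2 * c * y < y" if "y \<noteq> 0" using that h(1) c by simp
    ultimately have "y = 0" by fastforce
    then show ?thesis using h by simp
  qed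
  have h5: "x = 1 / 2 \<and> y = 0" if "x \<le> 1/2 \<and> \<bar>y\<bar> \<le> 2 * c * (1 / 2 - x)" "x \<ge> 1/2" for x y
    using that by (cases "x = 1 / 2") auto
  have main: "p = (1 / 2, 0)" if "k \<in> letters" "l \<in> letters" "k < l"
    "p \<in> psi c k ` rhombus c" "p \<in> psi c l ` rhombus c" for k l
  proof -
    obtain x y where p: "p = (x, y)" by (meson surj_pair)
    consider "k = 1" "l = 2" | "k = 1" "l = 3" | "k = 2" "l = 3"
      using \<open>k < l\<close> \<open>k \<in> letters\<close> \<open>l \<in> letters\<close> by (auto simp: letters_iff)
    then show ?thesis
    proof cases
      case 1
      then show ?thesis using that h1 h2 h5 unfolding p by blast
    next
      case 2
      then have "x \<le> 1/2 \<and> \<bar>y\<bar> \<le> 2 * c * (1 / 2 - x)" "y \<ge> 0 \<and> \<bar>x - 1 / 2\<bar> \<le> 2 * c * y"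
        using h1 h3 that unfolding p by blast+
      then show ?thesis unfolding p using h4[of y x] by auto
    next
      case 3
      then have "x \<ge> 1/2 \<and> \<bar>y\<bar> \<le> 2 * c * (x - 1 / 2)" "y \<ge> 0 \<and> \<bar>x - 1 / 2\<bar> \<le> 2 * c * y"
        using h2 h3 that unfolding p by blast+
      then show ?thesis unfolding p using h4[of y x] by auto
    qed
  qed
  show ?thesis
    using main[of k l] main[of l k] k p by (cases "k < l") auto
qed

text \<open>Within the rhombus only endpoints are sent to endpoints, so letters can be stripped from
  the front. For the letter 3 an endpoint is never hit: the second coordinate forces
  \<open>x = 0\<close>, where the rhombus contains only \<open>(0, 0)\<close>, and this point goes
  to the midpoint.\<close>

lemma endpoint_in_cell:
  assumes c: "0 < c" "c < 1 / 2" and i: "set i \<subseteq> letters"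
    and e: "e \<in> endpoints" "e \<in> psi_word c i ` rhombus c"
  shows "e \<in> psi_word c i ` endpoints"
  using i e
proof (induction i arbitrary: e)
  case (Cons k i)
  then obtain u where u: "e = psi c k u" "u \<in> psi_word c i ` rhombus c"
    unfolding psi_word_Cons_image by blast
  obtain x y where xy: "u = (x, y)" by (meson surj_pair)
  have "u \<in> rhombus c"
    using u(2) psi_word_rhombus[OF c] Cons.prems by auto
  then have x: "0 \<le> x" "x \<le> 1" and y: "\<bar>y\<bar> \<le> 2 * c * x"
    using rhombus_fst[OF c(1), of x y] by (simp_all add: xy rhombus_def)
  have "u \<in> endpoints"
  proof -
    consider "k = 1" | "k = 2" | "k = 3" using Cons.prems by (auto simp: letters_iff)
    then show ?thesis
    proof cases
      case 3
      then have "x = 0" "y \<noteq> 0"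
        using Cons.prems(2) u(1) c(1) by (auto simp: xy psi_values endpoints_def)
      then show ?thesis using y by simp
    qed (use Cons.prems(2) u(1) x in \<open>auto simp: xy psi_values endpoints_def\<close>)
  qed
  then have "u \<in> psi_word c i ` endpoints" using Cons u by auto
  then show ?case using u by auto
qed simp

text \<open>A common first letter is cancelled by injectivity. Different first letters leave only
  the point \<open>(1 / 2, 0)\<close>, whose preimage under each map is the endpoint
  \<open>(0, 0)\<close>; then \<open>endpoint_in_cell\<close> applies to the remaining
  letters.\<close>

lemma cell_inter:
  assumes c: "0 < c" "c < 1 / 2"
    and ij: "i \<in> words letters n" "j \<in> words letters n" "i \<noteq> j"
    and p: "p \<in> psi_word c i ` rhombus c" "p \<in> psi_word c j ` rhombus c"
  shows "p \<in> psi_word c i ` endpoints"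
  using ij p
proof (induction n arbitrary: i j p)
  case (Suc n)
  then obtain k i' l j' where *: "i = k # i'" "j = l # j'" "k \<in> letters" "l \<in> letters"
    "i' \<in> words letters n" "j' \<in> words letters n"
    by (auto simp: words_Suc)
  obtain u u' where u: "p = psi c k u" "p = psi c l u'" "u \<in> psi_word c i' ` rhombus c"
    "u' \<in> psi_word c j' ` rhombus c"
    using Suc.prems(4,5) unfolding *(1,2) psi_word_Cons_image by blast
  have "u \<in> psi_word c i' ` endpoints"
  proof (cases "k = l")
    case True
    then have "u = u'" using u(1,2) by (auto intro: injD[OF inj_psi[OF c(1), of k]])
    then show ?thesis using Suc.IH[of i' j' u] * u Suc.prems True by auto
  next
    case False
    have "u \<in> rhombus c" "u' \<in> rhombus c"
      using u psi_word_rhombus[OF c] * by (auto simp: words_def)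
    then have p: "p = (1 / 2, 0)"
      using psi_rhombus_inter[OF c *(3,4) False] u(1,2) by blast
    have "u \<in> endpoints"
    proof -
      obtain x y where xy: "u = (x, y)" by (meson surj_pair)
      have "0 \<le> x" "x \<le> 1" "\<bar>y\<bar> \<le> 2 * c * x"
        using rhombus_fst[OF c(1), of x y] \<open>u \<in> rhombus c\<close> by (simp_all add: xy rhombus_def)
      then show ?thesis using *(3) u(1) p c(1)
        by (auto simp: xy psi_values endpoints_def letters_iff)
    qed
    then show ?thesis using endpoint_in_cell[OF c _ _ u(3)] * by (auto simp: words_def)
  qed
  then show ?case using u * by auto
qed simp

section \<open>The fractal as the closure of the vertices\<close>

lemma endpoints_subset_image: "endpoints \<subseteq> psi c 1 ` endpoints \<union> psi c 2 ` endpoints"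
  by (auto simp: endpoints_def psi_values)

lemma vertices_mono: "m \<le> n \<Longrightarrow> vertices c m \<subseteq> vertices c n"
proof (rule lift_Suc_mono_le[of "vertices c"])
  fix n show "vertices c n \<subseteq> vertices c (Suc n)"
  proof
    fix p assume "p \<in> vertices c n"
    then obtain i e where i: "i \<in> words letters n" "e \<in> endpoints" "p = psi_word c i e"
      by (auto simp: vertices_eq)
    obtain k e' where k: "k \<in> letters" "e' \<in> endpoints" "e = psi c k e'"
      using endpoints_subset_image[of c] i(2) letters_iff by blast
    have "p = psi_word c (i @ [k]) e'" using i k by (simp add: psi_word_append)
    then show "p \<in> vertices c (Suc n)"
      using snoc_words[OF i(1) k(1)] k by (auto simp: vertices_eq)
  qed
qed

lemma all_vertices_cells: "all_vertices c = (\<Union>i\<in>words letters n. psi_word c i ` all_vertices c)"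
proof (intro equalityI subsetI)
  fix p assume "p \<in> all_vertices c"
  then obtain m where "p \<in> vertices c m" by (auto simp: all_vertices_def)
  then have "p \<in> vertices c (n + m)" using vertices_mono[of m "n + m" c] by auto
  then obtain i e where i: "i \<in> words letters (n + m)" "e \<in> endpoints" "p = psi_word c i e"
    by (auto simp: vertices_eq)
  from i(1) obtain j k where "i = j @ k" "j \<in> words letters n" "k \<in> words letters m"
    by (rule words_addE)
  then show "p \<in> (\<Union>i\<in>words letters n. psi_word c i ` all_vertices c)"
    using i by (auto simp: psi_word_append all_vertices_def vertices_eq intro!: bexI imageI)
next
  fix p assume "p \<in> (\<Union>i\<in>words letters n. psi_word c i ` all_vertices c)"
  then obtain i j m e where "i \<in> words letters n" "j \<in> words letters m" "e \<in> endpoints"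
    "p = psi_word c i (psi_word c j e)"
    by (auto simp: all_vertices_def vertices_eq)
  then have "i @ j \<in> words letters (n + m)" "p = psi_word c (i @ j) e"
    by (auto simp: append_words psi_word_append)
  then show "p \<in> all_vertices c"
    using \<open>e \<in> endpoints\<close> by (auto simp: all_vertices_def vertices_eq)
qed

lemma all_vertices_rhombus: "0 < c \<Longrightarrow> c < 1 / 2 \<Longrightarrow> all_vertices c \<subseteq> rhombus c"
  using endpoints_rhombus[of c]
  by (auto simp: all_vertices_def vertices_eq words_def intro!: psi_word_rhombus)

text \<open>A point of \<open>K\<close> farthest from \<open>L\<close> has the form
  \<open>psi c k z\<close> with \<open>z \<in> K\<close>. As the maps halve distances at least, the
  maximal distance is at most half of itself, hence 0. Exchanging \<open>K\<close> and
  \<open>L\<close> gives uniqueness.\<close>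

lemma psi_invariant_unique:
  assumes c: "0 < c" "c < 1 / 2"
    and K: "K \<noteq> {}" "compact K" "K = (\<Union>k\<in>letters. psi c k ` K)"
    and L: "L \<noteq> {}" "compact L" "L = (\<Union>k\<in>letters. psi c k ` L)"
  shows "K \<subseteq> L"
proof -
  have "continuous_on K (\<lambda>x. infdist x L)" by (intro continuous_intros)
  then obtain x where x: "x \<in> K" "\<forall>y\<in>K. infdist y L \<le> infdist x L"
    using continuous_attains_sup[OF K(2,1)] by blast
  obtain k z where z: "k \<in> letters" "z \<in> K" "x = psi c k z" using x(1) K(3) by blast
  obtain l where l: "l \<in> L" "infdist z L = dist z l"
    using infdist_attains_inf[OF compact_imp_closed[OF L(2)] L(1), of z] by auto
  have "psi c k l \<in> L" using L(3) z(1) l(1) by blast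
  then have "infdist x L \<le> dist (psi c k z) (psi c k l)"
    unfolding z(3) by (rule infdist_le)
  also have "\<dots> \<le> infdist z L / 2" using dist_psi_le[OF c z(1)] l by simp
  also have "\<dots> \<le> infdist x L / 2" using x(2) z(2) by simp
  finally have "infdist x L \<le> 0" by simp
  then have "\<forall>y\<in>K. infdist y L = 0" using x(2) infdist_nonneg by (metis order_antisym_conv order_trans)
  then show ?thesis
    using in_closed_iff_infdist_zero[OF compact_imp_closed[OF L(2)] L(1)] by blast
qed

lemma compact_closure_all_vertices:
  assumes "0 < c" "c < 1 / 2"
  shows "compact (closure (all_vertices c))"
  using bounded_subset[OF compact_imp_bounded[OF compact_rhombus[OF assms]]
      all_vertices_rhombus[OF assms]]
  by simp

lemma closure_all_vertices_cells:
  assumes c: "0 < c" "c < 1 / 2"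
  shows "closure (all_vertices c) = (\<Union>i\<in>words letters n. psi_word c i ` closure (all_vertices c))"
proof
  have "closed (\<Union>i\<in>words letters n. psi_word c i ` closure (all_vertices c))"
    using compact_closure_all_vertices[OF c]
    by (auto intro!: closed_UN compact_imp_closed compact_continuous_image continuous_on_psi_word)
  moreover have "all_vertices c \<subseteq> (\<Union>i\<in>words letters n. psi_word c i ` closure (all_vertices c))"
    using all_vertices_cells[of c n] closure_subset[of "all_vertices c"] by blast
  ultimately show "closure (all_vertices c) \<subseteq> \<dots>"
    by (intro closure_minimal)
  have "psi_word c i ` closure (all_vertices c) \<subseteq> closure (all_vertices c)"
    if "i \<in> words letters n" for i
  proof (rule image_closure_subset[OF continuous_on_psi_word])
    show "psi_word c i ` all_vertices c \<subseteq> closure (all_vertices c)"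
      using all_vertices_cells[of c n] closure_subset[of "all_vertices c"] that by blast
  qed simp
  then show "(\<Union>i\<in>words letters n. psi_word c i ` closure (all_vertices c)) \<subseteq> closure (all_vertices c)"
    by blast
qed

text \<open>The closure is itself a non-empty compact invariant set, so it provides existence, and
  \<open>psi_invariant_unique\<close> provides uniqueness, for the definite description.\<close>

lemma fractal_eq_closure:
  assumes c: "0 < c" "c < 1 / 2"
  shows "fractal c = closure (all_vertices c)"
  unfolding fractal_def
proof (rule the_equality)
  have "(0, 0) \<in> all_vertices c"
    by (auto simp: all_vertices_def vertices_def intro!: exI[of _ 0])
  moreover have "words letters 1 = (\<lambda>k. [k]) ` letters"
    by (auto simp: words_def length_Suc_conv)
  ultimately show *: "closure (all_vertices c) \<noteq> {} \<and> compact (closure (all_vertices c)) \<and>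
      closure (all_vertices c) = (\<Union>k\<in>letters. psi c k ` closure (all_vertices c))"
    using closure_all_vertices_cells[OF c, of 1] compact_closure_all_vertices[OF c] by auto
  fix K assume "K \<noteq> {} \<and> compact K \<and> K = (\<Union>k\<in>letters. psi c k ` K)"
  then show "K = closure (all_vertices c)"
    using * psi_invariant_unique[OF c] by (metis subset_antisym)
qed

lemma fractal_cells:
  assumes "0 < c" "c < 1 / 2"
  shows "fractal c = (\<Union>i\<in>words letters n. psi_word c i ` fractal c)"
  unfolding fractal_eq_closure[OF assms] by (rule closure_all_vertices_cells[OF assms])

lemma fractal_rhombus:
  assumes "0 < c" "c < 1 / 2"
  shows "fractal c \<subseteq> rhombus c"
  unfolding fractal_eq_closure[OF assms]
  using all_vertices_rhombus[OF assms] compact_imp_closed[OF compact_rhombus[OF assms]]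
  by (rule closure_minimal)

lemma compact_fractal: "0 < c \<Longrightarrow> c < 1 / 2 \<Longrightarrow> compact (fractal c)"
  unfolding fractal_eq_closure by (rule compact_closure_all_vertices)

text \<open>The approximating vertices stay in the same cell, so that a bound for the vertices of a
  cell passes to all its points.\<close>

lemma cell_sequence:
  assumes c: "0 < c" "c < 1 / 2" and x: "x \<in> psi_word c i ` fractal c"
  shows "\<exists>xs. range xs \<subseteq> psi_word c i ` all_vertices c \<and> xs \<longlonglongrightarrow> x"
proof -
  from x obtain u where u: "u \<in> closure (all_vertices c)" "x = psi_word c i u"
    by (auto simp: fractal_eq_closure[OF c])
  then obtain us where us: "\<And>n. us n \<in> all_vertices c" "us \<longlonglongrightarrow> u"
    by (meson closure_sequential)
  have "isCont (psi_word c i) u"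
    using continuous_on_psi_word[of UNIV c i] continuous_on_eq_continuous_at[OF open_UNIV] by blast
  then have "(\<lambda>n. psi_word c i (us n)) \<longlonglongrightarrow> x"
    unfolding u(2) using us(2) by (rule isCont_tendsto_compose)
  then show ?thesis using us(1) by (intro exI[of _ "\<lambda>n. psi_word c i (us n)"]) auto
qed

lemma finite_union_cells_closed:
  assumes "0 < c" "c < 1 / 2" "finite I"
  shows "closed (\<Union>i\<in>I. psi_word c i ` fractal c)"
  using assms by (auto intro!: closed_UN compact_imp_closed compact_continuous_image
      continuous_on_psi_word compact_fractal)

section \<open>Effective resistance\<close>

text \<open>The difference of the two sides is a square. It vanishes at the potential
  \<open>m\<close> for which the currents through the two resistors agree, which is the equality
  case below.\<close>

lemma series_resistors:
  fixes a b m :: real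
  assumes "0 < r" "0 < s"
  shows "(a - b)\<^sup>2 / (r + s) \<le> (m - a)\<^sup>2 / r + (m - b)\<^sup>2 / s"
proof -
  have "(m - a)\<^sup>2 / r + (m - b)\<^sup>2 / s - (a - b)\<^sup>2 / (r + s) =
      (s * (m - a) + r * (m - b))\<^sup>2 / (r * s * (r + s))"
    using assms by (simp add: divide_simps) (simp add: power2_eq_square algebra_simps)
  also have "\<dots> \<ge> 0" using assms by simp
  finally show ?thesis by simp
qed

lemma series_resistors_eq:
  fixes a b :: real
  assumes "0 < r" "0 < s"
  defines "m \<equiv> (s * a + r * b) / (r + s)"
  shows "(m - a)\<^sup>2 / r + (m - b)\<^sup>2 / s = (a - b)\<^sup>2 / (r + s)"
proof -
  have "m - a = r * (b - a) / (r + s)" "m - b = s * (a - b) / (r + s)"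
    using assms by (auto simp: field_simps)
  then have "(m - a)\<^sup>2 / r + (m - b)\<^sup>2 / s = (r * (a - b)\<^sup>2 + s * (a - b)\<^sup>2) / (r + s)\<^sup>2"
    using assms(1,2) by (simp add: power_divide power_mult_distrib power2_commute[of b a])
      (simp add: power2_eq_square divide_simps)
  also have "\<dots> = (a - b)\<^sup>2 / (r + s)"
    using assms(1,2) by (simp add: power2_eq_square[of "r + s"] distrib_right[symmetric])
  finally show ?thesis .
qed

definition edge_resistance :: "(nat list \<Rightarrow> real) \<Rightarrow> nat list \<Rightarrow> real" where
  "edge_resistance v i = cascade v i * cascade_limit v i"

text \<open>The law of resistors in series for the letters 1 and 2 makes consecutive levels
  compatible. The edge \<open>i @ [3]\<close> is a dead end, so its resistance may be any positive
  number.\<close>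

locale resistance_form =
  fixes c :: real and v :: "nat list \<Rightarrow> real"
  assumes c: "0 < c" "c < 1 / 2"
    and edge_pos: "i \<in> addresses \<Longrightarrow> 0 < edge_resistance v i"
    and edge_split: "i \<in> addresses \<Longrightarrow>
      edge_resistance v i = edge_resistance v (i @ [1]) + edge_resistance v (i @ [2])"
begin

abbreviation (input) r :: "nat list \<Rightarrow> real" where "r \<equiv> edge_resistance v"
abbreviation (input) V :: "(real \<times> real) set" where "V \<equiv> all_vertices c"
abbreviation (input) psiw :: "nat list \<Rightarrow> real \<times> real \<Rightarrow> real \<times> real" where "psiw \<equiv> psi_word c"
abbreviation (input) En :: "nat \<Rightarrow> (real \<times> real \<Rightarrow> real) \<Rightarrow> real" where "En \<equiv> energy c v"
abbreviation (input) E :: "(real \<times> real \<Rightarrow> real) \<Rightarrow> real" where "E \<equiv> energy_limit c v"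
abbreviation (input) F :: "(real \<times> real \<Rightarrow> real) set" where "F \<equiv> energy_domain c v"
abbreviation (input) Rv :: "real \<times> real \<Rightarrow> real \<times> real \<Rightarrow> real" where "Rv \<equiv> resistance_vertices c v"

section \<open>Energies and increments along chains of edges\<close>

lemma energy_eq: "En n f = (\<Sum>i\<in>words letters n. (f (psiw i (0, 0)) - f (psiw i (1, 0)))\<^sup>2 / r i)"
  by (simp add: energy_def edge_resistance_def)

text \<open>All three maps send \<open>(0, 0)\<close> to \<open>(1 / 2, 0)\<close>. An edge is thus
  replaced by a star centred at its midpoint: two halves that end at the old endpoints, and a branch
  with tip \<open>psiw i (1/2, c)\<close>.\<close>

lemma energy_Suc:
  "En (Suc n) f = (\<Sum>i\<in>words letters n.
     (f (psiw i (1/2, 0)) - f (psiw i (0, 0)))\<^sup>2 / r (i @ [1]) +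
     (f (psiw i (1/2, 0)) - f (psiw i (1, 0)))\<^sup>2 / r (i @ [2]) +
     (f (psiw i (1/2, 0)) - f (psiw i (1/2, c)))\<^sup>2 / r (i @ [3]))"
  unfolding energy_eq sum_words_Suc
  by (rule sum.cong) (simp_all add: letters_def psi_word_append psi_values add.assoc)

lemma energy_cong:
  assumes "\<And>p. p \<in> vertices c n \<Longrightarrow> f p = g p"
  shows "En n f = En n g"
proof -
  have "f (psiw i e) = g (psiw i e)" if "i \<in> words letters n" "e \<in> endpoints" for i e
    using that by (intro assms) (auto simp: vertices_eq)
  then show ?thesis
    unfolding energy_eq by (intro sum.cong) (auto simp: endpoints_def)
qed

lemma energy_nonneg: "0 \<le> En n f"
  unfolding energy_eq
  by (intro sum_nonneg divide_nonneg_pos) (auto intro: edge_pos words_addresses)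

text \<open>The branch term is non-negative and the two halves are in series. Monotonicity makes the
  limit energy an upper bound for every level, and hence for every single edge.\<close>

lemma energy_incseq: "incseq (\<lambda>n. En n f)"
proof (rule incseq_SucI)
  fix n
  show "En n f \<le> En (Suc n) f"
    unfolding energy_Suc unfolding energy_eq
  proof (rule sum_mono)
    fix i assume "i \<in> words letters n"
    then have i: "i \<in> addresses" by (rule words_addresses)
    have pos: "0 < r (i @ [k])" if "k \<in> letters" for k
      using that i by (intro edge_pos snoc_addresses)
    have "0 \<le> (f (psiw i (1/2, 0)) - f (psiw i (1/2, c)))\<^sup>2 / r (i @ [3])"
      by (intro divide_nonneg_pos pos) (auto simp: letters_iff)
    moreover have "(f (psiw i (0, 0)) - f (psiw i (1, 0)))\<^sup>2 / r i \<le>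
     (f (psiw i (1/2, 0)) - f (psiw i (0, 0)))\<^sup>2 / r (i @ [1]) +
     (f (psiw i (1/2, 0)) - f (psiw i (1, 0)))\<^sup>2 / r (i @ [2])"
      unfolding edge_split[OF i] by (intro series_resistors pos) (auto simp: letters_iff)
    ultimately show "(f (psiw i (0, 0)) - f (psiw i (1, 0)))\<^sup>2 / r i \<le>
     (f (psiw i (1/2, 0)) - f (psiw i (0, 0)))\<^sup>2 / r (i @ [1]) +
     (f (psiw i (1/2, 0)) - f (psiw i (1, 0)))\<^sup>2 / r (i @ [2]) +
     (f (psiw i (1/2, 0)) - f (psiw i (1/2, c)))\<^sup>2 / r (i @ [3])"
      by linarith
  qed
qed

lemma energy_le_limit: "f \<in> F \<Longrightarrow> En n f \<le> E f"
  unfolding energy_domain_def energy_limit_def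
  by (auto intro!: incseq_le energy_incseq simp: convergent_LIMSEQ_iff)

lemma energy_limit_nonneg: "f \<in> F \<Longrightarrow> 0 \<le> E f"
  using energy_le_limit[of f 0] energy_nonneg[of 0 f] by simp

lemma energy_affine:
  assumes "f \<in> F"
  shows "(\<lambda>p. (f p - a) / b) \<in> F" "E (\<lambda>p. (f p - a) / b) = E f / b\<^sup>2"
proof -
  have "En n (\<lambda>p. (f p - a) / b) = En n f / b\<^sup>2" for n
    by (simp add: energy_eq sum_divide_distrib diff_divide_distrib[symmetric] power_divide
        divide_divide_eq_left mult.commute)
  moreover have "(\<lambda>n. En n f / b\<^sup>2) \<longlonglongrightarrow> E f / b\<^sup>2"
    using assms unfolding energy_domain_def energy_limit_def
    unfolding divide_inverse by (intro tendsto_mult_right) (auto simp: convergent_LIMSEQ_iff)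
  ultimately show "(\<lambda>p. (f p - a) / b) \<in> F" "E (\<lambda>p. (f p - a) / b) = E f / b\<^sup>2"
    unfolding energy_domain_def energy_limit_def by (auto simp: convergent_def intro!: limI)
qed

lemma edge_bound:
  assumes f: "f \<in> F" and i: "i \<in> addresses"
  shows "\<bar>f (psiw i (0, 0)) - f (psiw i (1, 0))\<bar> \<le> sqrt (r i) * sqrt (E f)"
proof -
  let ?d = "f (psiw i (0, 0)) - f (psiw i (1, 0))"
  have "?d\<^sup>2 / r i \<le> En (length i) f"
    unfolding energy_eq
    using i by (intro member_le_sum[of i _ "\<lambda>i. (f (psiw i (0, 0)) - f (psiw i (1, 0)))\<^sup>2 / r i"])
      (auto simp: addresses_words intro!: divide_nonneg_pos edge_pos words_addresses)
  also have "\<dots> \<le> E f" using f by (rule energy_le_limit)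
  finally have "?d\<^sup>2 \<le> r i * E f"
    using edge_pos[OF i] by (simp add: field_simps)
  then have "sqrt (?d\<^sup>2) \<le> sqrt (r i * E f)" by (rule real_sqrt_le_mono)
  then show ?thesis by (simp add: real_sqrt_mult)
qed

text \<open>Every child of an edge starts at the midpoint, whatever its letter, and the child with
  letter 1 leads from there back to the start of the edge.\<close>

lemma half_bound:
  assumes f: "f \<in> F" and i: "i \<in> addresses" and k: "k \<in> letters"
  shows "\<bar>f (psiw (i @ [k]) (0, 0)) - f (psiw i (0, 0))\<bar> \<le> sqrt (r i) * sqrt (E f)"
proof -
  have "psiw (i @ [k]) (0, 0) = psiw (i @ [1]) (0, 0)" "psiw i (0, 0) = psiw (i @ [1]) (1, 0)"
    using k by (auto simp: psi_word_append psi_values letters_iff)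
  then have "\<bar>f (psiw (i @ [k]) (0, 0)) - f (psiw i (0, 0))\<bar> \<le> sqrt (r (i @ [1])) * sqrt (E f)"
    using edge_bound[OF f snoc_addresses[OF i], of 1] by (simp add: letters_iff)
  also have "\<dots> \<le> sqrt (r i) * sqrt (E f)"
    using edge_split[OF i] edge_pos[OF snoc_addresses[OF i], of 2] energy_limit_nonneg[OF f]
    by (intro mult_right_mono real_sqrt_le_mono) (auto simp: letters_iff)
  finally show ?thesis .
qed

text \<open>The chain visits the points \<open>psiw (i @ take k j) (0, 0)\<close>. A term with
  \<open>k < length j\<close> pays for the step to the next of these points; the last one,
  \<open>k = length j\<close>, pays for the edge \<open>i @ j\<close> itself, in case
  \<open>e\<close> is its far end.\<close>

lemma chain_bound:
  assumes f: "f \<in> F" and "i \<in> addresses" "j \<in> addresses" and e: "e \<in> endpoints"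
  shows "\<bar>f (psiw (i @ j) e) - f (psiw i (0, 0))\<bar> \<le>
    (\<Sum>k\<le>length j. sqrt (r (i @ take k j))) * sqrt (E f)"
  using assms(2,3)
proof (induction j arbitrary: i)
  case Nil
  have "0 \<le> sqrt (r i) * sqrt (E f)"
    using edge_pos[OF Nil(1)] energy_limit_nonneg[OF f] by simp
  then show ?case
    using e edge_bound[OF f Nil(1)] by (auto simp: endpoints_def abs_minus_commute)
next
  case (Cons k j)
  then have k: "k \<in> letters" "j \<in> addresses" by (auto simp: addresses_iff)
  have "\<bar>f (psiw (i @ k # j) e) - f (psiw i (0, 0))\<bar> \<le>
      \<bar>f (psiw ((i @ [k]) @ j) e) - f (psiw (i @ [k]) (0, 0))\<bar> +
      \<bar>f (psiw (i @ [k]) (0, 0)) - f (psiw i (0, 0))\<bar>"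
    by simp
  also have "\<dots> \<le> (\<Sum>l\<le>length j. sqrt (r ((i @ [k]) @ take l j))) * sqrt (E f) +
      sqrt (r i) * sqrt (E f)"
    by (intro add_mono Cons.IH half_bound f Cons.prems k snoc_addresses)
  also have "\<dots> = (\<Sum>l\<le>length (k # j). sqrt (r (i @ take l (k # j)))) * sqrt (E f)"
    by (simp add: sum.atMost_Suc_shift algebra_simps del: sum.atMost_Suc)
  finally show ?case .
qed

section \<open>Extension of functions without increase of energy\<close>

lemma cell_interior:
  assumes ij: "i \<in> words letters n" "j \<in> words letters n"
    and q: "q \<in> rhombus c" "q \<notin> endpoints"
    and p: "psiw i q \<in> psiw j ` rhombus c"
  shows "i = j"
proof (rule ccontr)
  assume "i \<noteq> j"
  then have "psiw i q \<in> psiw i ` endpoints"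
    using cell_inter[OF c ij] q p by blast
  then show False
    using q(2) by (simp add: inj_image_mem_iff inj_psi_word c)
qed

lemma interior_not_vertex:
  assumes i: "i \<in> words letters n" and q: "q \<in> rhombus c" "q \<notin> endpoints"
  shows "psiw i q \<notin> vertices c n"
proof
  assume "psiw i q \<in> vertices c n"
  then obtain j where j: "j \<in> words letters n" "psiw i q \<in> psiw j ` endpoints"
    unfolding vertices_eq by blast
  then have "i = j"
    using cell_interior[OF i j(1) q] endpoints_rhombus[OF c(1)] by blast
  then show False
    using j(2) q(2) by (simp add: inj_image_mem_iff inj_psi_word c)
qed

text \<open>The value at the midpoint of an edge is the weighted average that is constant on the new
  branch and minimises the energy of the two halves.\<close>

definition refine :: "nat \<Rightarrow> (real \<times> real \<Rightarrow> real) \<Rightarrow> real \<times> real \<Rightarrow> real" where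
  "refine n f p = (if p \<in> vertices c n then f p
     else let i = (SOME i. i \<in> words letters n \<and> p \<in> psi_word c i ` rhombus c) in
       (edge_resistance v (i @ [2]) * f (psi_word c i (0, 0)) +
        edge_resistance v (i @ [1]) * f (psi_word c i (1, 0))) / edge_resistance v i)"

lemma refine_interior:
  assumes i: "i \<in> words letters n" and q: "q \<in> rhombus c" "q \<notin> endpoints"
  shows "refine n f (psiw i q) = (r (i @ [2]) * f (psiw i (0, 0)) + r (i @ [1]) * f (psiw i (1, 0))) / r i"
proof -
  have "(SOME j. j \<in> words letters n \<and> psiw i q \<in> psiw j ` rhombus c) = i"
    using i q cell_interior[OF i _ q] by (intro some_equality) auto
  then show ?thesis
    using interior_not_vertex[OF i q] by (simp add: refine_def)
qed

lemma energy_refine: "En (Suc n) (refine n f) = En n f"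
  unfolding energy_Suc unfolding energy_eq
proof (rule sum.cong[OF refl])
  fix i assume i: "i \<in> words letters n"
  then have a: "i \<in> addresses" by (rule words_addresses)
  have pos: "0 < r (i @ [k])" if "k \<in> letters" for k
    using that a by (intro edge_pos snoc_addresses)
  \<comment> \<open>The midpoint and the tip of the branch lie in the cell and are not endpoints, so
    \<open>refine\<close> gives them the same value and the branch contributes no energy.\<close>
  have mid: "(1 / 2, 0) \<in> rhombus c" "(1 / 2, 0) \<notin> endpoints"
    "(1 / 2, c) \<in> rhombus c" "(1 / 2, c) \<notin> endpoints"
    using c by (auto simp: rhombus_def endpoints_def)
  have "psiw i (0, 0) \<in> vertices c n" "psiw i (1, 0) \<in> vertices c n"
    using i by (auto simp: vertices_def)
  then have v: "refine n f (psiw i (0, 0)) = f (psiw i (0, 0))"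
    "refine n f (psiw i (1, 0)) = f (psiw i (1, 0))"
    by (simp_all add: refine_def)
  show "(refine n f (psiw i (1/2, 0)) - refine n f (psiw i (0, 0)))\<^sup>2 / r (i @ [1]) +
     (refine n f (psiw i (1/2, 0)) - refine n f (psiw i (1, 0)))\<^sup>2 / r (i @ [2]) +
     (refine n f (psiw i (1/2, 0)) - refine n f (psiw i (1/2, c)))\<^sup>2 / r (i @ [3]) =
     (f (psiw i (0, 0)) - f (psiw i (1, 0)))\<^sup>2 / r i"
    using series_resistors_eq[OF pos[of 1] pos[of 2], of "f (psiw i (0, 0))" "f (psiw i (1, 0))"]
    unfolding v refine_interior[OF i mid(1,2)] refine_interior[OF i mid(3,4)] edge_split[OF a]
    by (simp add: letters_iff)
qed

text \<open>Repeated refinement keeps the energy at \<open>En n f\<close> on all later levels, so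
  the limit exists. This is the source of functions in \<open>F\<close> with prescribed values at
  vertices.\<close>

lemma finite_energy_extension:
  "\<exists>h\<in>F. \<forall>p\<in>vertices c n. h p = f p"
proof -
  define g where "g = rec_nat f (\<lambda>k. refine (n + k))"
  have g: "g 0 = f" "g (Suc k) = refine (n + k) (g k)" for k
    by (simp_all add: g_def)
  have stable: "g (k + l) p = g k p" if "p \<in> vertices c (n + k)" for k l p
  proof (induction l)
    case (Suc l)
    have "p \<in> vertices c (n + (k + l))"
      using that vertices_mono[of "n + k" "n + (k + l)" c] by auto
    then show ?case using Suc by (simp add: g refine_def)
  qed simp
  \<comment> \<open>A vertex keeps the value from its first appearance. Off the vertices the
    \<open>LEAST\<close> is unspecified, but the energies do not see these points.\<close>
  define h where "h p = g (LEAST k. p \<in> vertices c (n + k)) p" for p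
  have h: "h p = g k p" if "p \<in> vertices c (n + k)" for k p
  proof -
    let ?m = "LEAST k. p \<in> vertices c (n + k)"
    have "p \<in> vertices c (n + ?m)" "?m \<le> k"
      using that by (rule LeastI, intro Least_le)
    then show ?thesis
      using stable[of p ?m "k - ?m"] by (simp add: h_def)
  qed
  have "En (n + k) (g k) = En n f" for k
    by (induction k) (simp_all add: g energy_refine)
  then have "En (k + n) h = En n f" for k
    using energy_cong[of "n + k" h "g k"] h by (simp add: add.commute)
  then have "(\<lambda>k. En (k + n) h) \<longlonglongrightarrow> En n f" by simp
  then have "(\<lambda>k. En k h) \<longlonglongrightarrow> En n f" by (rule LIMSEQ_offset)
  then have "h \<in> F" by (auto simp: energy_domain_def convergent_def)
  moreover have "\<forall>p\<in>vertices c n. h p = f p"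
    using h[of _ 0] by (simp add: g)
  ultimately show ?thesis by blast
qed

lemma finite_energy_separates:
  assumes "x \<in> V" "y \<in> V" "x \<noteq> y"
  shows "\<exists>f\<in>F. f x = 0 \<and> f y = 1"
proof -
  obtain m n where "x \<in> vertices c m" "y \<in> vertices c n"
    using assms by (auto simp: all_vertices_def)
  then have "x \<in> vertices c (max m n)" "y \<in> vertices c (max m n)"
    using vertices_mono[of m "max m n" c] vertices_mono[of n "max m n" c] by auto
  moreover obtain h where "h \<in> F" "\<forall>p\<in>vertices c (max m n). h p = (if p = y then 1 else 0)"
    using finite_energy_extension[of "max m n" "\<lambda>p. if p = y then 1 else 0"] by auto
  ultimately show ?thesis using assms(3) by (intro bexI[of _ h]) auto
qed

section \<open>Resistance between vertices\<close>

lemma uniform_bound: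
  assumes "x \<in> V" "y \<in> V"
  shows "\<exists>B\<ge>0. \<forall>f\<in>F. \<bar>f x - f y\<bar> \<le> B * sqrt (E f)"
proof -
  have *: "\<exists>B\<ge>0. \<forall>f\<in>F. \<bar>f x - f (0, 0)\<bar> \<le> B * sqrt (E f)" if x: "x \<in> V" for x
  proof -
    from x obtain j n e where j: "j \<in> words letters n" "e \<in> endpoints" "x = psiw j e"
      by (auto simp: all_vertices_def vertices_eq)
    then have a: "j \<in> addresses" by (auto dest: words_addresses)
    have "0 \<le> (\<Sum>k\<le>length j. sqrt (r (take k j)))"
      using a set_take_subset
      by (intro sum_nonneg real_sqrt_ge_zero less_imp_le edge_pos) (fastforce simp: addresses_iff)
    moreover have "\<bar>f x - f (0, 0)\<bar> \<le> (\<Sum>k\<le>length j. sqrt (r (take k j))) * sqrt (E f)"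
      if "f \<in> F" for f
      using chain_bound[OF that _ a j(2), of "[]"] by (simp add: j(3) addresses_iff)
    ultimately show ?thesis by blast
  qed
  obtain B where B: "B \<ge> 0" "\<And>f. f \<in> F \<Longrightarrow> \<bar>f x - f (0, 0)\<bar> \<le> B * sqrt (E f)"
    using *[OF assms(1)] by blast
  obtain B' where B': "B' \<ge> 0" "\<And>f. f \<in> F \<Longrightarrow> \<bar>f y - f (0, 0)\<bar> \<le> B' * sqrt (E f)"
    using *[OF assms(2)] by blast
  have "\<bar>f x - f y\<bar> \<le> (B + B') * sqrt (E f)" if "f \<in> F" for f
    using B(2)[OF that] B'(2)[OF that] unfolding distrib_right by linarith
  then show ?thesis using B(1) B'(1) by (intro exI[of _ "B + B'"]) auto
qed

text \<open>\<open>Inf\<close> and \<open>inverse\<close> have default values outside their proper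
  domain, so these three facts are what makes \<open>resistance_vertices\<close> the intended
  quantity. Positivity comes from chains joining \<open>x\<close> and \<open>y\<close> through
  \<open>(0, 0)\<close>.\<close>

lemma energy_set:
  fixes x y
  defines "S \<equiv> {E f |f. f \<in> F \<and> f x = 0 \<and> f y = 1}"
  assumes "x \<in> V" "y \<in> V" "x \<noteq> y"
  shows "S \<noteq> {}" "bdd_below S" "0 < Inf S"
proof -
  show ne: "S \<noteq> {}"
    using finite_energy_separates[OF assms(2-4)] by (auto simp: S_def)
  show "bdd_below S"
    by (rule bdd_belowI[of _ 0]) (auto simp: S_def energy_limit_nonneg)
  obtain B where B: "B \<ge> 0" "\<And>f. f \<in> F \<Longrightarrow> \<bar>f x - f y\<bar> \<le> B * sqrt (E f)"
    using uniform_bound[OF assms(2,3)] by blast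
  have *: "1 \<le> B\<^sup>2 * e" if "e \<in> S" for e
  proof -
    obtain f where f: "f \<in> F" "f x = 0" "f y = 1" "e = E f" using \<open>e \<in> S\<close> unfolding S_def by blast
    then have "1 \<le> B * sqrt (E f)" using B(2)[of f] by simp
    then have "1\<^sup>2 \<le> (B * sqrt (E f))\<^sup>2" by (intro power_mono) auto
    then show ?thesis using energy_limit_nonneg[OF f(1)] f(4) by (simp add: power_mult_distrib)
  qed
  have B0: "B \<noteq> 0" using * ne by force
  then have "1 / B\<^sup>2 \<le> e" if "e \<in> S" for e
    using *[OF that] by (simp add: field_simps)
  then have "1 / B\<^sup>2 \<le> Inf S" using ne by (intro cInf_greatest) auto
  then show "0 < Inf S" using B0 by (smt (verit) zero_less_divide_iff zero_less_power2)
qed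

lemma Rv_nonneg: "x \<in> V \<Longrightarrow> y \<in> V \<Longrightarrow> 0 \<le> Rv x y"
  using energy_set(3)[of x y] by (auto simp: resistance_vertices_def)

text \<open>Together with \<open>Rv_bound\<close> this identifies \<open>sqrt (Rv x y)\<close> as
  the least \<open>b\<close> with \<open>\<bar>f x - f y\<bar> \<le> b * sqrt (E f)\<close> for all
  \<open>f\<close> in \<open>F\<close>. The metric properties are derived from this description
  rather than from the infimum.\<close>

lemma Rv_le:
  assumes xy: "x \<in> V" "y \<in> V" and b: "0 \<le> b"
    and le: "\<And>f. f \<in> F \<Longrightarrow> \<bar>f x - f y\<bar> \<le> b * sqrt (E f)"
  shows "sqrt (Rv x y) \<le> b"
proof (cases "x = y")
  case False
  let ?S = "{E f |f. f \<in> F \<and> f x = 0 \<and> f y = 1}"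
  note S = energy_set[OF xy False]
  have *: "1 \<le> b\<^sup>2 * e" if "e \<in> ?S" for e
  proof -
    obtain f where f: "f \<in> F" "f x = 0" "f y = 1" "e = E f" using \<open>e \<in> ?S\<close> by blast
    then have "1 \<le> b * sqrt (E f)" using le[of f] by simp
    then have "1\<^sup>2 \<le> (b * sqrt (E f))\<^sup>2" by (intro power_mono) auto
    then show ?thesis using energy_limit_nonneg[OF f(1)] f(4) by (simp add: power_mult_distrib)
  qed
  have b0: "0 < b" using * S(1) b by (cases "b = 0") force+
  then have "1 / b\<^sup>2 \<le> e" if "e \<in> ?S" for e
    using *[OF that] by (simp add: field_simps)
  then have "1 / b\<^sup>2 \<le> Inf ?S" using S(1) by (intro cInf_greatest) auto
  then have "inverse (Inf ?S) \<le> inverse (1 / b\<^sup>2)"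
    using b0 by (intro le_imp_inverse_le) auto
  then have "Rv x y \<le> b\<^sup>2" using False by (simp add: resistance_vertices_def)
  then show ?thesis using b by (simp add: real_le_lsqrt)
qed (use b in \<open>simp add: resistance_vertices_def\<close>)

lemma Rv_bound:
  assumes xy: "x \<in> V" "y \<in> V" and f: "f \<in> F"
  shows "\<bar>f x - f y\<bar> \<le> sqrt (Rv x y) * sqrt (E f)"
proof (cases "f x = f y")
  case True
  then show ?thesis using Rv_nonneg[OF xy] energy_limit_nonneg[OF f] by simp
next
  case False
  then have ne: "x \<noteq> y" by auto
  let ?S = "{E f |f. f \<in> F \<and> f x = 0 \<and> f y = 1}"
  note S = energy_set[OF xy ne]
  \<comment> \<open>Normalising the values to 0 at \<open>x\<close> and 1 at \<open>y\<close>
    divides the energy by \<open>d\<^sup>2\<close>.\<close>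
  define d where "d = f y - f x"
  have d: "d \<noteq> 0" using False by (simp add: d_def)
  have "E f / d\<^sup>2 \<in> ?S"
    using energy_affine[OF f, of "f x" d] d
    by (intro CollectI exI[of _ "\<lambda>p. (f p - f x) / d"]) (auto simp: d_def)
  then have "Inf ?S \<le> E f / d\<^sup>2" using S(2) by (rule cInf_lower)
  then have "d\<^sup>2 \<le> Rv x y * E f"
    using S(3) d ne by (simp add: resistance_vertices_def field_simps)
  then have "sqrt (d\<^sup>2) \<le> sqrt (Rv x y * E f)" by (rule real_sqrt_le_mono)
  then show ?thesis by (simp add: real_sqrt_mult d_def abs_minus_commute)
qed

lemma Rv_commute: "x \<in> V \<Longrightarrow> y \<in> V \<Longrightarrow> sqrt (Rv x y) \<le> sqrt (Rv y x)"
  using Rv_bound[of y x] Rv_nonneg[of y x] by (intro Rv_le) (auto simp: abs_minus_commute)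

text \<open>Increments of a function add up. The inequality concerns the square root of the
  resistance, which is all that the comparison of limits requires.\<close>

lemma Rv_triangle:
  assumes xyz: "x \<in> V" "y \<in> V" "z \<in> V"
  shows "sqrt (Rv x z) \<le> sqrt (Rv x y) + sqrt (Rv y z)"
proof (rule Rv_le)
  fix f assume "f \<in> F"
  then show "\<bar>f x - f z\<bar> \<le> (sqrt (Rv x y) + sqrt (Rv y z)) * sqrt (E f)"
    using Rv_bound[of x y f] Rv_bound[of y z f] xyz unfolding distrib_right by linarith
qed (use xyz Rv_nonneg in auto)

text \<open>Both points are joined to \<open>psiw i (0, 0)\<close> by chains inside the cell, hence
  the factor 2.\<close>

lemma Rv_cell_le:
  assumes i: "i \<in> addresses" and xy: "x \<in> psiw i ` V" "y \<in> psiw i ` V"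
    and b: "\<And>j. j \<in> addresses \<Longrightarrow> (\<Sum>k\<le>length j. sqrt (r (i @ take k j))) \<le> b"
  shows "sqrt (Rv x y) \<le> 2 * b"
proof (rule Rv_le)
  show "x \<in> V" "y \<in> V"
    using xy i all_vertices_cells[of c "length i"] by (auto simp: addresses_words)
  have "0 \<le> sqrt (r i)" using edge_pos[OF i] by simp
  also have "sqrt (r i) \<le> b" using b[of "[]"] by (simp add: addresses_iff)
  finally show "0 \<le> 2 * b" by simp
  have *: "\<bar>f x - f (psiw i (0, 0))\<bar> \<le> b * sqrt (E f)" if f: "f \<in> F" and x: "x \<in> psiw i ` V" for f x
  proof -
    from x obtain j n e where j: "j \<in> words letters n" "e \<in> endpoints" "x = psiw (i @ j) e"
      by (auto simp: all_vertices_def vertices_eq psi_word_append)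
    then have a: "j \<in> addresses" by (auto dest: words_addresses)
    show ?thesis
      using chain_bound[OF f i a j(2)] mult_right_mono[OF b[OF a], of "sqrt (E f)"]
        energy_limit_nonneg[OF f] by (simp add: j(3))
  qed
  show "\<bar>f x - f y\<bar> \<le> 2 * b * sqrt (E f)" if "f \<in> F" for f
    using *[OF that xy(1)] *[OF that xy(2)] by linarith
qed

lemma image_all_vertices_subset: "i \<in> words letters n \<Longrightarrow> psiw i ` V \<subseteq> V"
  using all_vertices_cells[of c n] by blast

lemma image_fractal_subset: "i \<in> words letters n \<Longrightarrow> psiw i ` fractal c \<subseteq> fractal c"
  using fractal_cells[OF c, of n] by blast

end

section \<open>Extension of the resistance to the fractal\<close>

locale shrinking_resistance_form = resistance_form +
  assumes small_cells: "0 < \<epsilon> \<Longrightarrow> \<exists>n. \<forall>i\<in>words letters n. \<forall>x\<in>psi_word c i ` all_vertices c.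
     \<forall>y\<in>psi_word c i ` all_vertices c. sqrt (resistance_vertices c v x y) < \<epsilon>"
begin

text \<open>The neighbourhood is the complement of the finitely many closed cells of one level that
  miss \<open>x\<close>. Vertices in it lie in cells containing \<open>x\<close>. If two such cells
  differ, \<open>cell_inter\<close> shows that \<open>x\<close> is a vertex of both, and the
  triangle inequality through \<open>x\<close> applies.\<close>

lemma small_near_point:
  assumes x: "x \<in> fractal c" and \<epsilon>: "0 < \<epsilon>"
  shows "\<exists>U. open U \<and> x \<in> U \<and> (\<forall>p\<in>U \<inter> V. \<forall>q\<in>U \<inter> V. sqrt (Rv p q) < \<epsilon>)"
proof -
  obtain n where n: "\<And>i x y. i \<in> words letters n \<Longrightarrow> x \<in> psiw i ` V \<Longrightarrow> y \<in> psiw i ` V \<Longrightarrow>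
      sqrt (Rv x y) < \<epsilon> / 2"
    using small_cells[OF half_gt_zero[OF \<epsilon>]] by metis
  define I where "I = {i \<in> words letters n. x \<notin> psiw i ` fractal c}"
  let ?U = "- (\<Union>i\<in>I. psiw i ` fractal c)"
  have VT: "V \<subseteq> fractal c" by (simp add: fractal_eq_closure[OF c] closure_subset)
  have small: "sqrt (Rv p q) < \<epsilon>" if p: "p \<in> ?U" "p \<in> V" and q: "q \<in> ?U" "q \<in> V" for p q
  proof -
    have *: "\<exists>i\<in>words letters n. p \<in> psiw i ` V \<and> x \<in> psiw i ` fractal c"
      if "p \<in> ?U" "p \<in> V" for p
    proof -
      obtain i where i: "i \<in> words letters n" "p \<in> psiw i ` V"
        using \<open>p \<in> V\<close> all_vertices_cells[of c n] by blast
      then have "i \<notin> I" using VT \<open>p \<in> ?U\<close> by blast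
      then show ?thesis using i by (auto simp: I_def)
    qed
    obtain i where i: "i \<in> words letters n" "p \<in> psiw i ` V" "x \<in> psiw i ` fractal c"
      using *[OF p] by blast
    obtain j where j: "j \<in> words letters n" "q \<in> psiw j ` V" "x \<in> psiw j ` fractal c"
      using *[OF q] by blast
    show ?thesis
    proof (cases "i = j")
      case True
      then show ?thesis using n[OF i(1,2), of q] j(2) \<epsilon> by simp
    next
      case False
      have "endpoints \<subseteq> V" by (auto simp: all_vertices_def vertices_eq intro!: exI[of _ 0])
      moreover have "x \<in> psiw i ` endpoints" "x \<in> psiw j ` endpoints"
        using cell_inter[OF c i(1) j(1) False, of x] cell_inter[OF c j(1) i(1) False[symmetric], of x]
          i(3) j(3) fractal_rhombus[OF c] by blast+
      ultimately have "x \<in> psiw i ` V" "x \<in> psiw j ` V" by blast+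
      then have "sqrt (Rv p x) < \<epsilon> / 2" "sqrt (Rv x q) < \<epsilon> / 2" "x \<in> V"
        using n i j image_all_vertices_subset by blast+
      then show ?thesis using Rv_triangle[of p x q] p q by linarith
    qed
  qed
  show ?thesis
  proof (intro exI[of _ ?U] conjI ballI)
    show "open ?U"
      by (intro open_Compl finite_union_cells_closed c) (simp add: I_def)
    show "x \<in> ?U" by (auto simp: I_def)
  qed (use small in blast)
qed

lemma Rv_sequences:
  assumes x: "x \<in> fractal c" and xs: "range xs \<subseteq> V" "xs \<longlonglongrightarrow> x" "range ys \<subseteq> V" "ys \<longlonglongrightarrow> x"
    and \<epsilon>: "0 < \<epsilon>"
  shows "\<exists>N. \<forall>m\<ge>N. \<forall>n\<ge>N. sqrt (Rv (xs m) (ys n)) < \<epsilon>"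
proof -
  obtain U where U: "open U" "x \<in> U" "\<And>p q. p \<in> U \<inter> V \<Longrightarrow> q \<in> U \<inter> V \<Longrightarrow> sqrt (Rv p q) < \<epsilon>"
    using small_near_point[OF x \<epsilon>] by blast
  obtain N N' where "\<forall>n\<ge>N. xs n \<in> U" "\<forall>n\<ge>N'. ys n \<in> U"
    using topological_tendstoD[OF xs(2) U(1,2)] topological_tendstoD[OF xs(4) U(1,2)]
    unfolding eventually_sequentially by blast
  then have "sqrt (Rv (xs m) (ys n)) < \<epsilon>" if "m \<ge> max N N'" "n \<ge> max N N'" for m n
    using that xs(1,3) by (intro U(3)) auto
  then show ?thesis by blast
qed

text \<open>Along one pair of sequences the square root of the resistance is Cauchy; along any other
  pair its difference from the first tends to 0. Both follow from the quadrilateral inequality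
  \<open>diff\<close>, combined with smallness for two independent indices.\<close>

lemma resistance_converges:
  assumes x: "x \<in> fractal c" and y: "y \<in> fractal c"
  shows "\<exists>l. \<forall>xs ys. range xs \<subseteq> V \<longrightarrow> range ys \<subseteq> V \<longrightarrow> xs \<longlonglongrightarrow> x \<longrightarrow> ys \<longlonglongrightarrow> y \<longrightarrow>
    (\<lambda>n. Rv (xs n) (ys n)) \<longlonglongrightarrow> l"
proof -
  let ?s = "\<lambda>p q. sqrt (Rv p q)"
  have diff: "\<bar>?s p q - ?s p' q'\<bar> \<le> ?s p p' + ?s q q'"
    if "p \<in> V" "q \<in> V" "p' \<in> V" "q' \<in> V" for p q p' q'
    using Rv_triangle[of p p' q] Rv_triangle[of p' q' q] Rv_triangle[of p' p q'] Rv_triangle[of p q q']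
      Rv_commute[of p p'] Rv_commute[of p' p] Rv_commute[of q q'] Rv_commute[of q' q] that
    by linarith
  obtain xs ys where xs: "range xs \<subseteq> V" "xs \<longlonglongrightarrow> x" and ys: "range ys \<subseteq> V" "ys \<longlonglongrightarrow> y"
    using cell_sequence[OF c, of x "[]"] cell_sequence[OF c, of y "[]"] x y by auto
  have "Cauchy (\<lambda>n. ?s (xs n) (ys n))"
  proof (rule metric_CauchyI)
    fix \<epsilon> :: real assume "0 < \<epsilon>"
    then obtain N N' where N: "\<forall>m\<ge>N. \<forall>n\<ge>N. ?s (xs m) (xs n) < \<epsilon> / 2"
      "\<forall>m\<ge>N'. \<forall>n\<ge>N'. ?s (ys m) (ys n) < \<epsilon> / 2"
      using Rv_sequences[OF x xs xs, of "\<epsilon> / 2"] Rv_sequences[OF y ys ys, of "\<epsilon> / 2"] by auto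
    have "\<bar>?s (xs m) (ys m) - ?s (xs n) (ys n)\<bar> < \<epsilon>" if "m \<ge> max N N'" "n \<ge> max N N'" for m n
    proof -
      have "?s (xs m) (xs n) < \<epsilon> / 2" "?s (ys m) (ys n) < \<epsilon> / 2" using N that by auto
      moreover have "xs m \<in> V" "ys m \<in> V" "xs n \<in> V" "ys n \<in> V" using xs(1) ys(1) by auto
      ultimately show ?thesis using diff[of "xs m" "ys m" "xs n" "ys n"] by linarith
    qed
    then show "\<exists>M. \<forall>m\<ge>M. \<forall>n\<ge>M. dist (?s (xs m) (ys m)) (?s (xs n) (ys n)) < \<epsilon>"
      unfolding dist_real_def by blast
  qed
  then obtain l where l: "(\<lambda>n. ?s (xs n) (ys n)) \<longlonglongrightarrow> l"
    using Cauchy_convergent convergent_def by blast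
  have "(\<lambda>n. Rv (xs' n) (ys' n)) \<longlonglongrightarrow> l\<^sup>2"
    if xs': "range xs' \<subseteq> V" "xs' \<longlonglongrightarrow> x" and ys': "range ys' \<subseteq> V" "ys' \<longlonglongrightarrow> y" for xs' ys'
  proof -
    have "(\<lambda>n. ?s (xs' n) (ys' n) - ?s (xs n) (ys n)) \<longlonglongrightarrow> 0"
    proof (rule LIMSEQ_I)
      fix \<epsilon> :: real assume "0 < \<epsilon>"
      then obtain N N' where N: "\<forall>m\<ge>N. \<forall>n\<ge>N. ?s (xs' m) (xs n) < \<epsilon> / 2"
        "\<forall>m\<ge>N'. \<forall>n\<ge>N'. ?s (ys' m) (ys n) < \<epsilon> / 2"
        using Rv_sequences[OF x xs' xs, of "\<epsilon> / 2"] Rv_sequences[OF y ys' ys, of "\<epsilon> / 2"] by auto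
      have "\<bar>?s (xs' n) (ys' n) - ?s (xs n) (ys n)\<bar> < \<epsilon>" if "n \<ge> max N N'" for n
      proof -
        have "?s (xs' n) (xs n) < \<epsilon> / 2" "?s (ys' n) (ys n) < \<epsilon> / 2" using N that by auto
        moreover have "xs' n \<in> V" "ys' n \<in> V" "xs n \<in> V" "ys n \<in> V"
          using xs(1) ys(1) xs'(1) ys'(1) by auto
        ultimately show ?thesis using diff[of "xs' n" "ys' n" "xs n" "ys n"] by linarith
      qed
      then show "\<exists>N. \<forall>n\<ge>N. norm (?s (xs' n) (ys' n) - ?s (xs n) (ys n) - 0) < \<epsilon>"
        unfolding diff_0_right real_norm_def by blast
    qed
    from tendsto_add[OF this l] have "(\<lambda>n. ?s (xs' n) (ys' n)) \<longlonglongrightarrow> l" by simp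
    then have "(\<lambda>n. (?s (xs' n) (ys' n))\<^sup>2) \<longlonglongrightarrow> l\<^sup>2" by (rule tendsto_power)
    moreover have "(?s (xs' n) (ys' n))\<^sup>2 = Rv (xs' n) (ys' n)" for n
      using Rv_nonneg[of "xs' n" "ys' n"] xs'(1) ys'(1) by auto
    ultimately show ?thesis by simp
  qed
  then show ?thesis by blast
qed

lemma resistance_tendsto:
  assumes x: "x \<in> fractal c" and y: "y \<in> fractal c"
    and xs: "range xs \<subseteq> V" "range ys \<subseteq> V" "xs \<longlonglongrightarrow> x" "ys \<longlonglongrightarrow> y"
  shows "(\<lambda>n. Rv (xs n) (ys n)) \<longlonglongrightarrow> resistance c v x y"
proof -
  obtain l where l: "\<forall>xs ys. range xs \<subseteq> V \<longrightarrow> range ys \<subseteq> V \<longrightarrow> xs \<longlonglongrightarrow> x \<longrightarrow> ys \<longlonglongrightarrow> y \<longrightarrow>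
      (\<lambda>n. Rv (xs n) (ys n)) \<longlonglongrightarrow> l"
    using resistance_converges[OF x y] by blast
  have "resistance c v x y = l"
    unfolding resistance_def
  proof (rule the_equality)
    fix l' assume "\<forall>xs ys. range xs \<subseteq> V \<longrightarrow> range ys \<subseteq> V \<longrightarrow> xs \<longlonglongrightarrow> x \<longrightarrow> ys \<longlonglongrightarrow> y \<longrightarrow>
      (\<lambda>n. Rv (xs n) (ys n)) \<longlonglongrightarrow> l'"
    \<comment> \<open>The given sequences show that the condition on \<open>l'\<close> is not
      vacuous.\<close>
    then have "(\<lambda>n. Rv (xs n) (ys n)) \<longlonglongrightarrow> l'" using xs by blast
    moreover have "(\<lambda>n. Rv (xs n) (ys n)) \<longlonglongrightarrow> l" using l xs by blast
    ultimately show "l' = l" by (rule LIMSEQ_unique)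
  qed (rule l)
  then show ?thesis using l xs by blast
qed

lemma resistance_cell_le:
  assumes i: "i \<in> words letters n" and xy: "x \<in> psiw i ` fractal c" "y \<in> psiw i ` fractal c"
    and b: "\<And>p q. p \<in> psiw i ` V \<Longrightarrow> q \<in> psiw i ` V \<Longrightarrow> Rv p q \<le> b"
  shows "resistance c v x y \<le> b"
proof -
  obtain xs ys where xs: "range xs \<subseteq> psiw i ` V" "xs \<longlonglongrightarrow> x" "range ys \<subseteq> psiw i ` V" "ys \<longlonglongrightarrow> y"
    using cell_sequence[OF c xy(1)] cell_sequence[OF c xy(2)] by blast
  have "(\<lambda>n. Rv (xs n) (ys n)) \<longlonglongrightarrow> resistance c v x y"
    using xs xy image_all_vertices_subset[OF i] image_fractal_subset[OF i]
    by (intro resistance_tendsto) blast+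
  moreover have "Rv (xs n) (ys n) \<le> b" for n using xs b by blast
  ultimately show ?thesis by (intro LIMSEQ_le_const2) auto
qed

end

section \<open>Hausdorff measure under exponential decay\<close>

lemma diam_of_le:
  assumes "\<And>x y. x \<in> U \<Longrightarrow> y \<in> U \<Longrightarrow> d x y \<le> b"
  shows "diam_of d U \<le> ennreal b"
  unfolding diam_of_def using assms by (intro SUP_least ennreal_leI) auto

lemma hausdorff_measure_eq_0:
  fixes U :: "'i \<Rightarrow> 'b set" and I :: "nat \<Rightarrow> 'i set"
  assumes s: "0 < s" and fin: "\<And>n. finite (I n)"
    and U: "\<And>n i. i \<in> I n \<Longrightarrow> U i \<subseteq> X" "\<And>n. X \<subseteq> (\<Union>i\<in>I n. U i)"
    and b: "\<And>i. 0 \<le> b i" "\<And>n i x y. i \<in> I n \<Longrightarrow> x \<in> U i \<Longrightarrow> y \<in> U i \<Longrightarrow> d x y \<le> b i"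
    and lim: "(\<lambda>n. \<Sum>i\<in>I n. b i powr s) \<longlonglongrightarrow> 0"
  shows "hausdorff_measure X d s = 0"
proof -
  have "hausdorff_premeasure X d s \<delta> = 0" if \<delta>: "0 < \<delta>" for \<delta>
  proof -
    have *: "hausdorff_premeasure X d s \<delta> \<le> ennreal (\<Sum>i\<in>I n. b i powr s)"
      if n: "(\<Sum>i\<in>I n. b i powr s) < \<delta> powr s" for n
    proof -
      obtain h where h: "bij_betw h {0..<card (I n)} (I n)"
        using ex_bij_betw_nat_finite[OF fin] by blast
      \<comment> \<open>A finite cover becomes a sequence by appending empty sets, whose diameter is
        0 and whose terms vanish.\<close>
      define W where "W m = (if m < card (I n) then U (h m) else {})" for m
      have hI: "h m \<in> I n" if "m < card (I n)" for m
        using bij_betwE[OF h] that by auto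
      have diam: "diam_of d (W m) \<le> ennreal (b (h m))" if "m < card (I n)" for m
        using b(2) hI[OF that] that by (intro diam_of_le) (auto simp: W_def)
      \<comment> \<open>The mesh condition comes from the sum itself: when it is small, so is each
        of its terms.\<close>
      have b\<delta>: "b i \<le> \<delta>" if "i \<in> I n" for i
      proof -
        have "b i powr s \<le> (\<Sum>i\<in>I n. b i powr s)"
          using that fin by (intro member_le_sum) auto
        then have "b i powr s < \<delta> powr s" using n by simp
        then have "b i < \<delta>" using powr_mono2[of s \<delta> "b i"] s \<delta> by (cases "b i < \<delta>") auto
        then show ?thesis by simp
      qed
      have "W m \<subseteq> X" for m using U(1) hI by (auto simp: W_def)
      moreover have "X \<subseteq> (\<Union>m. W m)"
      proof
        fix x assume "x \<in> X"
        then obtain i where i: "i \<in> I n" "x \<in> U i" using U(2) by blast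
        then obtain m where "m < card (I n)" "i = h m"
          using h unfolding bij_betw_def by (metis atLeastLessThan_iff imageE)
        then show "x \<in> (\<Union>m. W m)" using i by (auto simp: W_def intro!: exI[of _ m])
      qed
      moreover have "diam_of d (W m) \<le> ennreal \<delta>" for m
      proof (cases "m < card (I n)")
        case True
        then show ?thesis using diam[OF True] b\<delta>[OF hI[OF True]] by (meson ennreal_leI order_trans)
      qed (simp add: W_def diam_of_def bot_ennreal)
      ultimately have "hausdorff_premeasure X d s \<delta> \<le>
          (\<Sum>m. ennreal (enn2real (diam_of d (W m)) powr s))"
        unfolding hausdorff_premeasure_def by (intro INF_lower) blast
      also have "\<dots> = (\<Sum>m<card (I n). ennreal (enn2real (diam_of d (W m)) powr s))"
        using s by (intro suminf_finite) (auto simp: W_def diam_of_def bot_ennreal)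
      also have "\<dots> \<le> (\<Sum>m<card (I n). ennreal (b (h m) powr s))"
      proof (intro sum_mono ennreal_leI powr_mono2)
        fix m assume m: "m \<in> {..<card (I n)}"
        then show "enn2real (diam_of d (W m)) \<le> b (h m)"
          using diam[of m] b(1) by (auto intro: enn2real_leI)
      qed (use s in auto)
      also have "\<dots> = ennreal (\<Sum>m<card (I n). b (h m) powr s)"
        by (simp add: sum_ennreal)
      also have "(\<Sum>m<card (I n). b (h m) powr s) = (\<Sum>i\<in>I n. b i powr s)"
        using sum.reindex_bij_betw[OF h, of "\<lambda>i. b i powr s"] by (simp add: lessThan_atLeast0)
      finally show ?thesis .
    qed
    have "0 < \<delta> powr s" using \<delta> by simp
    then have "\<forall>\<^sub>F n in sequentially. (\<Sum>i\<in>I n. b i powr s) < \<delta> powr s"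
      by (rule order_tendstoD(2)[OF lim])
    then have "\<forall>\<^sub>F n in sequentially. hausdorff_premeasure X d s \<delta> \<le> ennreal (\<Sum>i\<in>I n. b i powr s)"
      by (rule eventually_mono) (rule *)
    moreover have "(\<lambda>n. ennreal (\<Sum>i\<in>I n. b i powr s)) \<longlonglongrightarrow> ennreal 0"
      using lim by (rule tendsto_ennrealI)
    ultimately have "hausdorff_premeasure X d s \<delta> \<le> ennreal 0"
      by (intro tendsto_lowerbound) auto
    then show ?thesis by simp
  qed
  then show ?thesis unfolding hausdorff_measure_def by (simp add: SUP_eq_const)
qed

section \<open>Diameters of cells under exponential decay\<close>

locale decaying_resistance_form = resistance_form +
  fixes s q C :: real
  assumes s: "0 < s" and q: "0 < q" "q < 1"
    and decay: "(\<Sum>i\<in>words letters n. edge_resistance v i powr s) \<le> C * q ^ n"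
begin

text \<open>Any number strictly between \<open>q\<close> and 1 serves: \<open>q / mu < 1\<close>
  makes the generations below a cell summable, and \<open>mu < 1\<close> leaves a geometric gain
  along chains.\<close>

definition mu :: real where "mu = (1 + q) / 2"

definition level_sum :: "nat list \<Rightarrow> nat \<Rightarrow> real" where
  "level_sum i k = (\<Sum>j\<in>words letters k. edge_resistance v (i @ j) powr s)"

text \<open>One number that dominates
  \<open>edge_resistance v (i @ j) powr s / mu ^ length j\<close> for all descendants
  \<open>i @ j\<close> at once. It is a sum over generations rather than a supremum so that it can
  be interchanged with the sum over the cells of a level.\<close>

definition cell_weight :: "nat list \<Rightarrow> real" where
  "cell_weight i = (\<Sum>k. level_sum i k / mu ^ k)"

lemma mu: "0 < mu" "mu < 1" "q / mu < 1"
  using q by (auto simp: mu_def field_simps)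

lemma level_sum_nonneg: "0 \<le> level_sum i k"
  by (simp add: level_sum_def sum_nonneg)

lemma sum_level_sum: "(\<Sum>i\<in>words letters n. level_sum i k) \<le> C * q ^ (n + k)"
  using decay[of "n + k"] by (simp add: sum_words_add level_sum_def)

lemma level_sum_le:
  assumes "i \<in> words letters n"
  shows "level_sum i k \<le> C * q ^ (n + k)"
  using member_le_sum[OF assms, of "\<lambda>i. level_sum i k"] sum_level_sum[where n = n and k = k]
    level_sum_nonneg by auto

lemma C_nonneg: "0 \<le> C"
  using decay[of 0] by (simp add: order_trans[of 0 "edge_resistance v [] powr s"])

lemma geometric_bound: "C * q ^ (n + k) / mu ^ k = C * q ^ n * (q / mu) ^ k"
  by (simp add: power_add power_divide)

lemma summable_level_sum:
  assumes "i \<in> words letters n"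
  shows "summable (\<lambda>k. level_sum i k / mu ^ k)"
proof (rule summable_comparison_test')
  show "summable (\<lambda>k. C * q ^ n * (q / mu) ^ k)"
    using q mu by (intro summable_mult summable_geometric) auto
  fix k
  have "level_sum i k / mu ^ k \<le> C * q ^ (n + k) / mu ^ k"
    using level_sum_le[OF assms] mu by (intro divide_right_mono) auto
  then show "norm (level_sum i k / mu ^ k) \<le> C * q ^ n * (q / mu) ^ k"
    using level_sum_nonneg[of i k] mu by (simp add: geometric_bound)
qed

lemma cell_weight_nonneg: "i \<in> words letters n \<Longrightarrow> 0 \<le> cell_weight i"
  unfolding cell_weight_def using level_sum_nonneg mu
  by (intro suminf_nonneg summable_level_sum) auto

lemma edge_le_cell_weight:
  assumes i: "i \<in> words letters n" and j: "j \<in> words letters k"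
  shows "edge_resistance v (i @ j) powr s \<le> mu ^ k * cell_weight i"
proof -
  have "edge_resistance v (i @ j) powr s \<le> level_sum i k"
    unfolding level_sum_def using j by (intro member_le_sum) auto
  moreover have "(\<Sum>k\<in>{k}. level_sum i k / mu ^ k) \<le> cell_weight i"
    unfolding cell_weight_def using level_sum_nonneg mu
    by (intro sum_le_suminf summable_level_sum[OF i]) auto
  ultimately show ?thesis using mu by (simp add: field_simps)
qed

text \<open>After the interchange, generation \<open>k\<close> below level \<open>n\<close> is the
  full level \<open>n + k\<close>, to which \<open>decay\<close> applies. Passing from single edges
  to whole subtrees therefore costs only a constant factor.\<close>

lemma sum_cell_weight:
  "(\<Sum>i\<in>words letters n. cell_weight i) \<le> C / (1 - q / mu) * q ^ n"
proof -
  have "(\<Sum>i\<in>words letters n. cell_weight i) =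
      (\<Sum>k. \<Sum>i\<in>words letters n. level_sum i k / mu ^ k)"
    unfolding cell_weight_def by (intro suminf_sum[symmetric] summable_level_sum)
  also have "\<dots> \<le> (\<Sum>k. C * q ^ n * (q / mu) ^ k)"
  proof (rule suminf_le)
    fix k
    show "(\<Sum>i\<in>words letters n. level_sum i k / mu ^ k) \<le> C * q ^ n * (q / mu) ^ k"
      using divide_right_mono[OF sum_level_sum[of k n], of "mu ^ k"] mu
      by (simp add: geometric_bound sum_divide_distrib)
  next
    show "summable (\<lambda>k. \<Sum>i\<in>words letters n. level_sum i k / mu ^ k)"
      by (intro summable_sum summable_level_sum)
    show "summable (\<lambda>k. C * q ^ n * (q / mu) ^ k)"
      using q mu by (intro summable_mult summable_geometric) auto
  qed
  also have "\<dots> = C / (1 - q / mu) * q ^ n"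
    using q mu by (simp add: suminf_mult suminf_geometric)
  finally show ?thesis .
qed

text \<open>The gain per generation for the square root: since
  \<open>sqrt r = (r powr s) powr (1 / (2 * s))\<close>, a factor \<open>mu\<close> in the
  \<open>s\<close>-th power becomes \<open>beta\<close>.\<close>

definition beta :: real where "beta = mu powr (1 / (2 * s))"

lemma beta: "0 < beta" "beta < 1"
  using mu s powr_less_mono2[of "1 / (2 * s)" mu 1] by (auto simp: beta_def)

text \<open>The terms are dominated by a geometric series, so the bound does not depend on the
  length of \<open>j\<close> and controls the vertices of all levels in the cell.\<close>

lemma chain_sum_le:
  assumes i: "i \<in> words letters n" and j: "j \<in> addresses"
  shows "(\<Sum>k\<le>length j. sqrt (edge_resistance v (i @ take k j))) \<le>
    cell_weight i powr (1 / (2 * s)) / (1 - beta)"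
proof -
  let ?W = "cell_weight i powr (1 / (2 * s))"
  have "sqrt (edge_resistance v (i @ take k j)) \<le> ?W * beta ^ k" if k: "k \<le> length j" for k
  proof -
    let ?r = "edge_resistance v (i @ take k j)"
    have w: "take k j \<in> words letters k"
      using j k set_take_subset[of k j] by (auto simp: words_def addresses_iff)
    have r: "0 < ?r"
      using i w by (intro edge_pos words_addresses[of _ "n + k"] append_words)
    have "sqrt ?r = (?r powr s) powr (1 / (2 * s))"
      using r s by (simp add: powr_powr powr_half_sqrt)
    also have "\<dots> \<le> (mu ^ k * cell_weight i) powr (1 / (2 * s))"
      using edge_le_cell_weight[OF i w] s by (intro powr_mono2) auto
    also have "\<dots> = ?W * beta ^ k"
      using mu cell_weight_nonneg[OF i]
      by (simp add: powr_mult beta_def powr_power powr_realpow[symmetric] powr_powr mult.commute)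
    finally show ?thesis .
  qed
  then have "(\<Sum>k\<le>length j. sqrt (edge_resistance v (i @ take k j))) \<le> (\<Sum>k\<le>length j. ?W * beta ^ k)"
    by (intro sum_mono) auto
  also have "\<dots> = ?W * (\<Sum>k\<le>length j. beta ^ k)" by (simp add: sum_distrib_left)
  also have "\<dots> \<le> ?W * (1 / (1 - beta))"
  proof (rule mult_left_mono)
    have "(\<Sum>k\<le>length j. beta ^ k) \<le> (\<Sum>k. beta ^ k)"
      using beta by (intro sum_le_suminf summable_geometric) auto
    then show "(\<Sum>k\<le>length j. beta ^ k) \<le> 1 / (1 - beta)"
      using beta by (simp add: suminf_geometric)
  qed simp
  finally show ?thesis by simp
qed

lemma vertex_resistance_le:
  assumes i: "i \<in> words letters n" and xy: "x \<in> psiw i ` V" "y \<in> psiw i ` V"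
  shows "sqrt (Rv x y) \<le> 2 / (1 - beta) * cell_weight i powr (1 / (2 * s))"
  using Rv_cell_le[OF words_addresses[OF i] xy chain_sum_le[OF i]] by simp

lemma cell_weight_le:
  assumes i: "i \<in> words letters n"
  shows "cell_weight i \<le> C / (1 - q / mu) * q ^ n"
  using member_le_sum[OF i, of cell_weight] sum_cell_weight[of n] cell_weight_nonneg by fastforce

text \<open>Each weight is at most the sum over its level, hence of order \<open>q ^ n\<close>
  uniformly over the cells. The power \<open>1 / (2 * s)\<close> keeps the decay geometric.\<close>

sublocale shrinking_resistance_form
proof
  fix \<epsilon> :: real assume \<epsilon>: "0 < \<epsilon>"
  let ?K = "2 / (1 - beta)" and ?a = "1 / (2 * s)" and ?C = "C / (1 - q / mu)"
  have C: "0 \<le> ?C" using C_nonneg mu by simp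
  have "q powr ?a < 1" "0 < q powr ?a"
    using powr_less_mono2[of ?a q 1] q s by auto
  then have "(\<lambda>n. ?K * (?C powr ?a * (q powr ?a) ^ n)) \<longlonglongrightarrow> ?K * (?C powr ?a * 0)"
    by (intro tendsto_mult tendsto_const LIMSEQ_realpow_zero) auto
  then have "\<forall>\<^sub>F n in sequentially. ?K * (?C powr ?a * (q powr ?a) ^ n) < \<epsilon>"
    using \<epsilon> by (intro order_tendstoD(2)) auto
  then obtain n where n: "?K * (?C powr ?a * (q powr ?a) ^ n) < \<epsilon>"
    unfolding eventually_sequentially by blast
  have "sqrt (Rv x y) < \<epsilon>" if i: "i \<in> words letters n" and xy: "x \<in> psiw i ` V" "y \<in> psiw i ` V"
    for i x y
  proof -
    have "cell_weight i powr ?a \<le> (?C * q ^ n) powr ?a"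
      using cell_weight_le[OF i] cell_weight_nonneg[OF i] s by (intro powr_mono2) auto
    also have "\<dots> = ?C powr ?a * (q ^ n) powr ?a"
      using C q by (simp only: powr_mult)
    also have "(q ^ n) powr ?a = (q powr ?a) ^ n"
      using q by (simp add: powr_power powr_realpow[symmetric] powr_powr mult.commute)
    finally have "?K * cell_weight i powr ?a \<le> ?K * (?C powr ?a * (q powr ?a) ^ n)"
      using beta by (intro mult_left_mono) auto
    then show ?thesis using vertex_resistance_le[OF i xy] n by linarith
  qed
  then show "\<exists>n. \<forall>i\<in>words letters n. \<forall>x\<in>psiw i ` V. \<forall>y\<in>psiw i ` V. sqrt (Rv x y) < \<epsilon>"
    by blast
qed

lemma hausdorff_measure_fractal: "hausdorff_measure (fractal c) (resistance c v) s = 0"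
proof -
  let ?K = "2 / (1 - beta)"
  \<comment> \<open>The square of the bound for the square root. Its exponent \<open>1 / s\<close>
    cancels against the power \<open>s\<close> in the Hausdorff sum, which becomes a constant times
    the sum of the weights.\<close>
  define b where "b i = ?K\<^sup>2 * cell_weight i powr (1 / s)" for i
  show ?thesis
  proof (rule hausdorff_measure_eq_0[where I = "words letters" and U = "\<lambda>i. psiw i ` fractal c"
        and b = b])
    show "psiw i ` fractal c \<subseteq> fractal c" if "i \<in> words letters n" for n i
      using that by (rule image_fractal_subset)
    show "fractal c \<subseteq> (\<Union>i\<in>words letters n. psiw i ` fractal c)" for n
      using fractal_cells[OF c] by blast
    show "resistance c v x y \<le> b i"
      if i: "i \<in> words letters n" and xy: "x \<in> psiw i ` fractal c" "y \<in> psiw i ` fractal c"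
      for n i x y
    proof (rule resistance_cell_le[OF i xy])
      fix p q assume pq: "p \<in> psiw i ` V" "q \<in> psiw i ` V"
      have 0: "0 \<le> Rv p q"
        using pq image_all_vertices_subset[OF i] by (intro Rv_nonneg) auto
      have "(sqrt (Rv p q))\<^sup>2 \<le> (?K * cell_weight i powr (1 / (2 * s)))\<^sup>2"
        using vertex_resistance_le[OF i pq] 0 by (intro power_mono) auto
      also have "\<dots> = b i"
        using s unfolding b_def power_mult_distrib
        by (simp add: power2_eq_square[of "_ powr _"] powr_add[symmetric])
      finally show "Rv p q \<le> b i" using 0 by simp
    qed
    have eq: "(\<Sum>i\<in>words letters n. b i powr s) = (?K\<^sup>2) powr s * (\<Sum>i\<in>words letters n. cell_weight i)" for n
      unfolding sum_distrib_left
    proof (rule sum.cong[OF refl])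
      fix i assume "i \<in> words letters n"
      then have "0 \<le> cell_weight i" by (rule cell_weight_nonneg)
      then show "b i powr s = (?K\<^sup>2) powr s * cell_weight i"
        using s by (simp add: b_def powr_mult powr_powr)
    qed
    show "(\<lambda>n. \<Sum>i\<in>words letters n. b i powr s) \<longlonglongrightarrow> 0"
    proof (rule tendsto_sandwich[OF always_eventually always_eventually tendsto_const])
      show "\<forall>n. 0 \<le> (\<Sum>i\<in>words letters n. b i powr s)"
        by (intro allI sum_nonneg) simp
      show "\<forall>n. (\<Sum>i\<in>words letters n. b i powr s) \<le> (?K\<^sup>2) powr s * (C / (1 - q / mu) * q ^ n)"
        unfolding eq by (intro allI mult_left_mono[OF sum_cell_weight powr_ge_zero])
      have "(\<lambda>n. (?K\<^sup>2) powr s * (C / (1 - q / mu) * q ^ n)) \<longlonglongrightarrow>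
          (?K\<^sup>2) powr s * (C / (1 - q / mu) * 0)"
        using q by (intro tendsto_mult tendsto_const LIMSEQ_realpow_zero) auto
      then show "(\<lambda>n. (?K\<^sup>2) powr s * (C / (1 - q / mu) * q ^ n)) \<longlonglongrightarrow> 0" by simp
    qed
    show "0 \<le> b i" for i by (simp add: b_def)
  qed (auto simp: s)
qed

end

section \<open>The random cascade\<close>

text \<open>The partial sums in \<open>cascade_limit\<close>, decomposed at the root: the two
  subtrees appear as separate factors, and no division by a weight is involved.\<close>

fun mass :: "(nat list \<Rightarrow> real) \<Rightarrow> nat \<Rightarrow> nat list \<Rightarrow> real" where
  "mass v 0 i = 1"
| "mass v (Suc n) i = v (i @ [1]) * mass v n (i @ [1]) + v (i @ [2]) * mass v n (i @ [2])"

lemma cascade_Nil [simp]: "cascade v [] = 1"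
  by (simp add: cascade_def)

lemma cascade_snoc: "cascade v (i @ [k]) = cascade v i * v (i @ [k])"
  by (simp add: cascade_def)

lemma cascade_nonzero:
  assumes "\<And>i. i \<in> addresses - {[]} \<Longrightarrow> v i \<noteq> 0" "i \<in> addresses"
  shows "cascade v i \<noteq> 0"
  using assms(2)
proof (induction i rule: rev_induct)
  case (snoc k i)
  then have "i \<in> addresses" "i @ [k] \<in> addresses - {[]}" by (simp_all add: addresses_iff)
  then show ?case using snoc.IH assms(1) by (simp add: cascade_snoc)
qed simp

lemma mass_eq_sum:
  assumes v: "\<And>i. i \<in> addresses - {[]} \<Longrightarrow> v i \<noteq> 0" and i: "i \<in> addresses"
  shows "(\<Sum>j\<in>words {1, 2} n. cascade v (i @ j) / cascade v i) = mass v n i"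
  using i
proof (induction n arbitrary: i)
  case 0
  then have "cascade v i \<noteq> 0" using v by (intro cascade_nonzero; blast)
  then show ?case by simp
next
  case (Suc n)
  have w1: "words {1, 2 :: nat} (Suc 0) = {[1], [2]}"
    by (auto simp: words_Suc)
  have step: "(\<Sum>j\<in>words {1, 2} n. cascade v (i @ [k] @ j) / cascade v i) = v (i @ [k]) * mass v n (i @ [k])"
    if "k \<in> {1, 2}" for k
  proof -
    have a: "i @ [k] \<in> addresses" using Suc.prems that by (auto simp: addresses_iff letters_def)
    have "cascade v (i @ [k]) \<noteq> 0" "cascade v i \<noteq> 0"
      using v a Suc.prems by (intro cascade_nonzero; blast)+
    then have "cascade v (i @ [k] @ j) / cascade v i =
        v (i @ [k]) * (cascade v ((i @ [k]) @ j) / cascade v (i @ [k]))" for j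
      by (simp add: cascade_snoc)
    then have "(\<Sum>j\<in>words {1, 2} n. cascade v (i @ [k] @ j) / cascade v i) =
        v (i @ [k]) * (\<Sum>j\<in>words {1, 2} n. cascade v ((i @ [k]) @ j) / cascade v (i @ [k]))"
      by (simp only: sum_distrib_left)
    then show ?thesis unfolding Suc.IH[OF a] .
  qed
  have "(\<Sum>j\<in>words {1, 2} (Suc n). cascade v (i @ j) / cascade v i) =
      (\<Sum>k\<in>{1, 2}. \<Sum>j\<in>words {1, 2} n. cascade v (i @ [k] @ j) / cascade v i)"
    using sum_words_add[of "\<lambda>j. cascade v (i @ j) / cascade v i" "{1, 2}" "Suc 0" n]
    unfolding w1 by simp
  then show ?case using step[of 1] step[of 2] by simp
qed

text \<open>All mixed terms of the binomial expansion are absorbed into \<open>a * b ^ p\<close> and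
  \<open>b * a ^ p\<close>, so that later only a mean and one lower moment occur. If
  \<open>a \<le> b\<close>, the difference of \<open>(a + b) ^ Suc p\<close> and
  \<open>b ^ Suc p\<close> is \<open>a\<close> times \<open>Suc p\<close> products, each at most
  \<open>(2 * b) ^ p\<close>.\<close>

lemma power_add_le:
  fixes a b :: real
  assumes "0 \<le> a" "0 \<le> b"
  shows "(a + b) ^ Suc p \<le> a ^ Suc p + b ^ Suc p + 2 ^ Suc p * real (Suc p) * (a * b ^ p + b * a ^ p)"
proof -
  have *: "(a + b) ^ Suc p \<le> b ^ Suc p + 2 ^ Suc p * real (Suc p) * (a * b ^ p)"
    if "0 \<le> a" "a \<le> b" for a b :: real
  proof -
    have "(a + b) ^ Suc p - b ^ Suc p = a * (\<Sum>k<Suc p. (a + b) ^ k * b ^ (p - k))"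
      using diff_power_eq_sum[of "a + b" p b] by simp
    also have "\<dots> \<le> a * (\<Sum>k<Suc p. 2 ^ p * b ^ p)"
    proof (intro mult_left_mono sum_mono)
      fix k assume k: "k \<in> {..<Suc p}"
      have "(a + b) ^ k * b ^ (p - k) \<le> (2 * b) ^ k * (2 * b) ^ (p - k)"
        using that by (intro mult_mono power_mono) auto
      also have "\<dots> = (2 * b) ^ (k + (p - k))" by (rule power_add[symmetric])
      also have "\<dots> = 2 ^ p * b ^ p" using k by (simp only: power_mult_distrib) simp
      finally show "(a + b) ^ k * b ^ (p - k) \<le> 2 ^ p * b ^ p" .
    qed (use that in auto)
    also have "\<dots> = 2 ^ p * real (Suc p) * (a * b ^ p)" by (simp add: algebra_simps)
    also have "\<dots> \<le> 2 ^ Suc p * real (Suc p) * (a * b ^ p)"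
      using that by (intro mult_right_mono) auto
    finally show ?thesis by simp
  qed
  show ?thesis
  proof (cases "a \<le> b")
    case True
    have "0 \<le> a ^ Suc p" "0 \<le> 2 ^ Suc p * real (Suc p) * (b * a ^ p)" using assms by auto
    then show ?thesis using *[OF assms(1) True] unfolding distrib_left by linarith
  next
    case False
    have "0 \<le> b ^ Suc p" "0 \<le> 2 ^ Suc p * real (Suc p) * (a * b ^ p)" using assms by auto
    then show ?thesis using *[of b a] assms False unfolding distrib_left add.commute[of a b] by linarith
  qed
qed

section \<open>Independence of families of weights\<close>

locale cascade_space = prob_space M for M :: "'a measure" +
  fixes w :: "nat list \<Rightarrow> 'a \<Rightarrow> real"
  assumes random: "random_cascade M w"
    and mean: "expectation (\<lambda>\<omega>. w [1] \<omega> + w [2] \<omega>) = 1"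
begin

text \<open>The sigma-algebra generated by the triples with index in \<open>A\<close>. The weight
  \<open>w (i @ [k])\<close> belongs to the triple of the parent \<open>i\<close>, so the mass at
  \<open>i\<close>, built from weights strictly below \<open>i\<close>, depends on the triples in
  \<open>subtree i\<close>, with \<open>i\<close> included.\<close>

definition info :: "nat list set \<Rightarrow> 'a measure" where
  "info A = vimage_algebra (space M) (\<lambda>\<omega>. \<lambda>i\<in>A. triple w i \<omega>) (Pi\<^sub>M A (\<lambda>_. triple_space))"

definition subtree :: "nat list \<Rightarrow> nat list set" where
  "subtree i = (@) i ` addresses"

lemma w_measurable: "i \<in> addresses \<Longrightarrow> k \<in> letters \<Longrightarrow> w (i @ [k]) \<in> borel_measurable M"
  using random by (auto simp: random_cascade_def addresses_iff)

lemma w_bounds: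
  "i \<in> addresses \<Longrightarrow> k \<in> letters \<Longrightarrow> \<omega> \<in> space M \<Longrightarrow> 0 \<le> w (i @ [k]) \<omega>"
  "i \<in> addresses \<Longrightarrow> k \<in> letters \<Longrightarrow> \<omega> \<in> space M \<Longrightarrow> w (i @ [k]) \<omega> \<le> 1"
  using random by (auto simp: random_cascade_def addresses_iff)

lemma w_nonzero: "AE \<omega> in M. \<forall>i\<in>addresses - {[]}. w i \<omega> \<noteq> 0"
proof (subst AE_ball_countable)
  show "countable (addresses - {[]})" by (rule countableI_type)
  show "\<forall>i\<in>addresses - {[]}. AE \<omega> in M. w i \<omega> \<noteq> 0"
    using random by (auto simp: random_cascade_def)
qed

lemma triple_indep: "indep_vars (\<lambda>_. triple_space) (triple w) addresses"
  using random by (auto simp: random_cascade_def)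

lemma triple_measurable: "i \<in> addresses \<Longrightarrow> triple w i \<in> measurable M triple_space"
  using triple_indep by (auto simp: indep_vars_def)

lemma expectation_triple:
  assumes i: "i \<in> addresses" and h: "h \<in> borel_measurable triple_space"
  shows "expectation (\<lambda>\<omega>. h (triple w i \<omega>)) = (expectation (\<lambda>\<omega>. h (triple w [] \<omega>)) :: real)"
proof -
  have "distr M triple_space (triple w i) = distr M triple_space (triple w [])"
    using random i by (auto simp: random_cascade_def)
  moreover have "[] \<in> addresses" by (simp add: addresses_iff)
  ultimately show ?thesis
    using integral_distr[OF triple_measurable[OF i] h] integral_distr[OF triple_measurable h] by metis
qed

lemma space_info [simp]: "space (info A) = space M"
  by (simp add: info_def)

lemma info_triple: "(\<lambda>\<omega>. \<lambda>i\<in>A. triple w i \<omega>) \<in> measurable (info A) (Pi\<^sub>M A (\<lambda>_. triple_space))"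
  unfolding info_def
  by (rule measurable_vimage_algebra1)
    (auto simp: space_PiM triple_def triple_space_def)

lemma info_w:
  assumes "i \<in> A" "k \<in> letters"
  shows "w (i @ [k]) \<in> borel_measurable (info A)"
proof -
  have "(\<lambda>x. x i) \<in> measurable (Pi\<^sub>M A (\<lambda>_. triple_space)) triple_space"
    using assms by simp
  moreover have "(\<lambda>x. x k) \<in> borel_measurable triple_space"
    using assms unfolding triple_space_def by simp
  ultimately have "(\<lambda>\<omega>. (\<lambda>i\<in>A. triple w i \<omega>) i k) \<in> borel_measurable (info A)"
    by (rule measurable_compose[OF measurable_compose[OF info_triple]])
  then show ?thesis using assms by (simp add: triple_def)
qed

lemma info_mono:
  assumes "A \<subseteq> B" "f \<in> borel_measurable (info A)"
  shows "f \<in> borel_measurable (info B)"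
proof -
  have "(\<lambda>\<omega>. \<lambda>i\<in>A. triple w i \<omega>) = (\<lambda>x. restrict x A) \<circ> (\<lambda>\<omega>. \<lambda>i\<in>B. triple w i \<omega>)"
    using assms(1) by (auto simp: fun_eq_iff restrict_def)
  then have "(\<lambda>\<omega>. \<lambda>i\<in>A. triple w i \<omega>) \<in> measurable (info B) (Pi\<^sub>M A (\<lambda>_. triple_space))"
    using measurable_comp[OF info_triple measurable_restrict_subset[OF assms(1)]] by simp
  then have "sets (info A) \<subseteq> sets (info B)"
    unfolding info_def[of A] by (intro sets_image_in_sets) auto
  then show ?thesis
    using measurable_sets[OF assms(2)] by (intro measurableI) auto
qed

lemma sets_info:
  assumes "A \<subseteq> addresses" shows "sets (info A) \<subseteq> sets M"
  unfolding info_def using assms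
  by (intro sets_image_in_sets measurable_restrict triple_measurable) auto

lemma info_measurable:
  assumes "A \<subseteq> addresses" "f \<in> borel_measurable (info A)"
  shows "f \<in> borel_measurable M"
  using measurable_sets[OF assms(2)] sets_info[OF assms(1)] by (intro measurableI) auto

text \<open>The families of triples over disjoint index sets generate independent sigma-algebras,
  and independence passes to the smaller sigma-algebras generated by \<open>f\<close> and
  \<open>g\<close>.\<close>

lemma info_indep:
  fixes f g :: "'a \<Rightarrow> real"
  assumes AB: "A \<inter> B = {}" "A \<subseteq> addresses" "B \<subseteq> addresses"
    and f: "f \<in> borel_measurable (info A)" and g: "g \<in> borel_measurable (info B)"
  shows "indep_var borel f borel g"
proof -
  have sets: "sigma_sets (space M) {(\<lambda>\<omega>. \<lambda>i\<in>A. triple w i \<omega>) -` S \<inter> space M |S.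
      S \<in> sets (Pi\<^sub>M A (\<lambda>_. triple_space))} = sets (info A)" for A
    unfolding info_def by (rule sets_vimage_algebra[symmetric])
  have "indep_set (sets (info A)) (sets (info B))"
    using indep_var_restrict[OF triple_indep AB] unfolding indep_var_eq sets by simp
  moreover have "sigma_sets (space M) {f -` S \<inter> space M |S. S \<in> sets borel} \<subseteq> sets (info A)"
    if "f \<in> borel_measurable (info A)" for f :: "'a \<Rightarrow> real" and A
    using measurable_sets[OF that] unfolding space_info[of A, symmetric]
    by (intro sets.sigma_sets_subset) auto
  ultimately have "indep_set (sigma_sets (space M) {f -` S \<inter> space M |S. S \<in> sets borel})
     (sigma_sets (space M) {g -` S \<inter> space M |S. S \<in> sets borel})"
    using f g unfolding indep_set_def
    by (elim indep_sets_mono_sets) (simp split: bool.split)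
  then show ?thesis
    unfolding indep_var_eq using info_measurable[OF AB(2) f] info_measurable[OF AB(3) g] by simp
qed

text \<open>All integrands below are bounded, so that integrability is never an issue.\<close>

definition bounded_rv :: "nat list set \<Rightarrow> ('a \<Rightarrow> real) \<Rightarrow> bool" where
  "bounded_rv A f \<longleftrightarrow> A \<subseteq> addresses \<and> f \<in> borel_measurable (info A) \<and> (\<exists>b. \<forall>\<omega>\<in>space M. \<bar>f \<omega>\<bar> \<le> b)"

lemma bounded_rv_integrable:
  assumes "bounded_rv A f" shows "integrable M f"
proof -
  obtain b where "\<forall>\<omega>\<in>space M. \<bar>f \<omega>\<bar> \<le> b" using assms by (auto simp: bounded_rv_def)
  then show ?thesis
    using assms info_measurable[of A f]
    by (intro integrable_const_bound[of _ b]) (auto simp: bounded_rv_def)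
qed

lemma bounded_rv_mono: "bounded_rv A f \<Longrightarrow> A \<subseteq> B \<Longrightarrow> B \<subseteq> addresses \<Longrightarrow> bounded_rv B f"
  by (auto simp: bounded_rv_def info_mono)

lemma bounded_rv_const [intro]: "A \<subseteq> addresses \<Longrightarrow> bounded_rv A (\<lambda>_. x)"
  by (auto simp: bounded_rv_def)

lemma bounded_rv_add [intro]:
  assumes "bounded_rv A f" "bounded_rv A g"
  shows "bounded_rv A (\<lambda>\<omega>. f \<omega> + g \<omega>)"
proof -
  obtain b b' where "\<forall>\<omega>\<in>space M. \<bar>f \<omega>\<bar> \<le> b" "\<forall>\<omega>\<in>space M. \<bar>g \<omega>\<bar> \<le> b'"
    using assms by (auto simp: bounded_rv_def)
  then have "\<forall>\<omega>\<in>space M. \<bar>f \<omega> + g \<omega>\<bar> \<le> b + b'" by fastforce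
  then show ?thesis using assms unfolding bounded_rv_def by auto
qed

lemma bounded_rv_mult [intro]:
  assumes "bounded_rv A f" "bounded_rv A g"
  shows "bounded_rv A (\<lambda>\<omega>. f \<omega> * g \<omega>)"
proof -
  obtain b b' where b: "\<forall>\<omega>\<in>space M. \<bar>f \<omega>\<bar> \<le> b" "\<forall>\<omega>\<in>space M. \<bar>g \<omega>\<bar> \<le> b'"
    using assms by (auto simp: bounded_rv_def)
  have "\<bar>f \<omega> * g \<omega>\<bar> \<le> b * b'" if "\<omega> \<in> space M" for \<omega>
  proof -
    have "\<bar>f \<omega>\<bar> \<le> b" "\<bar>g \<omega>\<bar> \<le> b'" using b that by auto
    then show ?thesis unfolding abs_mult by (intro mult_mono) auto
  qed
  then show ?thesis using assms unfolding bounded_rv_def by auto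
qed

lemma bounded_rv_diff [intro]:
  assumes "bounded_rv A f" "bounded_rv A g"
  shows "bounded_rv A (\<lambda>\<omega>. f \<omega> - g \<omega>)"
proof -
  have A: "A \<subseteq> addresses" using assms(1) by (simp add: bounded_rv_def)
  show ?thesis
    using bounded_rv_add[OF assms(1) bounded_rv_mult[OF bounded_rv_const[OF A, of "-1"] assms(2)]]
    by simp
qed

lemma bounded_rv_power [intro]: "bounded_rv A f \<Longrightarrow> bounded_rv A (\<lambda>\<omega>. f \<omega> ^ p)"
proof (induction p)
  case 0
  then show ?case by (auto simp: bounded_rv_def intro!: exI[of _ 1])
qed auto

lemma bounded_rv_powr [intro]:
  assumes "bounded_rv A f" "0 \<le> s"
  shows "bounded_rv A (\<lambda>\<omega>. f \<omega> powr s)"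
proof -
  obtain b where "\<forall>\<omega>\<in>space M. \<bar>f \<omega>\<bar> \<le> b" using assms by (auto simp: bounded_rv_def)
  \<comment> \<open>The real \<open>powr\<close> sees only the absolute value of its base, so no
    sign condition on \<open>f\<close> is called for.\<close>
  moreover have "x powr s = \<bar>x\<bar> powr s" for x :: real
    by (simp add: abs_if uminus_powr_eq)
  ultimately have "\<forall>\<omega>\<in>space M. \<bar>f \<omega> powr s\<bar> \<le> b powr s"
    using powr_mono2[OF assms(2) abs_ge_zero] by (metis abs_of_nonneg powr_ge_zero)
  then show ?thesis using assms unfolding bounded_rv_def by auto
qed

lemma bounded_rv_sum [intro]:
  assumes "A \<subseteq> addresses" "\<And>k. k \<in> K \<Longrightarrow> bounded_rv A (f k)"
  shows "bounded_rv A (\<lambda>\<omega>. \<Sum>k\<in>K. f k \<omega>)"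
  using assms(2)
  by (induction K rule: infinite_finite_induct) (auto intro: bounded_rv_const[OF assms(1)])

lemma expectation_mult:
  assumes "A \<inter> B = {}" "bounded_rv A f" "bounded_rv B g"
  shows "expectation (\<lambda>\<omega>. f \<omega> * g \<omega>) = expectation f * expectation g"
proof (rule indep_var_lebesgue_integral)
  show "indep_var borel f borel g"
    using assms by (intro info_indep[of A B]) (auto simp: bounded_rv_def)
qed (use assms bounded_rv_integrable in auto)

lemma bounded_rv_w: "i \<in> A \<Longrightarrow> A \<subseteq> addresses \<Longrightarrow> k \<in> letters \<Longrightarrow> bounded_rv A (w (i @ [k]))"
  unfolding bounded_rv_def using info_w[of i A k] w_bounds[of i k]
  by (intro conjI exI[of _ 1] ballI) (auto simp: abs_of_nonneg)

section \<open>Partial masses and their means\<close>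

abbreviation (input) Z :: "nat \<Rightarrow> nat list \<Rightarrow> 'a \<Rightarrow> real" where
  "Z n i \<omega> \<equiv> mass (\<lambda>i. w i \<omega>) n i"

lemma subtree_addresses: "i \<in> addresses \<Longrightarrow> subtree i \<subseteq> addresses"
  by (auto simp: subtree_def addresses_iff)

lemma subtree_self: "i \<in> subtree i"
  by (auto simp: subtree_def addresses_iff image_iff intro!: exI[of _ "[]"])

lemma subtree_child: "k \<in> letters \<Longrightarrow> subtree (i @ [k]) \<subseteq> subtree i"
  by (auto simp: subtree_def addresses_iff image_iff)

lemma subtree_disjoint: "k \<noteq> l \<Longrightarrow> subtree (i @ [k]) \<inter> subtree (i @ [l]) = {}"
  by (auto simp: subtree_def)

lemma notin_subtree_child: "i \<notin> subtree (i @ [k])"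
  by (auto simp: subtree_def)

lemma mass_bounds:
  assumes "i \<in> addresses" "\<omega> \<in> space M"
  shows "0 \<le> Z n i \<omega>" "Z n i \<omega> \<le> 2 ^ n"
proof -
  have "0 \<le> Z n i \<omega> \<and> Z n i \<omega> \<le> 2 ^ n"
    using assms
  proof (induction n arbitrary: i)
    case (Suc n)
    have *: "0 \<le> w (i @ [k]) \<omega> * Z n (i @ [k]) \<omega> \<and> w (i @ [k]) \<omega> * Z n (i @ [k]) \<omega> \<le> 1 * 2 ^ n"
      if "k \<in> letters" for k
      using Suc.IH[OF snoc_addresses[OF Suc.prems(1) that] Suc.prems(2)]
        w_bounds[OF Suc.prems(1) that Suc.prems(2)]
      by (intro conjI mult_mono mult_nonneg_nonneg) auto
    show ?case using *[of 1] *[of 2] by simp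
  qed simp
  then show "0 \<le> Z n i \<omega>" "Z n i \<omega> \<le> 2 ^ n" by auto
qed

lemma mass_measurable:
  assumes "subtree i \<subseteq> A" shows "Z n i \<in> borel_measurable (info A)"
  using assms
proof (induction n arbitrary: i)
  case (Suc n)
  have "i \<in> A" using Suc.prems subtree_self by auto
  moreover have "subtree (i @ [k]) \<subseteq> A" if "k \<in> letters" for k
    using Suc.prems subtree_child[OF that] by blast
  ultimately show ?case
    by (simp del: One_nat_def)
      (intro borel_measurable_add borel_measurable_times info_w Suc.IH; simp)
qed simp

lemma bounded_rv_mass: "i \<in> addresses \<Longrightarrow> bounded_rv (subtree i) (Z n i)"
  unfolding bounded_rv_def
  using mass_measurable[of i "subtree i" n] subtree_addresses[of i] mass_bounds[of i]
  by (intro conjI exI[of _ "2 ^ n"] ballI) auto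

lemma bounded_rv_weight: "i \<in> addresses \<Longrightarrow> k \<in> letters \<Longrightarrow> bounded_rv {i} (w (i @ [k]))"
  by (rule bounded_rv_w) auto

text \<open>Only independence of two disjoint families of triples is available, hence the two steps:
  first the triple at \<open>i\<close> is split off, then the two subtrees are separated.\<close>

lemma expectation_split:
  assumes i: "i \<in> addresses" and U: "bounded_rv {i} U"
    and X: "bounded_rv (subtree (i @ [1])) X" and Y: "bounded_rv (subtree (i @ [2])) Y"
  shows "expectation (\<lambda>\<omega>. U \<omega> * (X \<omega> * Y \<omega>)) = expectation U * (expectation X * expectation Y)"
proof -
  let ?B = "subtree (i @ [1]) \<union> subtree (i @ [2])"
  have B: "?B \<subseteq> addresses" using i by (intro Un_least subtree_addresses snoc_addresses) auto
  have "expectation (\<lambda>\<omega>. U \<omega> * (X \<omega> * Y \<omega>)) = expectation U * expectation (\<lambda>\<omega>. X \<omega> * Y \<omega>)"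
    using X Y B notin_subtree_child
    by (intro expectation_mult[of "{i}" ?B] U bounded_rv_mult)
      (auto intro: bounded_rv_mono)
  also have "expectation (\<lambda>\<omega>. X \<omega> * Y \<omega>) = expectation X * expectation Y"
    by (rule expectation_mult[OF subtree_disjoint X Y]) simp
  finally show ?thesis .
qed

lemma bounded_rv_one: "i \<in> addresses \<Longrightarrow> k \<in> letters \<Longrightarrow> bounded_rv (subtree (i @ [k])) (\<lambda>_. 1)"
  by (intro bounded_rv_const subtree_addresses snoc_addresses)

lemma expectation_split1:
  assumes "i \<in> addresses" "bounded_rv {i} U" "bounded_rv (subtree (i @ [1])) X"
  shows "expectation (\<lambda>\<omega>. U \<omega> * X \<omega>) = expectation U * expectation X"
  using expectation_split[OF assms bounded_rv_one[OF assms(1)]] by (simp add: prob_space)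

lemma expectation_split2:
  assumes "i \<in> addresses" "bounded_rv {i} U" "bounded_rv (subtree (i @ [2])) Y"
  shows "expectation (\<lambda>\<omega>. U \<omega> * Y \<omega>) = expectation U * expectation Y"
  using expectation_split[OF assms(1,2) bounded_rv_one[OF assms(1)] assms(3)] by (simp add: prob_space)

text \<open>Carries moment conditions stated at the root to every address; only the law of a single
  triple is compared.\<close>

lemma expectation_weights:
  assumes i: "i \<in> addresses" and K: "K \<subseteq> letters" and g: "g \<in> borel_measurable borel"
  shows "expectation (\<lambda>\<omega>. \<Sum>k\<in>K. g (w (i @ [k]) \<omega>)) = (expectation (\<lambda>\<omega>. \<Sum>k\<in>K. g (w [k] \<omega>)) :: real)"
proof -
  let ?h = "\<lambda>x. \<Sum>k\<in>K. g (x k) :: real"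
  have "(\<lambda>x. g (x k)) \<in> borel_measurable triple_space" if "k \<in> K" for k
    using that K unfolding triple_space_def
    by (intro measurable_compose[OF _ g] measurable_component_singleton) auto
  then have "?h \<in> borel_measurable triple_space" by (rule borel_measurable_sum)
  from expectation_triple[OF i this] show ?thesis
    using K by (simp add: triple_def subset_iff)
qed

lemma expectation_weight_sum:
  assumes "i \<in> addresses"
  shows "expectation (w (i @ [1])) + expectation (w (i @ [2])) = 1"
proof -
  have "expectation (\<lambda>\<omega>. \<Sum>k\<in>{1, 2}. w (i @ [k]) \<omega>) = 1"
    using expectation_weights[OF assms, of "{1, 2}" "\<lambda>x. x"] mean by simp
  then show ?thesis
    using bounded_rv_integrable[OF bounded_rv_weight[OF assms]] by simp
qed

lemma expectation_mass: "i \<in> addresses \<Longrightarrow> expectation (Z n i) = 1"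
proof (induction n arbitrary: i)
  case (Suc n)
  note i = Suc.prems
  have Z: "bounded_rv (subtree (i @ [k])) (Z n (i @ [k]))" if "k \<in> letters" for k
    using i that by (intro bounded_rv_mass snoc_addresses)
  have int: "integrable M (\<lambda>\<omega>. w (i @ [k]) \<omega> * Z n (i @ [k]) \<omega>)" if "k \<in> letters" for k
    using i that
    by (intro bounded_rv_integrable[of addresses] bounded_rv_mult)
      (auto intro!: bounded_rv_mono[OF bounded_rv_weight] bounded_rv_mono[OF Z] subtree_addresses
        snoc_addresses)
  show ?case
    using expectation_split1[OF i bounded_rv_weight[OF i] Z] expectation_split2[OF i bounded_rv_weight[OF i] Z]
      int Suc.IH[OF snoc_addresses[OF i]] expectation_weight_sum[OF i]
    by simp
qed (simp add: prob_space)

text \<open>The weights are at most 1 and non-zero, and cannot both be 1 because of the mean.\<close>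

lemma expectation_powr_less:
  assumes K: "{1, 2} \<subseteq> K" "K \<subseteq> letters" and ab: "0 < a" "a < b"
    and le: "expectation (\<lambda>\<omega>. \<Sum>k\<in>K. w [k] \<omega> powr a) \<le> 1"
  shows "expectation (\<lambda>\<omega>. \<Sum>k\<in>K. w [k] \<omega> powr b) < 1"
proof (rule ccontr)
  assume ge: "\<not> ?thesis"
  have nil: "[] \<in> addresses" by (simp add: addresses_iff)
  have w: "bounded_rv {[]} (w [k])" if "k \<in> letters" for k
    using bounded_rv_weight[OF nil that] by simp
  have int: "integrable M (\<lambda>\<omega>. \<Sum>k\<in>K. w [k] \<omega> powr s)" if "0 \<le> s" for s
    using nil K that by (intro bounded_rv_integrable[of "{[]}"] bounded_rv_sum bounded_rv_powr w) auto
  let ?d = "\<lambda>\<omega>. (\<Sum>k\<in>K. w [k] \<omega> powr a) - (\<Sum>k\<in>K. w [k] \<omega> powr b)"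
  have wb: "0 \<le> w [k] \<omega>" "w [k] \<omega> \<le> 1" if "k \<in> K" "\<omega> \<in> space M" for k \<omega>
    using w_bounds[OF nil, of k \<omega>] that K by auto
  have mono: "w [k] \<omega> powr b \<le> w [k] \<omega> powr a" if "k \<in> K" "\<omega> \<in> space M" for k \<omega>
    using wb[OF that] ab by (cases "w [k] \<omega> = 0") (auto intro: powr_mono')
  have nonneg: "0 \<le> ?d \<omega>" if "\<omega> \<in> space M" for \<omega>
    using mono that by (simp add: sum_mono)
  have d: "integrable M ?d" "expectation ?d \<le> 0"
    using int[of a] int[of b] ab le ge by auto
  moreover have "expectation ?d \<ge> 0"
    using nonneg by (intro Bochner_Integration.integral_nonneg)
  ultimately have "AE \<omega> in M. ?d \<omega> = 0"
    using integral_nonneg_eq_0_iff_AE[OF d(1)] nonneg by auto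
  moreover have "AE \<omega> in M. \<forall>k\<in>letters. w [k] \<omega> \<noteq> 0"
    using w_nonzero by (auto simp: addresses_iff)
  ultimately have "AE \<omega> in M. w [1] \<omega> + w [2] \<omega> = 2"
    using AE_space
  proof (eventually_elim)
    case (elim \<omega>)
    have "w [k] \<omega> = 1" if k: "k \<in> K" for k
    proof (rule ccontr)
      assume "w [k] \<omega> \<noteq> 1"
      then have "0 < w [k] \<omega>" "w [k] \<omega> < 1"
        using wb[OF k elim(3)] elim(2) k K by (auto simp: less_le)
      then have "w [k] \<omega> powr b < w [k] \<omega> powr a"
        using ab by (intro powr_less_mono') auto
      then have "(\<Sum>k\<in>K. w [k] \<omega> powr b) < (\<Sum>k\<in>K. w [k] \<omega> powr a)"
        using k mono elim(3) finite_subset[OF K(2) finite_letters]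
        by (intro sum_strict_mono_ex1) auto
      then show False using elim(1) by simp
    qed
    then show ?case using K by simp
  qed
  then have "expectation (\<lambda>\<omega>. w [1] \<omega> + w [2] \<omega>) = expectation (\<lambda>\<omega>. 2)"
    using w_measurable[OF nil, of 1] w_measurable[OF nil, of 2]
    by (intro integral_cong_AE) auto
  then show False using mean by (simp add: prob_space)
qed

section \<open>Moments of the partial masses\<close>

lemma expectation_power_less:
  assumes "2 \<le> p"
  shows "\<exists>q. 0 < q \<and> q < 1 \<and> (\<forall>i\<in>addresses. expectation (\<lambda>\<omega>. w (i @ [1]) \<omega> ^ p) + 
    expectation (\<lambda>\<omega>. w (i @ [2]) \<omega> ^ p) \<le> q)"
proof -
  let ?e = "expectation (\<lambda>\<omega>. \<Sum>k\<in>{1, 2}. w [k] \<omega> powr real p)"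
  have nil: "[] \<in> addresses" by (simp add: addresses_iff)
  have "expectation (\<lambda>\<omega>. \<Sum>k\<in>{1, 2}. w [k] \<omega> powr 1) = expectation (\<lambda>\<omega>. w [1] \<omega> + w [2] \<omega>)"
    using w_bounds[OF nil] by (intro Bochner_Integration.integral_cong) auto
  then have e: "?e < 1"
    using assms mean by (intro expectation_powr_less[of "{1, 2}" 1]) auto
  have "expectation (\<lambda>\<omega>. w (i @ [1]) \<omega> ^ p) + expectation (\<lambda>\<omega>. w (i @ [2]) \<omega> ^ p) = ?e"
    if i: "i \<in> addresses" for i
  proof -
    have int: "integrable M (\<lambda>\<omega>. w (i @ [k]) \<omega> ^ p)" if "k \<in> letters" for k
      by (intro bounded_rv_integrable[of "{i}"] bounded_rv_power bounded_rv_weight i that)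
    have "expectation (\<lambda>\<omega>. w (i @ [1]) \<omega> ^ p) + expectation (\<lambda>\<omega>. w (i @ [2]) \<omega> ^ p) =
        expectation (\<lambda>\<omega>. \<Sum>k\<in>{1, 2}. w (i @ [k]) \<omega> ^ p)"
      using int by simp
    also have "\<dots> = expectation (\<lambda>\<omega>. \<Sum>k\<in>{1, 2}. w (i @ [k]) \<omega> powr real p)"
      using assms w_bounds[OF i] by (intro Bochner_Integration.integral_cong) (auto simp: powr_realpow')
    also have "\<dots> = ?e" by (intro expectation_weights[OF i]) auto
    finally show ?thesis .
  qed
  \<comment> \<open>The maximum with \<open>1 / 2\<close> makes the rate visibly positive.\<close>
  then show ?thesis
    using e by (intro exI[of _ "max (1 / 2) ?e"]) auto
qed

text \<open>The outer induction is on the order of the moment, the inner one on the generation. Pure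
  powers are contracted by \<open>q < 1\<close>; mixed terms are products over different subtrees
  and factor into a mean and a moment of the previous order.\<close>

lemma mass_moment_bound: "\<exists>B. \<forall>n. \<forall>i\<in>addresses. expectation (\<lambda>\<omega>. Z n i \<omega> ^ Suc p) \<le> B"
proof (induction p)
  case 0
  then show ?case by (intro exI[of _ 1]) (auto simp: expectation_mass)
next
  case (Suc p)
  then obtain B' where B': "\<And>n i. i \<in> addresses \<Longrightarrow> expectation (\<lambda>\<omega>. Z n i \<omega> ^ Suc p) \<le> B'" by blast
  let ?p = "Suc (Suc p)"
  obtain q where q: "0 < q" "q < 1" "\<And>i. i \<in> addresses \<Longrightarrow>
      expectation (\<lambda>\<omega>. w (i @ [1]) \<omega> ^ ?p) + expectation (\<lambda>\<omega>. w (i @ [2]) \<omega> ^ ?p) \<le> q"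
    using expectation_power_less[of ?p] by auto
  let ?c = "2 ^ ?p * real ?p"
  \<comment> \<open>Chosen so that \<open>q * B + ?c * (2 * B') \<le> B\<close>, which the inner
    induction preserves; the 1 covers generation 0, where the mass is 1.\<close>
  define B where "B = max 1 (?c * (2 * B') / (1 - q))"
  have nil: "[] \<in> addresses" by (simp add: addresses_iff)
  have "0 \<le> B'"
    using B'[OF nil, of 0] by (simp add: prob_space)
  have "expectation (\<lambda>\<omega>. Z n i \<omega> ^ ?p) \<le> B" if "i \<in> addresses" for n i
    using that
  proof (induction n arbitrary: i)
    case 0
    then show ?case by (simp add: B_def prob_space)
  next
    case (Suc n)
    note i = Suc.prems
    define W where "W k = w (i @ [k])" for k
    define X where "X k = Z n (i @ [k])" for k
    have W: "bounded_rv {i} (W k)" if "k \<in> letters" for k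
      unfolding W_def using i that by (rule bounded_rv_weight)
    have X: "bounded_rv (subtree (i @ [k])) (X k)" if "k \<in> letters" for k
      unfolding X_def using i that by (intro bounded_rv_mass snoc_addresses)
    have A: "bounded_rv addresses (W k)" "bounded_rv addresses (X k)" if "k \<in> letters" for k
      using i that
      by (auto intro!: bounded_rv_mono[OF W] bounded_rv_mono[OF X] subtree_addresses snoc_addresses)
    have Wb: "0 \<le> W k \<omega>" "W k \<omega> \<le> 1" and X0: "0 \<le> X k \<omega>" if "k \<in> letters" "\<omega> \<in> space M" for k \<omega>
      using w_bounds[OF i that] mass_bounds(1)[OF snoc_addresses[OF i that(1)] that(2)]
      by (auto simp: W_def X_def)
    \<comment> \<open>The weights are kept in the pure powers, where their moments give the factor
      \<open>q\<close>, and bounded by 1 in the mixed terms.\<close>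
    define T where "T \<omega> = W 1 \<omega> ^ ?p * X 1 \<omega> ^ ?p + W 2 \<omega> ^ ?p * X 2 \<omega> ^ ?p +
      ?c * (X 1 \<omega> * X 2 \<omega> ^ Suc p + X 1 \<omega> ^ Suc p * X 2 \<omega>)" for \<omega>
    have T: "bounded_rv addresses T"
      unfolding T_def by (intro bounded_rv_add bounded_rv_mult bounded_rv_power bounded_rv_const A) auto
    have "Z (Suc n) i \<omega> ^ ?p \<le> T \<omega>" if \<omega>: "\<omega> \<in> space M" for \<omega>
    proof -
      have eq: "Z (Suc n) i \<omega> = W 1 \<omega> * X 1 \<omega> + W 2 \<omega> * X 2 \<omega>" by (simp add: W_def X_def)
      have "(W 1 \<omega> * X 1 \<omega> + W 2 \<omega> * X 2 \<omega>) ^ ?p \<le> (W 1 \<omega> * X 1 \<omega>) ^ ?p + (W 2 \<omega> * X 2 \<omega>) ^ ?p +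
        ?c * ((W 1 \<omega> * X 1 \<omega>) * (W 2 \<omega> * X 2 \<omega>) ^ Suc p + (W 2 \<omega> * X 2 \<omega>) * (W 1 \<omega> * X 1 \<omega>) ^ Suc p)"
        using \<omega> by (intro power_add_le mult_nonneg_nonneg Wb X0) auto
      also have "\<dots> \<le> (W 1 \<omega> * X 1 \<omega>) ^ ?p + (W 2 \<omega> * X 2 \<omega>) ^ ?p +
        ?c * ((1 * X 1 \<omega>) * (1 * X 2 \<omega>) ^ Suc p + (1 * X 2 \<omega>) * (1 * X 1 \<omega>) ^ Suc p)"
        using \<omega> by (intro add_left_mono mult_left_mono add_mono mult_mono power_mono mult_right_mono Wb X0
            mult_nonneg_nonneg zero_le_power) auto
      finally show ?thesis
        unfolding eq T_def by (simp only: power_mult_distrib mult_1 mult.commute[of "X 2 \<omega>"])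
    qed
    then have "expectation (\<lambda>\<omega>. Z (Suc n) i \<omega> ^ ?p) \<le> expectation T"
      using i by (intro integral_mono bounded_rv_integrable[OF T]
          bounded_rv_integrable[OF bounded_rv_power[OF bounded_rv_mass]])
    also have "expectation T = expectation (\<lambda>\<omega>. W 1 \<omega> ^ ?p * X 1 \<omega> ^ ?p) +
        expectation (\<lambda>\<omega>. W 2 \<omega> ^ ?p * X 2 \<omega> ^ ?p) +
        ?c * (expectation (\<lambda>\<omega>. X 1 \<omega> * X 2 \<omega> ^ Suc p) + expectation (\<lambda>\<omega>. X 1 \<omega> ^ Suc p * X 2 \<omega>))"
    proof -
      have "integrable M (\<lambda>\<omega>. W k \<omega> ^ ?p * X k \<omega> ^ ?p)" if "k \<in> letters" for k
        by (intro bounded_rv_integrable[of addresses] bounded_rv_mult bounded_rv_power A that)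
      moreover have "integrable M (\<lambda>\<omega>. X 1 \<omega> * X 2 \<omega> ^ Suc p)" "integrable M (\<lambda>\<omega>. X 1 \<omega> ^ Suc p * X 2 \<omega>)"
        by (intro bounded_rv_integrable[of addresses] bounded_rv_mult bounded_rv_power A; simp)+
      ultimately show ?thesis
        unfolding T_def by (simp del: power_Suc)
    qed
    also have "expectation (\<lambda>\<omega>. W 1 \<omega> ^ ?p * X 1 \<omega> ^ ?p) =
        expectation (\<lambda>\<omega>. W 1 \<omega> ^ ?p) * expectation (\<lambda>\<omega>. X 1 \<omega> ^ ?p)"
      by (intro expectation_split1[OF i] bounded_rv_power W X) auto
    also have "expectation (\<lambda>\<omega>. W 2 \<omega> ^ ?p * X 2 \<omega> ^ ?p) =
        expectation (\<lambda>\<omega>. W 2 \<omega> ^ ?p) * expectation (\<lambda>\<omega>. X 2 \<omega> ^ ?p)"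
      by (intro expectation_split2[OF i] bounded_rv_power W X) auto
    also have "expectation (\<lambda>\<omega>. X 1 \<omega> * X 2 \<omega> ^ Suc p) = expectation (X 1) * expectation (\<lambda>\<omega>. X 2 \<omega> ^ Suc p)"
      by (intro expectation_mult[OF subtree_disjoint[of 1 2 i]] bounded_rv_power X) auto
    also have "expectation (\<lambda>\<omega>. X 1 \<omega> ^ Suc p * X 2 \<omega>) = expectation (\<lambda>\<omega>. X 1 \<omega> ^ Suc p) * expectation (X 2)"
      by (intro expectation_mult[OF subtree_disjoint[of 1 2 i]] bounded_rv_power X) auto
    also have "expectation (\<lambda>\<omega>. W 1 \<omega> ^ ?p) * expectation (\<lambda>\<omega>. X 1 \<omega> ^ ?p) +
        expectation (\<lambda>\<omega>. W 2 \<omega> ^ ?p) * expectation (\<lambda>\<omega>. X 2 \<omega> ^ ?p) +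
        ?c * (expectation (X 1) * expectation (\<lambda>\<omega>. X 2 \<omega> ^ Suc p) +
          expectation (\<lambda>\<omega>. X 1 \<omega> ^ Suc p) * expectation (X 2)) \<le>
        expectation (\<lambda>\<omega>. W 1 \<omega> ^ ?p) * B + expectation (\<lambda>\<omega>. W 2 \<omega> ^ ?p) * B + ?c * (1 * B' + B' * 1)"
    proof (intro add_mono mult_left_mono)
      show "expectation (\<lambda>\<omega>. X 1 \<omega> ^ ?p) \<le> B" "expectation (\<lambda>\<omega>. X 2 \<omega> ^ ?p) \<le> B"
        unfolding X_def using i by (intro Suc.IH snoc_addresses; simp)+
      have "expectation (X k) = 1" "expectation (\<lambda>\<omega>. X k \<omega> ^ Suc p) \<le> B'" if "k \<in> letters" for k
        unfolding X_def using i that by (intro expectation_mass B' snoc_addresses; simp)+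
      then show "expectation (X 1) * expectation (\<lambda>\<omega>. X 2 \<omega> ^ Suc p) \<le> 1 * B'"
        "expectation (\<lambda>\<omega>. X 1 \<omega> ^ Suc p) * expectation (X 2) \<le> B' * 1"
        by (simp_all del: power_Suc)
      show "0 \<le> expectation (\<lambda>\<omega>. W 1 \<omega> ^ ?p)" "0 \<le> expectation (\<lambda>\<omega>. W 2 \<omega> ^ ?p)"
        using Wb by (auto intro!: Bochner_Integration.integral_nonneg)
    qed auto
    also have "\<dots> = (expectation (\<lambda>\<omega>. W 1 \<omega> ^ ?p) + expectation (\<lambda>\<omega>. W 2 \<omega> ^ ?p)) * B + ?c * (2 * B')"
      by (simp add: algebra_simps)
    also have "\<dots> \<le> q * B + (1 - q) * B"
    proof (intro add_mono mult_right_mono)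
      show "expectation (\<lambda>\<omega>. W 1 \<omega> ^ ?p) + expectation (\<lambda>\<omega>. W 2 \<omega> ^ ?p) \<le> q"
        unfolding W_def using q(3)[OF i] .
      have "?c * (2 * B') / (1 - q) \<le> B" by (simp only: B_def max.cobounded2)
      then show "?c * (2 * B') \<le> (1 - q) * B"
        using q(2) by (simp only: pos_divide_le_eq diff_gt_0_iff_gt mult.commute)
      show "0 \<le> B" by (simp add: B_def)
    qed
    finally show ?case by (simp add: algebra_simps)
  qed
  then show ?case by blast
qed

section \<open>Almost sure convergence of the masses\<close>

lemma abs_le_weighted_square:
  fixes d t :: real
  assumes "0 < t" shows "\<bar>d\<bar> \<le> (d\<^sup>2 / t + t) / 2"
proof -
  have "\<bar>d\<bar> * (2 * t) \<le> d\<^sup>2 + t * t"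
    using sum_squares_bound[of "\<bar>d\<bar>" t] by (simp add: power2_eq_square)
  then have "\<bar>d\<bar> \<le> (d\<^sup>2 + t * t) / (2 * t)" using assms by (simp add: pos_le_divide_eq)
  also have "\<dots> = (d\<^sup>2 / t + t) / 2" using assms by (simp add: add_divide_distrib)
  finally show ?thesis .
qed

text \<open>The increments obey the same recursion as the masses. They are centred and independent
  in different subtrees, so the cross term vanishes, and each generation contributes a factor
  bounded by the second moments of the weights.\<close>

lemma mass_increment_second_moment:
  "\<exists>q. 0 < q \<and> q < 1 \<and>
    (\<forall>n. \<forall>i\<in>addresses. expectation (\<lambda>\<omega>. (Z (Suc n) i \<omega> - Z n i \<omega>)\<^sup>2) \<le> q ^ n)"
proof -
  obtain q where q: "0 < q" "q < 1" "\<And>i. i \<in> addresses \<Longrightarrow>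
      expectation (\<lambda>\<omega>. w (i @ [1]) \<omega> ^ 2) + expectation (\<lambda>\<omega>. w (i @ [2]) \<omega> ^ 2) \<le> q"
    using expectation_power_less[of 2] by auto
  have "expectation (\<lambda>\<omega>. (Z (Suc n) i \<omega> - Z n i \<omega>)\<^sup>2) \<le> q ^ n" if "i \<in> addresses" for n i
    using that
  proof (induction n arbitrary: i)
    case (0 i)
    \<comment> \<open>The first increment is the sum of two numbers in the unit interval minus
      1.\<close>
    have "(Z (Suc 0) i \<omega> - Z 0 i \<omega>)\<^sup>2 \<le> 1" if "\<omega> \<in> space M" for \<omega>
      using w_bounds[OF 0, of 1 \<omega>] w_bounds[OF 0, of 2 \<omega>] that
      by (simp add: abs_square_le_1 abs_le_iff)
    then have "expectation (\<lambda>\<omega>. (Z (Suc 0) i \<omega> - Z 0 i \<omega>)\<^sup>2) \<le> expectation (\<lambda>\<omega>. 1)"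
      by (intro integral_mono bounded_rv_integrable[of "subtree i"] bounded_rv_power bounded_rv_diff
          bounded_rv_mass bounded_rv_const subtree_addresses 0)
    then show ?case by (simp add: prob_space)
  next
    case (Suc n)
    note i = Suc.prems
    define W where "W k = w (i @ [k])" for k
    define D where "D k \<omega> = Z (Suc n) (i @ [k]) \<omega> - Z n (i @ [k]) \<omega>" for k \<omega>
    have W: "bounded_rv {i} (W k)" if "k \<in> letters" for k
      unfolding W_def using i that by (rule bounded_rv_weight)
    have D: "bounded_rv (subtree (i @ [k])) (D k)" if "k \<in> letters" for k
      unfolding D_def using i that by (intro bounded_rv_diff bounded_rv_mass snoc_addresses)
    have A: "bounded_rv addresses (W k)" "bounded_rv addresses (D k)" if "k \<in> letters" for k
      using i that
      by (auto intro!: bounded_rv_mono[OF W] bounded_rv_mono[OF D] subtree_addresses snoc_addresses)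
    have ED: "expectation (D k) = 0" if "k \<in> letters" for k
    proof -
      have "expectation (D k) = expectation (Z (Suc n) (i @ [k])) - expectation (Z n (i @ [k]))"
        unfolding D_def using i that
        by (intro Bochner_Integration.integral_diff bounded_rv_integrable[OF bounded_rv_mass] snoc_addresses)
      then show ?thesis using i that by (simp add: expectation_mass snoc_addresses del: mass.simps)
    qed
    have "Z (Suc (Suc n)) i \<omega> - Z (Suc n) i \<omega> = W 1 \<omega> * D 1 \<omega> + W 2 \<omega> * D 2 \<omega>" for \<omega>
      by (subst mass.simps(2), subst (2) mass.simps(2))
        (simp only: W_def D_def right_diff_distrib; simp)
    then have "(Z (Suc (Suc n)) i \<omega> - Z (Suc n) i \<omega>)\<^sup>2 = (W 1 \<omega>)\<^sup>2 * (D 1 \<omega>)\<^sup>2 + (W 2 \<omega>)\<^sup>2 * (D 2 \<omega>)\<^sup>2 +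
        2 * ((W 1 \<omega> * W 2 \<omega>) * (D 1 \<omega> * D 2 \<omega>))" for \<omega>
      by (simp only: power2_sum power_mult_distrib) simp
    moreover have "integrable M (\<lambda>\<omega>. (W k \<omega>)\<^sup>2 * (D k \<omega>)\<^sup>2)" if "k \<in> letters" for k
      by (intro bounded_rv_integrable[of addresses] bounded_rv_mult bounded_rv_power A that)
    moreover have "integrable M (\<lambda>\<omega>. (W 1 \<omega> * W 2 \<omega>) * (D 1 \<omega> * D 2 \<omega>))"
      by (intro bounded_rv_integrable[of addresses] bounded_rv_mult A) auto
    ultimately have "expectation (\<lambda>\<omega>. (Z (Suc (Suc n)) i \<omega> - Z (Suc n) i \<omega>)\<^sup>2) =
        expectation (\<lambda>\<omega>. (W 1 \<omega>)\<^sup>2 * (D 1 \<omega>)\<^sup>2) + expectation (\<lambda>\<omega>. (W 2 \<omega>)\<^sup>2 * (D 2 \<omega>)\<^sup>2) +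
        2 * expectation (\<lambda>\<omega>. (W 1 \<omega> * W 2 \<omega>) * (D 1 \<omega> * D 2 \<omega>))"
      by (simp del: mass.simps)
    also have "expectation (\<lambda>\<omega>. (W 1 \<omega>)\<^sup>2 * (D 1 \<omega>)\<^sup>2) = expectation (\<lambda>\<omega>. (W 1 \<omega>)\<^sup>2) * expectation (\<lambda>\<omega>. (D 1 \<omega>)\<^sup>2)"
      by (intro expectation_split1[OF i] bounded_rv_power W D) auto
    also have "expectation (\<lambda>\<omega>. (W 2 \<omega>)\<^sup>2 * (D 2 \<omega>)\<^sup>2) = expectation (\<lambda>\<omega>. (W 2 \<omega>)\<^sup>2) * expectation (\<lambda>\<omega>. (D 2 \<omega>)\<^sup>2)"
      by (intro expectation_split2[OF i] bounded_rv_power W D) auto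
    \<comment> \<open>The two weights may be dependent, so their product is treated as a single
      factor; the centred increments make the expectation vanish.\<close>
    also have "expectation (\<lambda>\<omega>. (W 1 \<omega> * W 2 \<omega>) * (D 1 \<omega> * D 2 \<omega>)) = 0"
      using expectation_split[OF i bounded_rv_mult[OF W W] D D, of 1 2] ED by simp
    also have "expectation (\<lambda>\<omega>. (W 1 \<omega>)\<^sup>2) * expectation (\<lambda>\<omega>. (D 1 \<omega>)\<^sup>2) +
        expectation (\<lambda>\<omega>. (W 2 \<omega>)\<^sup>2) * expectation (\<lambda>\<omega>. (D 2 \<omega>)\<^sup>2) + 2 * 0 \<le>
        expectation (\<lambda>\<omega>. (W 1 \<omega>)\<^sup>2) * q ^ n + expectation (\<lambda>\<omega>. (W 2 \<omega>)\<^sup>2) * q ^ n"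
    proof -
      have "expectation (\<lambda>\<omega>. (D k \<omega>)\<^sup>2) \<le> q ^ n" if "k \<in> letters" for k
        unfolding D_def using i that by (intro Suc.IH snoc_addresses)
      moreover have "0 \<le> expectation (\<lambda>\<omega>. (W k \<omega>)\<^sup>2)" for k
        by (intro Bochner_Integration.integral_nonneg) simp
      ultimately show ?thesis by (simp add: add_mono mult_left_mono)
    qed
    also have "\<dots> \<le> q * q ^ n"
      using q(3)[OF i] q(1) unfolding W_def distrib_right[symmetric]
      by (intro mult_right_mono) auto
    finally show ?case by simp
  qed
  then show ?thesis using q(1,2) by blast
qed

text \<open>The expectations of the absolute increments are summable, so the increments are
  absolutely summable almost surely.\<close>

lemma mass_converges: "AE \<omega> in M. \<forall>i\<in>addresses. convergent (\<lambda>n. Z n i \<omega>)"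
proof (subst AE_ball_countable)
  show "countable addresses" by (rule countableI_type)
  show "\<forall>i\<in>addresses. AE \<omega> in M. convergent (\<lambda>n. Z n i \<omega>)"
  proof
    fix i assume i: "i \<in> addresses"
    obtain q where q: "0 < q" "q < 1"
      "\<And>n. expectation (\<lambda>\<omega>. (Z (Suc n) i \<omega> - Z n i \<omega>)\<^sup>2) \<le> q ^ n"
      using mass_increment_second_moment i by blast
    define D where "D n \<omega> = Z (Suc n) i \<omega> - Z n i \<omega>" for n \<omega>
    \<comment> \<open>In the weighted bound of \<open>\<bar>D n \<omega>\<bar>\<close> by its
      square, the weight \<open>t ^ n\<close> with \<open>t = sqrt q\<close> balances the two parts:
      each is at most \<open>t ^ n\<close> in expectation before halving.\<close>
    define t where "t = sqrt q"
    have t: "0 < t" "t < 1" using q by (auto simp: t_def)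
    have "t * t = q" using q by (simp add: t_def)
    then have tq: "q ^ n / t ^ n = t ^ n" for n
      using t(1) by (simp add: power_mult_distrib[symmetric] divide_eq_eq)
    have D: "bounded_rv (subtree i) (D n)" for n
      unfolding D_def using i by (intro bounded_rv_diff bounded_rv_mass)
    have meas: "D n \<in> borel_measurable M" for n
      using D i by (auto simp: bounded_rv_def intro: info_measurable)
    have "(\<integral>\<^sup>+\<omega>. ennreal \<bar>D n \<omega>\<bar> \<partial>M) \<le> ennreal (t ^ n)" for n
    proof -
      have "\<bar>D n \<omega>\<bar> \<le> ((D n \<omega>)\<^sup>2 / t ^ n + t ^ n) / 2" for \<omega>
        using t(1) by (intro abs_le_weighted_square) simp
      then have "(\<integral>\<^sup>+\<omega>. ennreal \<bar>D n \<omega>\<bar> \<partial>M) \<le> (\<integral>\<^sup>+\<omega>. ennreal (((D n \<omega>)\<^sup>2 / t ^ n + t ^ n) / 2) \<partial>M)"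
        by (intro nn_integral_mono ennreal_leI)
      also have "\<dots> = ennreal (expectation (\<lambda>\<omega>. ((D n \<omega>)\<^sup>2 / t ^ n + t ^ n) / 2))"
        using t(1) bounded_rv_integrable[OF bounded_rv_power[OF D]]
        by (intro nn_integral_eq_integral) (auto intro!: AE_I2)
      also have "expectation (\<lambda>\<omega>. ((D n \<omega>)\<^sup>2 / t ^ n + t ^ n) / 2) = (expectation (\<lambda>\<omega>. (D n \<omega>)\<^sup>2) / t ^ n + t ^ n) / 2"
        using bounded_rv_integrable[OF bounded_rv_power[OF D]] by (simp add: prob_space)
      also have "\<dots> \<le> (q ^ n / t ^ n + t ^ n) / 2"
        using q(3)[of n] t(1) by (simp only: D_def) (intro divide_right_mono add_mono; simp)
      also have "\<dots> = t ^ n" by (simp add: tq)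
      finally show ?thesis by (simp add: ennreal_leI)
    qed
    then have "(\<Sum>n. \<integral>\<^sup>+\<omega>. ennreal \<bar>D n \<omega>\<bar> \<partial>M) \<le> (\<Sum>n. ennreal (t ^ n))"
      by (intro suminf_le) auto
    also have "\<dots> = ennreal (\<Sum>n. t ^ n)"
      using t by (intro suminf_ennreal2 summable_geometric) auto
    finally have "(\<Sum>n. \<integral>\<^sup>+\<omega>. ennreal \<bar>D n \<omega>\<bar> \<partial>M) < \<infinity>"
      by (simp add: order_le_less_trans)
    then have "(\<integral>\<^sup>+\<omega>. (\<Sum>n. ennreal \<bar>D n \<omega>\<bar>) \<partial>M) \<noteq> \<infinity>"
      using meas by (subst nn_integral_suminf) auto
    then have "AE \<omega> in M. (\<Sum>n. ennreal \<bar>D n \<omega>\<bar>) \<noteq> \<infinity>"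
      using meas by (intro nn_integral_noteq_infinite) auto
    then show "AE \<omega> in M. convergent (\<lambda>n. Z n i \<omega>)"
    proof eventually_elim
      case (elim \<omega>)
      then have "summable (\<lambda>n. \<bar>D n \<omega>\<bar>)"
        by (intro summable_suminf_not_top) auto
      then have "summable (\<lambda>n. D n \<omega>)" by (rule summable_rabs_cancel)
      then have "convergent (\<lambda>n. \<Sum>k<n. D k \<omega>)" by (simp add: summable_iff_convergent)
      moreover have "(\<Sum>k<n. D k \<omega>) = Z n i \<omega> - 1" for n
        unfolding D_def by (induction n) (simp_all del: mass.simps(2))
      ultimately have "convergent (\<lambda>n. (Z n i \<omega> - 1) + 1)"
        by (intro convergent_add convergent_const) simp
      then show ?case by simp
    qed
  qed
qed

section \<open>Positivity of the limits\<close>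

definition mass_limit :: "nat list \<Rightarrow> 'a \<Rightarrow> real" where
  "mass_limit i \<omega> = lim (\<lambda>n. Z n i \<omega>)"

lemma mass_tendsto: "AE \<omega> in M. \<forall>i\<in>addresses. (\<lambda>n. Z n i \<omega>) \<longlonglongrightarrow> mass_limit i \<omega>"
  using mass_converges by eventually_elim (auto simp: mass_limit_def convergent_LIMSEQ_iff)

lemma mass_limit_measurable: "subtree i \<subseteq> A \<Longrightarrow> mass_limit i \<in> borel_measurable (info A)"
  unfolding mass_limit_def by (intro borel_measurable_lim_metric mass_measurable)

lemma limit_recursion:
  assumes "\<forall>i\<in>addresses. (\<lambda>n. Z n i \<omega>) \<longlonglongrightarrow> mass_limit i \<omega>" and i: "i \<in> addresses"
  shows "mass_limit i \<omega> = w (i @ [1]) \<omega> * mass_limit (i @ [1]) \<omega> + w (i @ [2]) \<omega> * mass_limit (i @ [2]) \<omega>"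
proof (rule LIMSEQ_unique)
  show "(\<lambda>n. Z (Suc n) i \<omega>) \<longlonglongrightarrow> mass_limit i \<omega>"
    using assms by (intro LIMSEQ_Suc) auto
  show "(\<lambda>n. Z (Suc n) i \<omega>) \<longlonglongrightarrow>
      w (i @ [1]) \<omega> * mass_limit (i @ [1]) \<omega> + w (i @ [2]) \<omega> * mass_limit (i @ [2]) \<omega>"
    unfolding mass.simps using assms(1) snoc_addresses[OF i]
    by (intro tendsto_add tendsto_mult tendsto_const) auto
qed

lemma fatou_bound:
  assumes meas: "\<And>n. u n \<in> borel_measurable M"
    and lim: "AE \<omega> in M. (\<lambda>n. u n \<omega>) \<longlonglongrightarrow> l \<omega>"
    and le: "\<And>n. (\<integral>\<^sup>+\<omega>. u n \<omega> \<partial>M) \<le> b"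
  shows "(\<integral>\<^sup>+\<omega>. l \<omega> \<partial>M) \<le> (b :: ennreal)"
proof -
  have "AE \<omega> in M. l \<omega> = liminf (\<lambda>n. u n \<omega>)"
    using lim by eventually_elim (metis lim_imp_Liminf sequentially_bot)
  then have "(\<integral>\<^sup>+\<omega>. l \<omega> \<partial>M) = (\<integral>\<^sup>+\<omega>. liminf (\<lambda>n. u n \<omega>) \<partial>M)"
    by (rule nn_integral_cong_AE)
  also have "\<dots> \<le> liminf (\<lambda>n. \<integral>\<^sup>+\<omega>. u n \<omega> \<partial>M)"
    using meas by (rule nn_integral_liminf)
  also have "\<dots> \<le> b"
    using le by (intro Liminf_le) auto
  finally show ?thesis .
qed

text \<open>Fatou for \<open>(1 - Z\<^sub>n / B)\<^sup>2\<close>, where \<open>B\<close> bounds the second moments, keeps the probability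
  of a vanishing limit away from 1; the recursion then squares this bound at every level.\<close>

lemma mass_limit_zero_prob:
  "\<exists>r. 0 \<le> r \<and> r < 1 \<and>
    (\<forall>i\<in>addresses. expectation (\<lambda>\<omega>. indicator {0} (mass_limit i \<omega>)) \<le> (r :: real))"
proof -
  obtain B' where B': "\<And>n i. i \<in> addresses \<Longrightarrow> expectation (\<lambda>\<omega>. Z n i \<omega> ^ Suc 1) \<le> B'"
    using mass_moment_bound[of 1] by blast
  define B where "B = max 1 B'"
  have B: "1 \<le> B" "\<And>n i. i \<in> addresses \<Longrightarrow> expectation (\<lambda>\<omega>. (Z n i \<omega>)\<^sup>2) \<le> B"
    using B' by (auto simp: B_def numeral_2_eq_2 max.coboundedI2 simp del: power_Suc)
  have "expectation (\<lambda>\<omega>. indicator {0} (mass_limit i \<omega>)) \<le> 1 - 1 / B" if i: "i \<in> addresses" for i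
  proof -
    have m: "mass_limit i \<in> borel_measurable M"
      using mass_limit_measurable[OF order_refl] subtree_addresses[OF i] info_measurable by blast
    have "(\<integral>\<^sup>+\<omega>. ennreal ((1 - Z n i \<omega> / B)\<^sup>2) \<partial>M) \<le> ennreal (1 - 1 / B)" for n
    proof -
      have Z: "bounded_rv (subtree i) (Z n i)" using i by (rule bounded_rv_mass)
      have int: "integrable M (Z n i)" "integrable M (\<lambda>\<omega>. (Z n i \<omega>)\<^sup>2)"
        using bounded_rv_integrable[OF Z] bounded_rv_integrable[OF bounded_rv_power[OF Z]] by auto
      \<comment> \<open>The scaling \<open>t = 1 / B\<close> minimises
        \<open>1 - 2 * t + t\<^sup>2 * B\<close>, the bound given by mean 1 and second moment at
        most \<open>B\<close>.\<close>
      have eq: "(1 - Z n i \<omega> / B)\<^sup>2 = 1 - 2 / B * Z n i \<omega> + 1 / B\<^sup>2 * (Z n i \<omega>)\<^sup>2" for \<omega>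
        by (simp add: power2_diff power_divide)
      have "integrable M (\<lambda>\<omega>. (1 - Z n i \<omega> / B)\<^sup>2)" unfolding eq using int by simp
      then have "(\<integral>\<^sup>+\<omega>. ennreal ((1 - Z n i \<omega> / B)\<^sup>2) \<partial>M) = ennreal (expectation (\<lambda>\<omega>. (1 - Z n i \<omega> / B)\<^sup>2))"
        by (intro nn_integral_eq_integral) auto
      also have "expectation (\<lambda>\<omega>. (1 - Z n i \<omega> / B)\<^sup>2) = 1 - 2 / B + 1 / B\<^sup>2 * expectation (\<lambda>\<omega>. (Z n i \<omega>)\<^sup>2)"
        unfolding eq using int expectation_mass[OF i, of n] by (simp add: prob_space)
      also have "\<dots> \<le> 1 - 2 / B + 1 / B\<^sup>2 * B"
        using B i by (intro add_left_mono mult_left_mono) auto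
      also have "\<dots> = 1 - 1 / B" using B by (simp add: power2_eq_square field_simps)
      finally show ?thesis by (simp add: ennreal_leI)
    qed
    then have "(\<integral>\<^sup>+\<omega>. ennreal ((1 - mass_limit i \<omega> / B)\<^sup>2) \<partial>M) \<le> ennreal (1 - 1 / B)"
    proof (rule fatou_bound[rotated 2])
      show "(\<lambda>\<omega>. ennreal ((1 - Z n i \<omega> / B)\<^sup>2)) \<in> borel_measurable M" for n
        using info_measurable[OF subtree_addresses[OF i] mass_measurable[OF order_refl]] by measurable
      show "AE \<omega> in M. (\<lambda>n. ennreal ((1 - Z n i \<omega> / B)\<^sup>2)) \<longlonglongrightarrow> ennreal ((1 - mass_limit i \<omega> / B)\<^sup>2)"
        using mass_tendsto
      proof eventually_elim
        case (elim \<omega>)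
        then show ?case using i B(1) by (intro tendsto_ennrealI tendsto_intros) auto
      qed
    qed
    \<comment> \<open>The square is 1 where the limit is 0, so it dominates the indicator.\<close>
    moreover have "(\<integral>\<^sup>+\<omega>. ennreal (indicator {0} (mass_limit i \<omega>)) \<partial>M) \<le>
        (\<integral>\<^sup>+\<omega>. ennreal ((1 - mass_limit i \<omega> / B)\<^sup>2) \<partial>M)"
      by (intro nn_integral_mono ennreal_leI) (auto simp: indicator_def)
    moreover have "(\<integral>\<^sup>+\<omega>. ennreal (indicator {0} (mass_limit i \<omega>)) \<partial>M) =
        ennreal (expectation (\<lambda>\<omega>. indicator {0} (mass_limit i \<omega>)))"
    proof (rule nn_integral_eq_integral)
      show "integrable M (\<lambda>\<omega>. indicator {0} (mass_limit i \<omega>) :: real)"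
        using m by (intro integrable_const_bound[of _ 1]) auto
    qed simp
    ultimately have "ennreal (expectation (\<lambda>\<omega>. indicator {0} (mass_limit i \<omega>))) \<le> ennreal (1 - 1 / B)"
      by simp
    then show ?thesis using B(1) by (subst (asm) ennreal_le_iff) auto
  qed
  then show ?thesis using B(1) by (intro exI[of _ "1 - 1 / B"]) auto
qed

lemma bounded_rv_limit_zero:
  assumes "i \<in> addresses"
  shows "bounded_rv (subtree i) (\<lambda>\<omega>. indicator {0} (mass_limit i \<omega>))"
  unfolding bounded_rv_def
proof (intro conjI exI[of _ 1] ballI)
  show "subtree i \<subseteq> addresses" using assms by (rule subtree_addresses)
  show "(\<lambda>\<omega>. indicator {0} (mass_limit i \<omega>) :: real) \<in> borel_measurable (info (subtree i))"
    using mass_limit_measurable[of i "subtree i"] by measurable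
qed (simp add: indicator_def)

lemma mass_limit_positive: "AE \<omega> in M. \<forall>i\<in>addresses. 0 < mass_limit i \<omega>"
proof (subst AE_ball_countable)
  show "countable addresses" by (rule countableI_type)
  obtain r :: real where r: "0 \<le> r" "r < 1"
    "\<And>i. i \<in> addresses \<Longrightarrow> expectation (\<lambda>\<omega>. indicator {0} (mass_limit i \<omega>)) \<le> r"
    using mass_limit_zero_prob by blast
  let ?e = "\<lambda>i. expectation (\<lambda>\<omega>. indicator {0} (mass_limit i \<omega>)) :: real"
  have nonneg: "AE \<omega> in M. \<forall>i\<in>addresses. 0 \<le> mass_limit i \<omega>"
    using mass_tendsto AE_space
  proof eventually_elim
    case (elim \<omega>)
    show ?case
    proof
      fix i assume "i \<in> addresses"
      then show "0 \<le> mass_limit i \<omega>"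
        using elim mass_bounds(1)[of i \<omega>] by (intro LIMSEQ_le_const[of "\<lambda>n. Z n i \<omega>"]) auto
    qed
  qed
  have "?e i \<le> r ^ n" if "i \<in> addresses" for n i
    using that
  proof (induction n arbitrary: i)
    case 0
    have "?e i \<le> 1" using r(2,3) 0 by fastforce
    then show ?case by simp
  next
    case (Suc n)
    note i = Suc.prems
    let ?I = "\<lambda>k \<omega>. indicator {0} (mass_limit (i @ [k]) \<omega>) :: real"
    have I: "bounded_rv (subtree (i @ [k])) (?I k)" if "k \<in> letters" for k
      using i that by (intro bounded_rv_limit_zero snoc_addresses)
    have A: "bounded_rv addresses (?I k)" if "k \<in> letters" for k
      using i that by (auto intro!: bounded_rv_mono[OF I] subtree_addresses snoc_addresses)
    \<comment> \<open>As the weights are non-zero and the limits non-negative, the limit at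
      \<open>i\<close> can vanish only if those of both children do. Bounding one of the two
      independent factors by \<open>r\<close> and the other by induction gives decay in
      \<open>n\<close>.\<close>
    have "?e i \<le> expectation (\<lambda>\<omega>. ?I 1 \<omega> * ?I 2 \<omega>)"
    proof (rule integral_mono_AE)
      show "AE \<omega> in M. indicator {0} (mass_limit i \<omega>) \<le> ?I 1 \<omega> * ?I 2 \<omega>"
        using nonneg mass_tendsto w_nonzero AE_space
      proof eventually_elim
        case (elim \<omega>)
        have *: "0 < w (i @ [k]) \<omega>" "0 \<le> mass_limit (i @ [k]) \<omega>" if "k \<in> letters" for k
          using elim snoc_addresses[OF i that] w_bounds(1)[OF i that, of \<omega>] by (auto simp: less_le)
        show ?case
          using limit_recursion[OF elim(2) i] *[of 1] *[of 2]
          by (auto simp: indicator_def add_nonneg_eq_0_iff)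
      qed
      show "integrable M (\<lambda>\<omega>. indicator {0} (mass_limit i \<omega>) :: real)"
        by (intro bounded_rv_integrable[OF bounded_rv_limit_zero] i)
      show "integrable M (\<lambda>\<omega>. ?I 1 \<omega> * ?I 2 \<omega>)"
        by (intro bounded_rv_integrable[of addresses] bounded_rv_mult A) auto
    qed
    also have "\<dots> = ?e (i @ [1]) * ?e (i @ [2])"
      by (intro expectation_mult[OF subtree_disjoint[of 1 2 i]] I) auto
    also have "\<dots> \<le> r * r ^ n"
      using r i by (intro mult_mono Suc.IH r(3) snoc_addresses) auto
    finally show ?case by simp
  qed
  moreover have "(\<lambda>n. r ^ n) \<longlonglongrightarrow> 0" using r by (intro LIMSEQ_realpow_zero)
  ultimately have le: "?e i \<le> 0" if "i \<in> addresses" for i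
    using that by (intro LIMSEQ_le_const[of "\<lambda>n. r ^ n"]) auto
  show "\<forall>i\<in>addresses. AE \<omega> in M. 0 < mass_limit i \<omega>"
  proof
    fix i assume i: "i \<in> addresses"
    have "0 \<le> ?e i" by (intro Bochner_Integration.integral_nonneg) simp
    then have "?e i = 0" using le[OF i] by linarith
    then have "AE \<omega> in M. indicator {0} (mass_limit i \<omega>) = (0 :: real)"
      using integral_nonneg_eq_0_iff_AE[OF bounded_rv_integrable[OF bounded_rv_limit_zero[OF i]]]
      by auto
    then show "AE \<omega> in M. 0 < mass_limit i \<omega>"
      using nonneg by eventually_elim (use i in \<open>auto simp: indicator_def less_le split: if_splits\<close>)
  qed
qed

section \<open>Decay of the edge sums\<close>

lemma mass_powr_bound:
  assumes "0 \<le> s"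
  shows "\<exists>K\<ge>0. \<forall>n. \<forall>i\<in>addresses. expectation (\<lambda>\<omega>. Z n i \<omega> powr s) \<le> K"
proof -
  define p where "p = nat \<lceil>s\<rceil>"
  obtain B where B: "\<And>n i. i \<in> addresses \<Longrightarrow> expectation (\<lambda>\<omega>. Z n i \<omega> ^ Suc p) \<le> B"
    using mass_moment_bound[of p] by blast
  have "expectation (\<lambda>\<omega>. Z n i \<omega> powr s) \<le> max 0 (1 + B)" if i: "i \<in> addresses" for n i
  proof -
    have "Z n i \<omega> powr s \<le> 1 + Z n i \<omega> ^ Suc p" if "\<omega> \<in> space M" for \<omega>
    proof -
      let ?x = "Z n i \<omega>"
      have x: "0 \<le> ?x" using mass_bounds(1)[OF i that] .
      show ?thesis
      proof (cases "?x \<le> 1")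
        case True
        then have "?x powr s \<le> 1 powr s" using x assms by (intro powr_mono2)
        moreover have "0 \<le> ?x ^ Suc p" using x by simp
        ultimately show ?thesis by simp
      next
        case False
        have "s \<le> real (Suc p)" unfolding p_def by linarith
        then have "?x powr s \<le> ?x powr real (Suc p)" using False by (intro powr_mono) auto
        also have "\<dots> = ?x ^ Suc p" using False by (intro powr_realpow) auto
        finally show ?thesis by simp
      qed
    qed
    then have "expectation (\<lambda>\<omega>. Z n i \<omega> powr s) \<le> expectation (\<lambda>\<omega>. 1 + Z n i \<omega> ^ Suc p)"
      using assms
      by (intro integral_mono bounded_rv_integrable[of "subtree i"] bounded_rv_add bounded_rv_const
          bounded_rv_powr bounded_rv_power bounded_rv_mass subtree_addresses i)
    also have "\<dots> = 1 + expectation (\<lambda>\<omega>. Z n i \<omega> ^ Suc p)"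
      using bounded_rv_integrable[OF bounded_rv_power[OF bounded_rv_mass[OF i]]]
      by (simp add: prob_space del: power_Suc)
    also have "\<dots> \<le> max 0 (1 + B)" using B[OF i, of n] by linarith
    finally show ?thesis .
  qed
  then show ?thesis by (intro exI[of _ "max 0 (1 + B)"]) auto
qed

text \<open>The indices of the triples that determine \<open>cascade\<close> at \<open>i\<close>.
  The last weight belongs to the parent, so only proper prefixes occur; the set is thus disjoint
  from \<open>subtree i\<close>, which makes cascade and mass at \<open>i\<close>
  independent.\<close>

definition ancestors :: "nat list \<Rightarrow> nat list set" where
  "ancestors i = (\<lambda>m. take m i) ` {..<length i}"

lemma ancestors_addresses: "i \<in> addresses \<Longrightarrow> ancestors i \<subseteq> addresses"
  unfolding ancestors_def addresses_iff using set_take_subset[of _ i] addresses_iff by blast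

lemma ancestors_snoc: "ancestors (i @ [k]) = insert i (ancestors i)"
  by (auto simp: ancestors_def lessThan_Suc image_iff)

lemma ancestors_subtree: "ancestors i \<inter> subtree i = {}"
proof -
  have "length j < length i" if "j \<in> ancestors i" for j using that by (auto simp: ancestors_def)
  moreover have "length i \<le> length j" if "j \<in> subtree i" for j using that by (auto simp: subtree_def)
  ultimately show ?thesis by fastforce
qed

abbreviation (input) L :: "nat list \<Rightarrow> 'a \<Rightarrow> real" where
  "L i \<omega> \<equiv> cascade (\<lambda>i. w i \<omega>) i"

lemma bounded_rv_cascade:
  assumes "i \<in> addresses" shows "bounded_rv (ancestors i) (L i)"
  using assms
proof (induction i rule: rev_induct)
  case Nil
  then show ?case using bounded_rv_const[of "{}"] by (simp add: ancestors_def)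
next
  case (snoc k i)
  then have i: "i \<in> addresses" "k \<in> letters" by (auto simp: addresses_iff)
  have A: "insert i (ancestors i) \<subseteq> addresses" using i ancestors_addresses by auto
  show ?case
    unfolding cascade_snoc ancestors_snoc using snoc.IH[OF i(1)] A i
    by (intro bounded_rv_mult bounded_rv_w) (auto intro: bounded_rv_mono)
qed

lemma cascade_nonneg:
  assumes "i \<in> addresses" "\<omega> \<in> space M" shows "0 \<le> L i \<omega>"
  using assms(1)
proof (induction i rule: rev_induct)
  case (snoc k i)
  then have i: "i \<in> addresses" "k \<in> letters" by (auto simp: addresses_iff)
  then show ?case using snoc.IH w_bounds(1)[OF i assms(2)] by (simp add: cascade_snoc)
qed simp

text \<open>The triple at \<open>i\<close> is independent of the cascade at \<open>i\<close>, so
  each generation multiplies the sum by the same factor; summing over the letters takes care of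
  dependence within a triple.\<close>

lemma sum_cascade_moment:
  assumes "0 \<le> s"
  shows "(\<Sum>i\<in>words letters n. expectation (\<lambda>\<omega>. L i \<omega> powr s)) =
    expectation (\<lambda>\<omega>. \<Sum>k\<in>letters. w [k] \<omega> powr s) ^ n"
proof (induction n)
  case 0
  then show ?case by (simp add: prob_space)
next
  case (Suc n)
  let ?q = "expectation (\<lambda>\<omega>. \<Sum>k\<in>letters. w [k] \<omega> powr s)"
  have "(\<Sum>k\<in>letters. expectation (\<lambda>\<omega>. L (i @ [k]) \<omega> powr s)) = expectation (\<lambda>\<omega>. L i \<omega> powr s) * ?q"
    if "i \<in> words letters n" for i
  proof -
    have i: "i \<in> addresses" using that by (rule words_addresses)
    have W: "bounded_rv {i} (\<lambda>\<omega>. w (i @ [k]) \<omega> powr s)" if "k \<in> letters" for k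
      using i that assms by (intro bounded_rv_powr bounded_rv_weight)
    have C: "bounded_rv (ancestors i) (\<lambda>\<omega>. L i \<omega> powr s)"
      using assms by (intro bounded_rv_powr bounded_rv_cascade i)
    have disj: "ancestors i \<inter> {i} = {}" using ancestors_subtree[of i] subtree_self[of i] by blast
    have "expectation (\<lambda>\<omega>. L (i @ [k]) \<omega> powr s) =
        expectation (\<lambda>\<omega>. L i \<omega> powr s) * expectation (\<lambda>\<omega>. w (i @ [k]) \<omega> powr s)" if "k \<in> letters" for k
      unfolding cascade_snoc powr_mult by (rule expectation_mult[OF disj C W[OF that]])
    then have "(\<Sum>k\<in>letters. expectation (\<lambda>\<omega>. L (i @ [k]) \<omega> powr s)) =
        expectation (\<lambda>\<omega>. L i \<omega> powr s) * (\<Sum>k\<in>letters. expectation (\<lambda>\<omega>. w (i @ [k]) \<omega> powr s))"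
      by (simp add: sum_distrib_left)
    also have "(\<Sum>k\<in>letters. expectation (\<lambda>\<omega>. w (i @ [k]) \<omega> powr s)) =
        expectation (\<lambda>\<omega>. \<Sum>k\<in>letters. w (i @ [k]) \<omega> powr s)"
      by (intro Bochner_Integration.integral_sum[symmetric] bounded_rv_integrable[OF W])
    also have "\<dots> = ?q" by (intro expectation_weights[OF i]) auto
    finally show ?thesis .
  qed
  then show ?case
    using Suc by (simp add: sum_words_Suc sum_distrib_right[symmetric] mult.commute)
qed

text \<open>The expected sum over level \<open>n\<close> is of order \<open>?q ^ n\<close>. Divided
  by \<open>q ^ n\<close> for a slightly larger \<open>q < 1\<close>, the expectations remain
  summable in \<open>n\<close>, so the normalised sums are summable almost surely; their total is
  the random constant \<open>C\<close>.\<close>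

lemma edge_sum_decay:
  assumes \<alpha>: "0 < \<alpha>" "expectation (\<lambda>\<omega>. \<Sum>k\<in>letters. w [k] \<omega> powr \<alpha>) = 1" and s: "\<alpha> < s"
  shows "AE \<omega> in M. \<exists>C q. 0 < q \<and> q < 1 \<and>
    (\<forall>n. (\<Sum>i\<in>words letters n. (L i \<omega> * mass_limit i \<omega>) powr s) \<le> C * q ^ n)"
proof -
  let ?q = "expectation (\<lambda>\<omega>. \<Sum>k\<in>letters. w [k] \<omega> powr s)"
  have q0: "0 \<le> ?q" by (intro Bochner_Integration.integral_nonneg sum_nonneg) auto
  have q1: "?q < 1"
    using \<alpha> s by (intro expectation_powr_less[of letters \<alpha> s]) auto
  define q where "q = (1 + ?q) / 2"
  have q: "0 < q" "q < 1" "?q / q < 1" using q0 q1 by (auto simp: q_def field_simps)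
  obtain K where K: "K \<ge> 0" "\<And>n i. i \<in> addresses \<Longrightarrow> expectation (\<lambda>\<omega>. Z n i \<omega> powr s) \<le> K"
    using mass_powr_bound[of s] \<alpha>(1) s by auto
  define S where "S n \<omega> = (\<Sum>i\<in>words letters n. (L i \<omega> * mass_limit i \<omega>) powr s)" for n \<omega>
  have A: "bounded_rv addresses (L i)" "bounded_rv addresses (Z m i)" if "i \<in> addresses" for i m
    using that by (auto intro!: bounded_rv_mono[OF bounded_rv_cascade] bounded_rv_mono[OF bounded_rv_mass]
        ancestors_addresses subtree_addresses)
  have meas: "S n \<in> borel_measurable M" for n
  proof -
    have "mass_limit i \<in> borel_measurable M" "L i \<in> borel_measurable M" if "i \<in> addresses" for i
      using that mass_limit_measurable[OF subtree_addresses[OF that]] A(1)[OF that] info_measurable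
      by (auto simp: bounded_rv_def)
    then show ?thesis
      unfolding S_def
      by (intro borel_measurable_sum powr_real_measurable borel_measurable_times borel_measurable_const)
        (auto dest: words_addresses)
  qed
  \<comment> \<open>By Fatou: independence and the moment bounds are applied to the partial masses,
    which are bounded, and then carried over to the limit.\<close>
  have "(\<integral>\<^sup>+\<omega>. ennreal (S n \<omega>) \<partial>M) \<le> ennreal (K * ?q ^ n)" for n
  proof (rule fatou_bound)
    let ?u = "\<lambda>m \<omega>. \<Sum>i\<in>words letters n. (L i \<omega> * Z m i \<omega>) powr s"
    have u: "bounded_rv addresses (?u m)" for m
      using \<alpha>(1) s
      by (intro bounded_rv_sum bounded_rv_powr bounded_rv_mult A) (auto dest: words_addresses)
    show "(\<lambda>\<omega>. ennreal (?u m \<omega>)) \<in> borel_measurable M" for m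
      using u[of m] unfolding bounded_rv_def
      by (intro measurable_compose[OF info_measurable[of addresses] measurable_ennreal]) blast+
    show "AE \<omega> in M. (\<lambda>m. ennreal (?u m \<omega>)) \<longlonglongrightarrow> ennreal (S n \<omega>)"
      using mass_tendsto AE_space
    proof eventually_elim
      case (elim \<omega>)
      show ?case
        unfolding S_def
      proof (intro tendsto_ennrealI tendsto_sum tendsto_powr' tendsto_mult tendsto_const disjI2 conjI)
        fix i assume "i \<in> words letters n"
        then have i: "i \<in> addresses" by (rule words_addresses)
        then show "(\<lambda>m. Z m i \<omega>) \<longlonglongrightarrow> mass_limit i \<omega>" using elim by blast
        show "\<forall>\<^sub>F m in sequentially. 0 \<le> L i \<omega> * Z m i \<omega>"
          using cascade_nonneg[OF i elim(2)] mass_bounds(1)[OF i elim(2)] by simp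
      qed (use \<alpha>(1) s in auto)
    qed
    show "(\<integral>\<^sup>+\<omega>. ennreal (?u m \<omega>) \<partial>M) \<le> ennreal (K * ?q ^ n)" for m
    proof -
      have "(\<integral>\<^sup>+\<omega>. ennreal (?u m \<omega>) \<partial>M) = ennreal (expectation (?u m))"
        by (intro nn_integral_eq_integral bounded_rv_integrable[OF u]) (simp add: sum_nonneg)
      also have "expectation (?u m) = (\<Sum>i\<in>words letters n. expectation (\<lambda>\<omega>. (L i \<omega> * Z m i \<omega>) powr s))"
        using \<alpha>(1) s
        by (intro Bochner_Integration.integral_sum bounded_rv_integrable[of addresses] bounded_rv_powr
            bounded_rv_mult A) (auto dest: words_addresses)
      also have "\<dots> \<le> (\<Sum>i\<in>words letters n. expectation (\<lambda>\<omega>. L i \<omega> powr s) * K)"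
      proof (rule sum_mono)
        fix i assume "i \<in> words letters n"
        then have i: "i \<in> addresses" by (rule words_addresses)
        have "expectation (\<lambda>\<omega>. (L i \<omega> * Z m i \<omega>) powr s) =
            expectation (\<lambda>\<omega>. L i \<omega> powr s) * expectation (\<lambda>\<omega>. Z m i \<omega> powr s)"
          unfolding powr_mult using \<alpha>(1) s i
          by (intro expectation_mult[OF ancestors_subtree[of i]] bounded_rv_powr bounded_rv_cascade
              bounded_rv_mass) auto
        also have "\<dots> \<le> expectation (\<lambda>\<omega>. L i \<omega> powr s) * K"
          by (intro mult_left_mono K(2)[OF i] Bochner_Integration.integral_nonneg) auto
        finally show "expectation (\<lambda>\<omega>. (L i \<omega> * Z m i \<omega>) powr s) \<le> expectation (\<lambda>\<omega>. L i \<omega> powr s) * K" .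
      qed
      also have "\<dots> = K * ?q ^ n"
        using sum_cascade_moment[of s n] \<alpha>(1) s by (simp add: sum_distrib_right[symmetric])
      finally show ?thesis by (simp add: ennreal_leI)
    qed
  qed
  then have int: "(\<integral>\<^sup>+\<omega>. ennreal (S n \<omega> / q ^ n) \<partial>M) \<le> ennreal (K * (?q / q) ^ n)" for n
  proof -
    have "(\<integral>\<^sup>+\<omega>. ennreal (S n \<omega> / q ^ n) \<partial>M) = (\<integral>\<^sup>+\<omega>. ennreal (1 / q ^ n) * ennreal (S n \<omega>) \<partial>M)"
      using q(1) by (intro nn_integral_cong) (simp add: ennreal_mult'[symmetric])
    also have "\<dots> = ennreal (1 / q ^ n) * (\<integral>\<^sup>+\<omega>. ennreal (S n \<omega>) \<partial>M)"
      using meas by (intro nn_integral_cmult) auto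
    also have "\<dots> \<le> ennreal (1 / q ^ n) * ennreal (K * ?q ^ n)"
      using \<open>\<And>n. (\<integral>\<^sup>+\<omega>. ennreal (S n \<omega>) \<partial>M) \<le> ennreal (K * ?q ^ n)\<close> by (intro mult_left_mono) auto
    also have "\<dots> = ennreal (K * (?q / q) ^ n)"
      using q(1) by (simp add: ennreal_mult'[symmetric] power_divide)
    finally show ?thesis .
  qed
  have "(\<integral>\<^sup>+\<omega>. (\<Sum>n. ennreal (S n \<omega> / q ^ n)) \<partial>M) = (\<Sum>n. \<integral>\<^sup>+\<omega>. ennreal (S n \<omega> / q ^ n) \<partial>M)"
    using meas by (intro nn_integral_suminf) auto
  also have "\<dots> \<le> (\<Sum>n. ennreal (K * (?q / q) ^ n))"
    using int by (intro suminf_le) auto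
  also have "\<dots> = ennreal (\<Sum>n. K * (?q / q) ^ n)"
    using K(1) q0 q by (intro suminf_ennreal2 summable_mult summable_geometric) auto
  finally have "(\<integral>\<^sup>+\<omega>. (\<Sum>n. ennreal (S n \<omega> / q ^ n)) \<partial>M) \<noteq> \<infinity>"
    using ennreal_less_top by (auto simp: top_unique)
  then have "AE \<omega> in M. (\<Sum>n. ennreal (S n \<omega> / q ^ n)) \<noteq> \<infinity>"
    using meas by (intro nn_integral_noteq_infinite) auto
  then show ?thesis
  proof eventually_elim
    case (elim \<omega>)
    have S0: "0 \<le> S n \<omega> / q ^ n" for n
      using q(1) by (auto simp: S_def intro!: divide_nonneg_pos sum_nonneg)
    have sum: "summable (\<lambda>n. S n \<omega> / q ^ n)"
      using elim S0 by (intro summable_suminf_not_top) auto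
    have "S n \<omega> \<le> (\<Sum>n. S n \<omega> / q ^ n) * q ^ n" for n
    proof -
      have "(\<Sum>n\<in>{n}. S n \<omega> / q ^ n) \<le> (\<Sum>n. S n \<omega> / q ^ n)"
        using S0 by (intro sum_le_suminf sum) auto
      then show ?thesis using q(1) by (simp add: divide_le_eq)
    qed
    then show ?case
      using q(1,2) by (intro exI[of _ "\<Sum>n. S n \<omega> / q ^ n"] exI[of _ q]) (auto simp: S_def)
  qed
qed

section \<open>The upper bound for the dimension\<close>

lemma hausdorff_measure_resistance:
  assumes c: "0 < c" "c < 1 / 2"
    and \<alpha>: "0 < \<alpha>" "expectation (\<lambda>\<omega>. \<Sum>k\<in>letters. w [k] \<omega> powr \<alpha>) = 1" and s: "\<alpha> < s"
  shows "AE \<omega> in M. hausdorff_measure (fractal c) (resistance c (\<lambda>i. w i \<omega>)) s = 0"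
  using w_nonzero mass_tendsto mass_limit_positive edge_sum_decay[OF \<alpha> s] AE_space
proof eventually_elim
  case (elim \<omega>)
  let ?v = "\<lambda>i. w i \<omega>"
  obtain C q where q: "0 < q" "q < 1"
    "\<And>n. (\<Sum>i\<in>words letters n. (L i \<omega> * mass_limit i \<omega>) powr s) \<le> C * q ^ n"
    using elim(4) by blast
  \<comment> \<open>Where no weight vanishes, the quotients in \<open>cascade_limit\<close> cancel
    and give the recursive masses.\<close>
  have edge: "edge_resistance ?v i = L i \<omega> * mass_limit i \<omega>" if "i \<in> addresses" for i
  proof -
    have "cascade_limit ?v i = mass_limit i \<omega>"
      unfolding cascade_limit_def mass_limit_def using elim(1) that by (subst mass_eq_sum) auto
    then show ?thesis by (simp add: edge_resistance_def)
  qed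
  interpret decaying_resistance_form c ?v s q C
  proof
    fix i assume i: "i \<in> addresses"
    have "L i \<omega> \<noteq> 0" using elim(1) i by (intro cascade_nonzero) auto
    then have "0 < L i \<omega>" using cascade_nonneg[OF i elim(5)] by simp
    then show "0 < edge_resistance ?v i" using edge[OF i] elim(3) i by simp
    show "edge_resistance ?v i = edge_resistance ?v (i @ [1]) + edge_resistance ?v (i @ [2])"
      using limit_recursion[OF elim(2) i] edge[OF i] edge[OF snoc_addresses[OF i, of 1]]
        edge[OF snoc_addresses[OF i, of 2]]
      by (simp add: cascade_snoc algebra_simps)
  next
    fix n
    have "(\<Sum>i\<in>words letters n. edge_resistance ?v i powr s) =
        (\<Sum>i\<in>words letters n. (L i \<omega> * mass_limit i \<omega>) powr s)"
      by (intro sum.cong) (auto simp: edge words_addresses)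
    then show "(\<Sum>i\<in>words letters n. edge_resistance ?v i powr s) \<le> C * q ^ n" using q(3)[of n] by simp
  qed (use c q \<alpha> s in auto)
  show ?case by (rule hausdorff_measure_fractal)
qed

end

theorem theorem4:
  fixes M :: "'a measure" and w :: "nat list \<Rightarrow> 'a \<Rightarrow> real" and c \<alpha> :: real
  assumes c: "0 < c" "c < 1 / 2"
    and cascade: "random_cascade M w"
    and mean: "prob_space.expectation M (\<lambda>\<omega>. w [1] \<omega> + w [2] \<omega>) = 1"
    and nondegenerate: "(\<Sum>k\<in>letters. prob_space.prob M {\<omega> \<in> space M. w [k] \<omega> = 1}) < 1"
    and alpha: "0 < \<alpha>"
      "prob_space.expectation M (\<lambda>\<omega>. \<Sum>k\<in>letters. w [k] \<omega> powr \<alpha>) = 1"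
  shows "AE \<omega> in M. hausdorff_dim (fractal c) (resistance c (\<lambda>i. w i \<omega>)) \<le> ereal \<alpha>"
proof -
  interpret prob_space M using cascade by (simp add: random_cascade_def)
  interpret cascade_space M w
    using cascade mean by unfold_locales
  \<comment> \<open>The exceptional null set depends on the exponent, so countably many exponents
    are treated together; a sequence decreasing to \<alpha> suffices for the infimum.\<close>
  let ?s = "\<lambda>n. \<alpha> + 1 / real (Suc n)"
  have "AE \<omega> in M. \<forall>n. hausdorff_measure (fractal c) (resistance c (\<lambda>i. w i \<omega>)) (?s n) = 0"
    unfolding AE_all_countable using hausdorff_measure_resistance[OF c alpha] by simp
  then show ?thesis
  proof eventually_elim
    case (elim \<omega>)
    have "hausdorff_dim (fractal c) (resistance c (\<lambda>i. w i \<omega>)) \<le> ereal (?s n)" for n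
      unfolding hausdorff_dim_def using elim alpha(1)
      by (intro Inf_lower) (auto simp: add_pos_pos intro!: exI[of _ "?s n"])
    moreover have "(\<lambda>n. ereal (?s n)) \<longlonglongrightarrow> ereal (\<alpha> + 0)"
      by (intro tendsto_ereal tendsto_add tendsto_const LIMSEQ_Suc[OF lim_1_over_n])
    ultimately show ?case by (intro LIMSEQ_le_const[of "\<lambda>n. ereal (?s n)"]) auto
  qed
qed

end
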